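(* Let $t\geqslant 1$ and let $v\in\mathbb{C}$ be a primitive root of unity of order $2t$. Let $\overline{\Lambda}$ be the shuffle algebra over $\mathbb{C}$ (with parameter $v$) defined in the context and let $\Lambda^{\zeta}\subset\overline{\Lambda}$ be the subalgebra generated by $\overline{\Lambda}_{1,0}\oplus\overline{\Lambda}_{0,1}$. Then for any $f\in\overline{\Lambda}$, one has $f\in\Lambda^{\zeta}$ if and only if $f$ satisfies the wheel condition (defined in the context).
   Context: $\mathbb{N}$ includes $0$. $\overline{\Lambda}=\bigoplus_{n,m\in\mathbb{N}}\overline{\Lambda}_{n,m}$, where $\overline{\Lambda}_{n,m}$ is the $\mathbb{C}$-space of rational functions $F$ in $x_1,\dots,x_n,y_1,\dots,y_m$ that are skew-symmetric in $\{x_i\}$ and skew-symmetric in $\{y_j\}$ and have the form $F=\frac{f}{\prod_{1\leqslant i\leqslant n,\,1\leqslant j\leqslant m}(x_i-y_j)}$ with $f\in\mathbb{C}[x_i^{\pm1},y_j^{\pm1}]$ a Laurent polynomial (the numerator of $F$). For $F\in\overline{\Lambda}_{k_1,l_1}$, $G\in\overline{\Lambda}_{k_2,l_2}$ the shuffle product $F\star G\in\overline{\Lambda}_{k_1+k_2,l_1+l_2}$ is $$F\star G=\mathrm{ASym}_{\mathfrak{S}_{k_1+k_2}\times\mathfrak{S}_{l_1+l_2}}\Big(F(\{x_i,y_j\}_{1\leqslant i\leqslant k_1}^{1\leqslant j\leqslant l_1})\,G(\{x_i,y_j\}_{k_1<i\leqslant k_1+k_2}^{l_1<j\leqslant l_1+l_2})\prod_{1\leqslant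 i\leqslant k_1}^{l_1<j\leqslant l_1+l_2}\frac{x_i+v^{-1}y_j}{x_i-y_j}\prod_{k_1<i\leqslant k_1+k_2}^{1\leqslant j\leqslant l_1}\frac{y_j+v^{-1}x_i}{y_j-x_i}\Big),$$ where $\mathrm{ASym}_{\mathfrak{S}_n\times\mathfrak{S}_m}(f)=\frac{1}{n!m!}\sum_{\sigma\in\mathfrak{S}_n,\tau\in\mathfrak{S}_m}\mathrm{sign}(\sigma)\mathrm{sign}(\tau)f(x_{\sigma(1)},\dots,x_{\sigma(n)},y_{\tau(1)},\dots,y_{\tau(m)})$. This makes $\overline{\Lambda}$ an associative $\mathbb{C}$-algebra. Wheel condition: $F\in\overline{\Lambda}_{n,m}$ satisfies the wheel condition if its numerator $f(x_1,\dots,x_n,y_1,\dots,y_m)$ vanishes whenever $$\frac{x_1}{y_1}=\frac{y_1}{x_2}=\frac{x_2}{y_2}=\cdots=\frac{x_t}{y_t}=\frac{y_t}{x_1}=-v^{-1}$$ (an empty condition if $\min\{n,m\}<t$). A general element of $\overline{\Lambda}$ satisfies the wheel condition if all of its homogeneous components do. *)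

theory Defs
  imports
    Complex_Main
    "HOL-Library.Poly_Mapping"
    "HOL-Computational_Algebra.Polynomial_Factorial"
    "HOL-Combinatorics.Permutations"
begin

section \<open>Laurent polynomials and rational functions\<close>

text \<open>
  All variables \<open>x\<^sub>i\<close>, \<open>y\<^sub>j\<close> live in one ring; indices start at 0, so that the variables
  of bidegree \<open>(n, m)\<close> are \<open>X 0, \<dots>, X (n - 1), Y 0, \<dots>, Y (m - 1)\<close>.
\<close>

datatype var = X nat | Y nat

text \<open>The order has no mathematical content: the \<open>idom\<close> instance of \<^typ>\<open>'a \<Rightarrow>\<^sub>0 'b\<close> needs one.\<close>

instantiation var :: linorder
begin

fun less_eq_var :: "var \<Rightarrow> var \<Rightarrow> bool" where
  "less_eq_var (X i) (X j) = (i \<le> j)"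
| "less_eq_var (X i) (Y j) = True"
| "less_eq_var (Y i) (X j) = False"
| "less_eq_var (Y i) (Y j) = (i \<le> j)"

definition less_var :: "var \<Rightarrow> var \<Rightarrow> bool" where
  "less_var a b \<longleftrightarrow> a \<le> b \<and> \<not> b \<le> a"

instance
proof
  fix a b c :: var
  show "a < b \<longleftrightarrow> a \<le> b \<and> \<not> b \<le> a" by (rule less_var_def)
  show "a \<le> a" by (cases a) auto
  show "a \<le> b \<Longrightarrow> b \<le> c \<Longrightarrow> a \<le> c" by (cases a; cases b; cases c) auto
  show "a \<le> b \<Longrightarrow> b \<le> a \<Longrightarrow> a = b" by (cases a; cases b) auto
  show "a \<le> b \<or> b \<le> a" by (cases a; cases b) auto
qed

end

type_synonym laurent = "(var \<Rightarrow>\<^sub>0 int) \<Rightarrow>\<^sub>0 complex"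
type_synonym ratfun = "laurent fract"

definition laurent_in :: "nat \<Rightarrow> nat \<Rightarrow> laurent \<Rightarrow> bool" where
  "laurent_in n m f \<longleftrightarrow>
     (\<forall>\<mu> \<in> Poly_Mapping.keys f. Poly_Mapping.keys \<mu> \<subseteq> X ` {..<n} \<union> Y ` {..<m})"

definition laurent_eval :: "(nat \<Rightarrow> complex) \<Rightarrow> (nat \<Rightarrow> complex) \<Rightarrow> laurent \<Rightarrow> complex" where
  "laurent_eval x y f =
     (\<Sum>\<mu> \<in> Poly_Mapping.keys f. Poly_Mapping.lookup f \<mu> *
        (\<Prod>z \<in> Poly_Mapping.keys \<mu>.
           (case z of X i \<Rightarrow> x i | Y j \<Rightarrow> y j) powi Poly_Mapping.lookup \<mu> z))"

definition rconst :: "complex \<Rightarrow> ratfun" where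
  "rconst c = to_fract (Poly_Mapping.single 0 c)"

definition rvar :: "var \<Rightarrow> ratfun" where
  "rvar z = to_fract (Poly_Mapping.single (Poly_Mapping.single z 1) 1)"

lemma inj_rvar: "inj rvar"
proof (rule injI)
  fix z w assume "rvar z = rvar w"
  then have "Poly_Mapping.keys (Poly_Mapping.single (Poly_Mapping.single z (1::int)) (1::complex)) =
    Poly_Mapping.keys (Poly_Mapping.single (Poly_Mapping.single w (1::int)) (1::complex))"
    by (simp add: rvar_def)
  then have "Poly_Mapping.keys (Poly_Mapping.single z (1::int)) =
    Poly_Mapping.keys (Poly_Mapping.single w (1::int))"
    by simp
  then show "z = w" by simp
qed

abbreviation rx :: "nat \<Rightarrow> ratfun" where "rx i \<equiv> rvar (X i)"
abbreviation ry :: "nat \<Rightarrow> ratfun" where "ry j \<equiv> rvar (Y j)"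


section \<open>Renaming of variables\<close>

definition pushforward :: "('a \<Rightarrow> 'b) \<Rightarrow> ('a \<Rightarrow>\<^sub>0 'c) \<Rightarrow> ('b \<Rightarrow>\<^sub>0 'c::comm_monoid_add)" where
  "pushforward h f =
     (\<Sum>k \<in> Poly_Mapping.keys f. Poly_Mapping.single (h k) (Poly_Mapping.lookup f k))"

lemma pushforward_superset:
  assumes "finite K" "Poly_Mapping.keys f \<subseteq> K"
  shows "pushforward h f = (\<Sum>k\<in>K. Poly_Mapping.single (h k) (Poly_Mapping.lookup f k))"
  unfolding pushforward_def
  by (rule sum.mono_neutral_left) (use assms in \<open>auto simp: in_keys_iff\<close>)

lemma pushforward_0 [simp]: "pushforward h 0 = 0"
  by (simp add: pushforward_def)

lemma pushforward_single [simp]: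
  "pushforward h (Poly_Mapping.single k c) = Poly_Mapping.single (h k) c"
  by (subst pushforward_superset[of "{k}"]) auto

lemma pushforward_add: "pushforward h (f + g) = pushforward h f + pushforward h g"
proof -
  let ?K = "Poly_Mapping.keys f \<union> Poly_Mapping.keys g"
  have "Poly_Mapping.keys (f + g) \<subseteq> ?K" by (rule keys_add)
  then show ?thesis
    by (simp add: pushforward_superset[of ?K] lookup_add single_add sum.distrib)
qed

lemma pushforward_sum: "pushforward h (sum F A) = (\<Sum>a\<in>A. pushforward h (F a))"
  by (induction A rule: infinite_finite_induct) (simp_all add: pushforward_add)

lemma pushforward_comp: "pushforward g (pushforward h f) = pushforward (g \<circ> h) f"
  by (simp add: pushforward_def[of h] pushforward_sum) (simp add: pushforward_def)

lemma poly_mapping_expand: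
  "f = (\<Sum>k \<in> Poly_Mapping.keys f. Poly_Mapping.single k (Poly_Mapping.lookup f k))"
  by (rule poly_mapping_eqI)
     (auto simp: lookup_sum lookup_single when_def in_keys_iff sum.delta)

lemma pushforward_id [simp]: "pushforward id f = f"
  using poly_mapping_expand[of f] by (simp add: pushforward_def)

lemma inj_pushforward:
  assumes "inj h"
  shows "inj (pushforward h)"
proof (rule inj_on_inverseI)
  fix f
  show "pushforward (inv h) (pushforward h f) = f"
    by (simp add: pushforward_comp inv_o_cancel[OF assms])
qed

lemma pushforward_mult:
  fixes f g :: "'a::monoid_add \<Rightarrow>\<^sub>0 'c::semiring_0" and h :: "'a \<Rightarrow> 'b::monoid_add"
  assumes "\<And>a b. h (a + b) = h a + h b"
  shows "pushforward h (f * g) = pushforward h f * pushforward h g"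
proof -
  have "f * g = (\<Sum>k\<in>Poly_Mapping.keys f. \<Sum>l\<in>Poly_Mapping.keys g.
          Poly_Mapping.single (k + l) (Poly_Mapping.lookup f k * Poly_Mapping.lookup g l))"
    by (subst (1) poly_mapping_expand[of f], subst (1) poly_mapping_expand[of g])
       (simp add: sum_product mult_single)
  then show ?thesis
    by (simp add: pushforward_sum assms)
       (simp add: pushforward_def sum_product mult_single)
qed

primrec rename_var :: "(nat \<Rightarrow> nat) \<Rightarrow> (nat \<Rightarrow> nat) \<Rightarrow> var \<Rightarrow> var" where
  "rename_var \<sigma> \<tau> (X i) = X (\<sigma> i)"
| "rename_var \<sigma> \<tau> (Y j) = Y (\<tau> j)"

lemma inj_rename_var: "inj \<sigma> \<Longrightarrow> inj \<tau> \<Longrightarrow> inj (rename_var \<sigma> \<tau>)"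
  by (rule injI, case_tac x; case_tac y) (auto dest: injD)

definition laurent_rename :: "(nat \<Rightarrow> nat) \<Rightarrow> (nat \<Rightarrow> nat) \<Rightarrow> laurent \<Rightarrow> laurent" where
  "laurent_rename \<sigma> \<tau> = pushforward (pushforward (rename_var \<sigma> \<tau>))"

lemma laurent_rename_mult:
  "laurent_rename \<sigma> \<tau> (f * g) = laurent_rename \<sigma> \<tau> f * laurent_rename \<sigma> \<tau> g"
  unfolding laurent_rename_def by (rule pushforward_mult) (rule pushforward_add)

lemma inj_laurent_rename: "inj \<sigma> \<Longrightarrow> inj \<tau> \<Longrightarrow> inj (laurent_rename \<sigma> \<tau>)"
  unfolding laurent_rename_def by (intro inj_pushforward inj_rename_var)

lemma laurent_rename_add:
  "laurent_rename \<sigma> \<tau> (f + g) = laurent_rename \<sigma> \<tau> f + laurent_rename \<sigma> \<tau> g"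
  unfolding laurent_rename_def by (rule pushforward_add)

lemma laurent_rename_1: "laurent_rename \<sigma> \<tau> 1 = 1"
  unfolding laurent_rename_def by (simp flip: single_one)

definition inj_ring_hom :: "('a::comm_ring_1 \<Rightarrow> 'b::comm_ring_1) \<Rightarrow> bool" where
  "inj_ring_hom h \<longleftrightarrow> inj h \<and> h 1 = 1 \<and>
     (\<forall>a b. h (a + b) = h a + h b) \<and> (\<forall>a b. h (a * b) = h a * h b)"

lemma inj_ring_hom_eq_0_iff:
  assumes "inj_ring_hom h"
  shows "h a = 0 \<longleftrightarrow> a = 0"
proof -
  have "h (0 + 0) = h 0 + h 0" using assms unfolding inj_ring_hom_def by blast
  then have "h 0 = 0" by simp
  then show ?thesis using assms by (metis inj_ring_hom_def injD)
qed

lemma inj_ring_hom_laurent_rename: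
  "inj \<sigma> \<Longrightarrow> inj \<tau> \<Longrightarrow> inj_ring_hom (laurent_rename \<sigma> \<tau>)"
  by (simp add: inj_ring_hom_def inj_laurent_rename laurent_rename_1 laurent_rename_add
      laurent_rename_mult)

text \<open>
  The extension of \<open>h\<close> to the fraction fields, \<open>a / b \<mapsto> h a / h b\<close>. It is well defined, and only
  used, for injective ring homomorphisms.
\<close>

definition fract_map :: "('a::idom \<Rightarrow> 'b::idom) \<Rightarrow> 'a fract \<Rightarrow> 'b fract" where
  "fract_map h F = (THE G. \<exists>a b. b \<noteq> 0 \<and> F = Fract a b \<and> G = Fract (h a) (h b))"

lemma fract_map_Fract:
  assumes h: "inj_ring_hom h"
  shows "fract_map h (Fract a b) = Fract (h a) (h b)"
proof -
  have h1: "h 1 = 1" and hm: "\<And>x y. h (x * y) = h x * h y"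
    using h by (auto simp: inj_ring_hom_def)
  note h0 = inj_ring_hom_eq_0_iff[OF h]
  have main: "fract_map h (Fract a b) = Fract (h a) (h b)" if "b \<noteq> 0" for a b
    unfolding fract_map_def
  proof (rule the_equality)
    show "\<exists>a' b'. b' \<noteq> 0 \<and> Fract a b = Fract a' b' \<and> Fract (h a) (h b) = Fract (h a') (h b')"
      using that by blast
  next
    fix G assume "\<exists>a' b'. b' \<noteq> 0 \<and> Fract a b = Fract a' b' \<and> G = Fract (h a') (h b')"
    then obtain a' b' where *: "b' \<noteq> 0" "Fract a b = Fract a' b'" "G = Fract (h a') (h b')"
      by blast
    then have "h (a * b') = h (a' * b)" using that by (simp add: eq_fract)
    then show "G = Fract (h a) (h b)" using * that by (simp add: eq_fract h0 hm)
  qed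
  show ?thesis
  proof (cases "b = 0")
    case True
    then have "Fract a b = Fract 0 1" "Fract (h a) (h b) = Fract 0 1"
      using h0[of 0] by (simp_all add: eq_fract)
    then show ?thesis using main[of 1 0] h1 h0[of 0] by simp
  qed (rule main)
qed

text \<open>
  The substitution \<open>x\<^sub>i \<mapsto> x\<^bsub>\<sigma> i\<^esub>\<close>, \<open>y\<^sub>j \<mapsto> y\<^bsub>\<tau> j\<^esub>\<close>; it is only used for injective \<open>\<sigma>\<close> and \<open>\<tau>\<close>.
\<close>

definition ratfun_rename :: "(nat \<Rightarrow> nat) \<Rightarrow> (nat \<Rightarrow> nat) \<Rightarrow> ratfun \<Rightarrow> ratfun" where
  "ratfun_rename \<sigma> \<tau> = fract_map (laurent_rename \<sigma> \<tau>)"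

lemma ratfun_rename_Fract:
  "inj \<sigma> \<Longrightarrow> inj \<tau> \<Longrightarrow>
     ratfun_rename \<sigma> \<tau> (Fract a b) = Fract (laurent_rename \<sigma> \<tau> a) (laurent_rename \<sigma> \<tau> b)"
  by (simp add: ratfun_rename_def fract_map_Fract inj_ring_hom_laurent_rename)

lemma ratfun_rename_rvar:
  "inj \<sigma> \<Longrightarrow> inj \<tau> \<Longrightarrow> ratfun_rename \<sigma> \<tau> (rvar z) = rvar (rename_var \<sigma> \<tau> z)"
  by (simp add: rvar_def to_fract_def ratfun_rename_Fract laurent_rename_1)
     (simp add: laurent_rename_def)


section \<open>The shuffle algebra\<close>

definition asym :: "nat \<Rightarrow> nat \<Rightarrow> ratfun \<Rightarrow> ratfun" where
  "asym n m F = (1 / of_nat (fact n * fact m)) *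
     (\<Sum>\<sigma> | \<sigma> permutes {..<n}. \<Sum>\<tau> | \<tau> permutes {..<m}.
        of_int (sign \<sigma>) * of_int (sign \<tau>) * ratfun_rename \<sigma> \<tau> F)"

definition skew_symmetric :: "nat \<Rightarrow> nat \<Rightarrow> ratfun \<Rightarrow> bool" where
  "skew_symmetric n m F \<longleftrightarrow>
     (\<forall>\<sigma>. \<sigma> permutes {..<n} \<longrightarrow> ratfun_rename \<sigma> id F = of_int (sign \<sigma>) * F) \<and>
     (\<forall>\<tau>. \<tau> permutes {..<m} \<longrightarrow> ratfun_rename id \<tau> F = of_int (sign \<tau>) * F)"

definition is_numerator :: "nat \<Rightarrow> nat \<Rightarrow> laurent \<Rightarrow> ratfun \<Rightarrow> bool" where
  "is_numerator n m f F \<longleftrightarrow>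
     laurent_in n m f \<and> F = to_fract f / (\<Prod>i<n. \<Prod>j<m. rx i - ry j)"

lemma is_numerator_unique:
  assumes "is_numerator n m f F" "is_numerator n m g F"
  shows "f = g"
proof -
  have "rx i - ry j \<noteq> 0" for i j
    using inj_rvar by (auto dest: injD)
  then have "to_fract f = to_fract g"
    using assms by (auto simp: is_numerator_def)
  then show ?thesis by simp
qed

definition shuffle_component :: "nat \<Rightarrow> nat \<Rightarrow> ratfun set" where
  "shuffle_component n m = {F. skew_symmetric n m F \<and> (\<exists>f. is_numerator n m f F)}"

text \<open>
  The direct sum of the components: a finitely supported family indexed by the bidegree \<open>(n, m)\<close>.
\<close>

definition shuffle_algebra :: "(nat \<times> nat \<Rightarrow>\<^sub>0 ratfun) set" where
  "shuffle_algebra = {F. \<forall>n m. Poly_Mapping.lookup F (n, m) \<in> shuffle_component n m}"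

definition shuffle_hom ::
  "complex \<Rightarrow> nat \<times> nat \<Rightarrow> nat \<times> nat \<Rightarrow> ratfun \<Rightarrow> ratfun \<Rightarrow> ratfun" where
  "shuffle_hom v = (\<lambda>(k1, l1) (k2, l2) F G.
     asym (k1 + k2) (l1 + l2)
       (F * ratfun_rename (\<lambda>i. k1 + i) (\<lambda>j. l1 + j) G *
        (\<Prod>i\<in>{..<k1}. \<Prod>j\<in>{l1..<l1 + l2}. (rx i + rconst (inverse v) * ry j) / (rx i - ry j)) *
        (\<Prod>i\<in>{k1..<k1 + k2}. \<Prod>j\<in>{..<l1}. (ry j + rconst (inverse v) * rx i) / (ry j - rx i))))"

definition shuffle_mult ::
  "complex \<Rightarrow> (nat \<times> nat \<Rightarrow>\<^sub>0 ratfun) \<Rightarrow> (nat \<times> nat \<Rightarrow>\<^sub>0 ratfun) \<Rightarrow> (nat \<times> nat \<Rightarrow>\<^sub>0 ratfun)" where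
  "shuffle_mult v F G =
     (\<Sum>p \<in> Poly_Mapping.keys F. \<Sum>q \<in> Poly_Mapping.keys G.
        Poly_Mapping.single (fst p + fst q, snd p + snd q)
          (shuffle_hom v p q (Poly_Mapping.lookup F p) (Poly_Mapping.lookup G q)))"

definition shuffle_one :: "nat \<times> nat \<Rightarrow>\<^sub>0 ratfun" where
  "shuffle_one = Poly_Mapping.single (0, 0) 1"

definition shuffle_scale :: "complex \<Rightarrow> (nat \<times> nat \<Rightarrow>\<^sub>0 ratfun) \<Rightarrow> (nat \<times> nat \<Rightarrow>\<^sub>0 ratfun)" where
  "shuffle_scale c F = Poly_Mapping.map ((*) (rconst c)) F"

text \<open>Subalgebras are unital.\<close>

inductive_set generated_subalgebra ::
  "complex \<Rightarrow> (nat \<times> nat \<Rightarrow>\<^sub>0 ratfun) set \<Rightarrow> (nat \<times> nat \<Rightarrow>\<^sub>0 ratfun) set"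
  for v :: complex and S :: "(nat \<times> nat \<Rightarrow>\<^sub>0 ratfun) set" where
  one: "shuffle_one \<in> generated_subalgebra v S"
| gen: "F \<in> S \<Longrightarrow> F \<in> generated_subalgebra v S"
| add: "F \<in> generated_subalgebra v S \<Longrightarrow> G \<in> generated_subalgebra v S \<Longrightarrow>
    F + G \<in> generated_subalgebra v S"
| scale: "F \<in> generated_subalgebra v S \<Longrightarrow> shuffle_scale c F \<in> generated_subalgebra v S"
| mult: "F \<in> generated_subalgebra v S \<Longrightarrow> G \<in> generated_subalgebra v S \<Longrightarrow>
    shuffle_mult v F G \<in> generated_subalgebra v S"

definition Lambda_zeta :: "complex \<Rightarrow> (nat \<times> nat \<Rightarrow>\<^sub>0 ratfun) set" where
  "Lambda_zeta v = generated_subalgebra v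
     {F \<in> shuffle_algebra. Poly_Mapping.keys F \<subseteq> {(1, 0), (0, 1)}}"


section \<open>The wheel condition\<close>

text \<open>
  Laurent polynomials are evaluated at points with nonzero coordinates. The chain (indices from 1)
  \<open>x\<^sub>1/y\<^sub>1 = y\<^sub>1/x\<^sub>2 = \<dots> = x\<^sub>t/y\<^sub>t = y\<^sub>t/x\<^sub>1\<close> closes up cyclically, whence the index modulo \<open>t\<close>.
\<close>

definition wheel_component :: "complex \<Rightarrow> nat \<Rightarrow> nat \<Rightarrow> nat \<Rightarrow> ratfun \<Rightarrow> bool" where
  "wheel_component v t n m F \<longleftrightarrow>
     (t \<le> n \<and> t \<le> m \<longrightarrow>
       (\<forall>f x y. is_numerator n m f F \<longrightarrow>
          (\<forall>i<n. x i \<noteq> 0) \<longrightarrow> (\<forall>j<m. y j \<noteq> 0) \<longrightarrow>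
          (\<forall>i<t. x i / y i = - inverse v \<and> y i / x (Suc i mod t) = - inverse v) \<longrightarrow>
          laurent_eval x y f = 0))"

definition wheel_condition :: "complex \<Rightarrow> nat \<Rightarrow> (nat \<times> nat \<Rightarrow>\<^sub>0 ratfun) \<Rightarrow> bool" where
  "wheel_condition v t F \<longleftrightarrow>
     (\<forall>n m. wheel_component v t n m (Poly_Mapping.lookup F (n, m)))"

definition primitive_root_of_unity :: "nat \<Rightarrow> complex \<Rightarrow> bool" where
  "primitive_root_of_unity k z \<longleftrightarrow> 0 < k \<and> z ^ k = 1 \<and> (\<forall>j. 0 < j \<and> j < k \<longrightarrow> z ^ j \<noteq> 1)"

end

theory Submission
  imports Defs
begin

text \<open>
  Put \<open>u = - 1 / v\<close> and \<open>w = v\<^sup>2\<close>, a primitive \<open>t\<close>-th root of unity, so that wheels are chains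
  \<open>x\<^sub>i = u y\<^sub>i\<close>, \<open>y\<^sub>i = u x\<^bsub>i+1\<^esub>\<close>. On numerators, the factor of the shuffle product attached to a variable \<open>a\<close>
  of the first and a variable \<open>b\<close> (of the other kind) of the second operand is \<open>a - u b\<close>. A term of a
  product that survives on a wheel therefore has all wheel variables in one operand, which proves
  that the wheel condition is preserved.

  For the converse, filter skew numerators \<open>f\<close> by the number \<open>k\<close> of disjoint pairs \<open>x = u y\<close> such that \<open>f\<close>
  vanishes whenever \<open>k + 1\<close> pairs are so matched. Restricting such an \<open>f\<close> to \<open>k\<close> matched pairs
  \<open>(x, y) = (u z\<^sub>i, z\<^sub>i)\<close> gives an explicit product of linear forms times a function \<open>h\<close>, skew in each of
  the groups \<open>z\<close>, \<open>x'\<close>, \<open>y'\<close> of variables, that vanishes on \<open>z\<^bsub>i+1\<^esub> = w z\<^sub>i\<close> (\<open>1 \<le> i < t\<close>). Products of one-variable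
  elements in the order \<open>x\<^bsup>n-k\<^esup> (y x)\<^sup>k y\<^bsup>m-k\<^esup>\<close> realise every such \<open>h\<close>: in \<open>z\<close> they produce the Hall-Littlewood
  products with kernel \<open>(z - w z') / (z - z')\<close>, and these span all symmetric Laurent polynomials vanishing
  on the chains, by induction on the degree in one variable. Subtracting such a product decreases \<open>k\<close>.
\<close>

section \<open>Evaluation of Laurent polynomials\<close>

text \<open>The kernel in \<open>z\<close> is what the shuffle factors leave on matched pairs.
  Appending \<open>y x\<close>, matched as \<open>y = z\<close>, \<open>x = u z\<close>, to an
  earlier pair \<open>(u z', z')\<close> brings in \<open>u z' - u z\<close> and
  \<open>z' - u u z\<close>. The former completes a Vandermonde product; since
  \<open>u u w = 1\<close>, the latter is a multiple of \<open>z - w z'\<close>. Within the new pair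
  there remains \<open>z - u u z\<close>, which is nonzero exactly if \<open>t \<ge> 2\<close>; for
  \<open>t = 1\<close> a chain is a single variable and \<open>h = 0\<close> as soon as
  \<open>k > 0\<close>. The order of the word serves the filtration: a \<open>y\<close> on the right
  brings the factors \<open>x - u y\<close> for all earlier \<open>x\<close>, so the trailing
  \<open>y\<close> create no further matched pair. At a root of unity the Hall-Littlewood products
  need not span all symmetric functions: lifting a leading coefficient divides by
  \<open>w\<close>-integers, and the chain condition stops the recursion before the one that is 0.
  Everything is checked at points with nonzero coordinates. Each locus in use is the image of a
  torus under a monomial map, so factors can be cancelled on it because Laurent polynomials form a
  domain.\<close>

abbreviation lookup :: "('a \<Rightarrow>\<^sub>0 'b::zero) \<Rightarrow> 'a \<Rightarrow> 'b" where
  "lookup \<equiv> Poly_Mapping.lookup"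

abbreviation keys :: "('a \<Rightarrow>\<^sub>0 'b::zero) \<Rightarrow> 'a set" where
  "keys \<equiv> Poly_Mapping.keys"

abbreviation single :: "'a \<Rightarrow> 'b \<Rightarrow> ('a \<Rightarrow>\<^sub>0 'b::zero)" where
  "single \<equiv> Poly_Mapping.single"

type_synonym point = "nat \<Rightarrow> complex"

definition monom_eval :: "(var \<Rightarrow> complex) \<Rightarrow> (var \<Rightarrow>\<^sub>0 int) \<Rightarrow> complex" where
  "monom_eval p \<mu> = (\<Prod>z \<in> keys \<mu>. p z powi lookup \<mu> z)"

definition ev :: "(var \<Rightarrow> complex) \<Rightarrow> laurent \<Rightarrow> complex" where
  "ev p f = (\<Sum>\<mu> \<in> keys f. lookup f \<mu> * monom_eval p \<mu>)"

text \<open>Exponents may be negative and \<open>0 powi (- 1) = 0\<close>, so \<open>ev p\<close> is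
  multiplicative only away from zero coordinates. The condition ranges over all coordinates, not
  only those in use, which makes it stable under renaming without index bounds.\<close>

definition nz :: "('a \<Rightarrow> complex) \<Rightarrow> bool" where
  "nz p \<longleftrightarrow> (\<forall>z. p z \<noteq> 0)"

lemma nzD: "nz p \<Longrightarrow> p z \<noteq> 0"
  by (simp add: nz_def)

lemma nz_comp [simp]: "nz p \<Longrightarrow> nz (p \<circ> w)"
  by (simp add: nz_def)

lemma nz_upd [simp]: "nz p \<Longrightarrow> c \<noteq> 0 \<Longrightarrow> nz (p(z := c))"
  by (simp add: nz_def)

lemma nz_case_var [simp]: "nz (case_var x y) \<longleftrightarrow> nz x \<and> nz y"
  unfolding nz_def by (metis var.exhaust var.simps(5,6))

lemma laurent_eval_ev: "laurent_eval x y f = ev (case_var x y) f"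
  by (simp add: laurent_eval_def ev_def monom_eval_def)

lemma monom_eval_superset:
  assumes "finite K" "keys \<mu> \<subseteq> K"
  shows "monom_eval p \<mu> = (\<Prod>z\<in>K. p z powi lookup \<mu> z)"
  unfolding monom_eval_def
  by (rule prod.mono_neutral_left) (use assms in \<open>auto simp: in_keys_iff\<close>)

lemma monom_eval_0 [simp]: "monom_eval p 0 = 1"
  by (simp add: monom_eval_def)

lemma monom_eval_single [simp]: "monom_eval p (single z a) = p z powi a"
  by (subst monom_eval_superset[of "{z}"]) auto

lemma monom_eval_add:
  assumes "nz p"
  shows "monom_eval p (\<mu> + \<nu>) = monom_eval p \<mu> * monom_eval p \<nu>"
proof -
  let ?K = "keys \<mu> \<union> keys \<nu>"
  have "keys (\<mu> + \<nu>) \<subseteq> ?K" by (rule keys_add)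
  then show ?thesis
    using assms
    by (simp add: monom_eval_superset[of ?K] lookup_add prod.distrib[symmetric]
        power_int_add nz_def)
qed

lemma monom_eval_nz: "nz p \<Longrightarrow> monom_eval p \<mu> \<noteq> 0"
  by (simp add: monom_eval_def nz_def)

lemma monom_eval_sum:
  "nz p \<Longrightarrow> monom_eval p (sum F A) = (\<Prod>a\<in>A. monom_eval p (F a))"
  by (induction A rule: infinite_finite_induct) (simp_all add: monom_eval_add)

lemma monom_eval_pushforward:
  assumes "nz p"
  shows "monom_eval p (pushforward w \<mu>) = monom_eval (p \<circ> w) \<mu>"
  by (simp add: pushforward_def monom_eval_sum assms) (simp add: monom_eval_def)

lemma monom_eval_mult: "monom_eval (\<lambda>z. c z * p z) \<mu> = monom_eval c \<mu> * monom_eval p \<mu>"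
  by (simp add: monom_eval_def power_int_mult_distrib prod.distrib)

lemma monom_eval_cong:
  "(\<And>z. z \<in> keys \<mu> \<Longrightarrow> p z = p' z) \<Longrightarrow> monom_eval p \<mu> = monom_eval p' \<mu>"
  by (simp add: monom_eval_def)

lemma ev_superset:
  assumes "finite K" "keys f \<subseteq> K"
  shows "ev p f = (\<Sum>\<mu>\<in>K. lookup f \<mu> * monom_eval p \<mu>)"
  unfolding ev_def
  by (rule sum.mono_neutral_left) (use assms in \<open>auto simp: in_keys_iff\<close>)

lemma ev_0 [simp]: "ev p 0 = 0"
  by (simp add: ev_def)

lemma ev_single [simp]: "ev p (single \<mu> c) = c * monom_eval p \<mu>"
  by (subst ev_superset[of "{\<mu>}"]) auto

lemma ev_1 [simp]: "ev p 1 = 1"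
  by (simp flip: single_one)

lemma ev_add [simp]: "ev p (f + g) = ev p f + ev p g"
proof -
  let ?K = "keys f \<union> keys g"
  have "keys (f + g) \<subseteq> ?K" by (rule keys_add)
  then show ?thesis
    by (simp add: ev_superset[of ?K] lookup_add sum.distrib ring_distribs)
qed

lemma ev_minus [simp]: "ev p (- f) = - ev p f"
  by (simp add: ev_def sum_negf)

lemma ev_diff [simp]: "ev p (f - g) = ev p f - ev p g"
  using ev_add[of p f "- g"] by simp

lemma ev_sum [simp]: "ev p (sum F A) = (\<Sum>a\<in>A. ev p (F a))"
  by (induction A rule: infinite_finite_induct) simp_all

lemma ev_mult [simp]:
  assumes "nz p"
  shows "ev p (f * g) = ev p f * ev p g"
proof -
  have "f * g = (\<Sum>k\<in>keys f. \<Sum>l\<in>keys g.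
          single (k + l) (lookup f k * lookup g l))"
    by (subst (1) poly_mapping_expand[of f], subst (1) poly_mapping_expand[of g])
       (simp add: sum_product mult_single)
  also have "ev p \<dots> = ev p f * ev p g"
    by (simp add: monom_eval_add[OF assms] ev_def[of p f] ev_def[of p g] sum_product mult_ac)
  finally show ?thesis .
qed

lemma ev_prod [simp]: "nz p \<Longrightarrow> ev p (prod F A) = (\<Prod>a\<in>A. ev p (F a))"
  by (induction A rule: infinite_finite_induct) simp_all

lemma ev_power [simp]: "nz p \<Longrightarrow> ev p (f ^ k) = ev p f ^ k"
  by (induction k) simp_all

lemma ev_pushforward:
  assumes "nz p"
  shows "ev p (pushforward (pushforward w) f) = ev (p \<circ> w) f"
  by (simp add: pushforward_def[of "pushforward w"] monom_eval_pushforward[OF assms]) (simp add: ev_def)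

lemma ev_rename: "nz p \<Longrightarrow> ev p (laurent_rename \<sigma> \<tau> f) = ev (p \<circ> rename_var \<sigma> \<tau>) f"
  by (simp add: laurent_rename_def ev_pushforward)

lemma case_var_rename: "case_var x y \<circ> rename_var \<sigma> \<tau> = case_var (x \<circ> \<sigma>) (y \<circ> \<tau>)"
proof
  fix z show "(case_var x y \<circ> rename_var \<sigma> \<tau>) z = case_var (x \<circ> \<sigma>) (y \<circ> \<tau>) z"
    by (cases z) auto
qed

text \<open>Artin's argument: translating a relation by a point that separates two exponents and subtracting
  a multiple of the relation gives a shorter one.\<close>

lemma monom_eval_independent:
  assumes "finite K" "\<And>p. nz p \<Longrightarrow> (\<Sum>\<mu>\<in>K. c \<mu> * monom_eval p \<mu>) = 0" "\<mu> \<in> K"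
  shows "c \<mu> = 0"
  using assms
proof (induction "card K" arbitrary: K c \<mu> rule: less_induct)
  case less
  show ?case
  proof (cases "K = {\<mu>}")
    case True
    then show ?thesis using less.prems(2)[of "\<lambda>_. 1"]
      by (simp add: nz_def monom_eval_def)
  next
    case False
    then obtain \<nu> where \<nu>: "\<nu> \<in> K" "\<nu> \<noteq> \<mu>" using less.prems by blast
    then obtain z where z: "lookup \<nu> z \<noteq> lookup \<mu> z"
      by (meson poly_mapping_eqI)
    \<comment> \<open>Scaling \<open>z\<close> alone by 2 separates the exponents of
      \<open>z\<close>, because distinct powers of 2 have distinct values.\<close>
    define q :: "var \<Rightarrow> complex" where "q = (\<lambda>_. 1)(z := 2)"
    have q: "nz q" by (simp add: q_def nz_def)
    have qe: "monom_eval q \<kappa> = 2 powi lookup \<kappa> z" for \<kappa>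
    proof -
      have "monom_eval q \<kappa> = (\<Prod>a\<in>insert z (keys \<kappa>). q a powi lookup \<kappa> a)"
        by (rule monom_eval_superset) auto
      also have "\<dots> = q z powi lookup \<kappa> z * (\<Prod>a\<in>keys \<kappa> - {z}. q a powi lookup \<kappa> a)"
        by (rule prod.insert_remove) auto
      also have "(\<Prod>a\<in>keys \<kappa> - {z}. q a powi lookup \<kappa> a) = 1"
        by (rule prod.neutral) (auto simp: q_def)
      finally show ?thesis by (simp add: q_def del: fun_upd_apply) (simp add: q_def)
    qed
    have "(\<Sum>\<kappa>\<in>K - {\<nu>}. (c \<kappa> * (monom_eval q \<kappa> - monom_eval q \<nu>)) * monom_eval p \<kappa>) = 0"
      if p: "nz p" for p
    proof -
      have "nz (\<lambda>z. q z * p z)" using p q by (simp add: nz_def)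
      from less.prems(2)[OF this] have 1: "(\<Sum>\<kappa>\<in>K. c \<kappa> * (monom_eval q \<kappa> * monom_eval p \<kappa>)) = 0"
        by (simp add: monom_eval_mult)
      have "(\<Sum>\<kappa>\<in>K. (c \<kappa> * (monom_eval q \<kappa> - monom_eval q \<nu>)) * monom_eval p \<kappa>)
        = (\<Sum>\<kappa>\<in>K. c \<kappa> * (monom_eval q \<kappa> * monom_eval p \<kappa>)) -
          monom_eval q \<nu> * (\<Sum>\<kappa>\<in>K. c \<kappa> * monom_eval p \<kappa>)"
        by (simp add: sum_distrib_left sum_subtractf[symmetric] algebra_simps)
      also have "\<dots> = 0" using 1 less.prems(2)[OF p] by simp
      finally show ?thesis
        using \<nu> less.prems(1) by (simp add: sum.remove[of K \<nu>])
    qed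
    then have "c \<mu> * (monom_eval q \<mu> - monom_eval q \<nu>) = 0"
      using less.hyps[of "K - {\<nu>}" "\<lambda>\<kappa>. c \<kappa> * (monom_eval q \<kappa> - monom_eval q \<nu>)" \<mu>]
        less.prems \<nu> card_Diff1_less[of K \<nu>] by auto
    moreover have "monom_eval q \<mu> \<noteq> monom_eval q \<nu>"
    proof
      assume "monom_eval q \<mu> = monom_eval q \<nu>"
      then have "norm ((2::complex) powi lookup \<mu> z) = norm ((2::complex) powi lookup \<nu> z)"
        by (simp add: qe)
      then have "(2::real) powi lookup \<mu> z = 2 powi lookup \<nu> z"
        by (simp add: norm_power_int)
      then show False using z
        using power_int_strict_increasing[of "lookup \<mu> z" "lookup \<nu> z" "2::real"]
          power_int_strict_increasing[of "lookup \<nu> z" "lookup \<mu> z" "2::real"]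
        by linarith
    qed
    ultimately show ?thesis by simp
  qed
qed

lemma ev_faithful:
  assumes "\<And>p. nz p \<Longrightarrow> ev p f = 0"
  shows "f = 0"
proof (rule poly_mapping_eqI)
  fix \<mu>
  have "\<mu> \<in> keys f \<Longrightarrow> lookup f \<mu> = 0"
    by (rule monom_eval_independent[of "keys f"]) (use assms in \<open>auto simp: ev_def\<close>)
  then show "lookup f \<mu> = lookup 0 \<mu>" by (auto simp: in_keys_iff)
qed

lemma ev_eqI: "(\<And>p. nz p \<Longrightarrow> ev p f = ev p g) \<Longrightarrow> f = g"
  using ev_faithful[of "f - g"] by simp

section \<open>Supports\<close>

definition vars :: "nat \<Rightarrow> nat \<Rightarrow> var set" where
  "vars n m = X ` {..<n} \<union> Y ` {..<m}"

lemma X_in_vars [simp]: "X i \<in> vars n m \<longleftrightarrow> i < n"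
  and Y_in_vars [simp]: "Y j \<in> vars n m \<longleftrightarrow> j < m"
  by (auto simp: vars_def)

lemma laurent_in_vars:
  "laurent_in n m f \<longleftrightarrow> (\<forall>\<mu>\<in>keys f. keys \<mu> \<subseteq> vars n m)"
  by (simp add: laurent_in_def vars_def)

lemma laurent_in_0 [simp]: "laurent_in n m 0"
  by (simp add: laurent_in_def)

lemma laurent_in_1 [simp]: "laurent_in n m 1"
  by (simp add: laurent_in_def flip: single_one)

lemma laurent_in_const [simp]: "laurent_in n m (single 0 c)"
  by (simp add: laurent_in_def)

lemma laurent_in_single [simp]:
  "z \<in> vars n m \<Longrightarrow> laurent_in n m (single (single z a) c)"
  by (auto simp: laurent_in_vars)

lemma laurent_in_add [simp]: "laurent_in n m f \<Longrightarrow> laurent_in n m g \<Longrightarrow> laurent_in n m (f + g)"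
  unfolding laurent_in_def by (meson UnE keys_add subsetD)

lemma laurent_in_minus [simp]: "laurent_in n m f \<Longrightarrow> laurent_in n m (- f)"
  by (simp add: laurent_in_def)

lemma laurent_in_diff [simp]: "laurent_in n m f \<Longrightarrow> laurent_in n m g \<Longrightarrow> laurent_in n m (f - g)"
  using laurent_in_add[of n m f "- g"] by simp

lemma laurent_in_sum [simp]: "(\<And>a. a \<in> A \<Longrightarrow> laurent_in n m (F a)) \<Longrightarrow> laurent_in n m (sum F A)"
  by (induction A rule: infinite_finite_induct) simp_all

lemma laurent_in_mult [simp]:
  assumes "laurent_in n m f" "laurent_in n m g"
  shows "laurent_in n m (f * g)"
  unfolding laurent_in_vars
proof
  fix \<mu> assume "\<mu> \<in> keys (f * g)"
  then obtain a b where "a \<in> keys f" "b \<in> keys g" "\<mu> = a + b"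
    using keys_mult[of f g] by blast
  then show "keys \<mu> \<subseteq> vars n m"
    using assms keys_add[of a b] unfolding laurent_in_vars by blast
qed

lemma laurent_in_prod [simp]: "(\<And>a. a \<in> A \<Longrightarrow> laurent_in n m (F a)) \<Longrightarrow> laurent_in n m (prod F A)"
  by (induction A rule: infinite_finite_induct) simp_all

lemma keys_pushforward: "keys (pushforward h f) \<subseteq> h ` keys f"
  unfolding pushforward_def by (rule order.trans[OF keys_sum]) auto

lemma laurent_in_rename:
  assumes "laurent_in n m f" "rename_var \<sigma> \<tau> ` vars n m \<subseteq> vars n' m'"
  shows "laurent_in n' m' (laurent_rename \<sigma> \<tau> f)"
  unfolding laurent_in_vars
proof
  fix \<mu> assume "\<mu> \<in> keys (laurent_rename \<sigma> \<tau> f)"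
  then obtain \<nu> where "\<nu> \<in> keys f" "\<mu> = pushforward (rename_var \<sigma> \<tau>) \<nu>"
    using keys_pushforward[of "pushforward (rename_var \<sigma> \<tau>)" f]
    unfolding laurent_rename_def by auto
  then show "keys \<mu> \<subseteq> vars n' m'"
    using assms keys_pushforward[of "rename_var \<sigma> \<tau>" \<nu>] unfolding laurent_in_vars
    by (meson image_mono subset_trans)
qed

lemma vars_mono: "n \<le> n' \<Longrightarrow> m \<le> m' \<Longrightarrow> vars n m \<subseteq> vars n' m'"
  by (auto simp: vars_def)

lemma laurent_in_mono: "laurent_in n m f \<Longrightarrow> n \<le> n' \<Longrightarrow> m \<le> m' \<Longrightarrow> laurent_in n' m' f"
  unfolding laurent_in_vars by (meson vars_mono subset_trans)

lemma ev_cong: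
  assumes "laurent_in n m f" "\<And>z. z \<in> vars n m \<Longrightarrow> p z = p' z"
  shows "ev p f = ev p' f"
  unfolding ev_def using assms unfolding laurent_in_vars
  by (intro sum.cong refl arg_cong2[where f = "(*)"] monom_eval_cong) blast

section \<open>Substitutions and divisibility by linear forms\<close>

text \<open>The substitution \<open>z \<mapsto> c z * w z\<close>. As \<open>w\<close> need not be
  injective, restriction to a locus such as \<open>x = u y\<close> or to a chain of variables has
  this form.\<close>

definition monom_subst :: "(var \<Rightarrow> complex) \<Rightarrow> (var \<Rightarrow> var) \<Rightarrow> laurent \<Rightarrow> laurent" where
  "monom_subst c w f = (\<Sum>\<mu>\<in>keys f.
     single (pushforward w \<mu>) (lookup f \<mu> * monom_eval c \<mu>))"

lemma ev_monom_subst: "nz p \<Longrightarrow> ev p (monom_subst c w f) = ev (\<lambda>z. c z * p (w z)) f"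
  by (simp add: monom_subst_def monom_eval_pushforward)
     (simp add: ev_def monom_eval_mult comp_def mult_ac)

lemma laurent_in_monom_subst:
  assumes "\<And>z. z \<in> vars n m \<Longrightarrow> w z \<in> vars n' m'" "laurent_in n m f"
  shows "laurent_in n' m' (monom_subst c w f)"
  unfolding monom_subst_def
proof (rule laurent_in_sum)
  fix \<mu> assume "\<mu> \<in> keys f"
  then have "keys (pushforward w \<mu>) \<subseteq> vars n' m'"
    using assms keys_pushforward[of w \<mu>] unfolding laurent_in_vars by blast
  then show "laurent_in n' m' (single (pushforward w \<mu>) (lookup f \<mu> * monom_eval c \<mu>))"
    by (simp add: laurent_in_vars)
qed

text \<open>The locus is parametrised by a torus, so functions on it pull back to the Laurent ring,
  a domain. If \<open>d * f\<close> vanishes on the locus and \<open>d\<close> is nonzero somewhere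
  on it, then \<open>f\<close> vanishes everywhere on it, also at the zeros of
  \<open>d\<close>.\<close>

lemma ev_eq_0_dense:
  fixes w :: "var \<Rightarrow> var"
  assumes "nz c"
    and "\<And>p. nz p \<Longrightarrow> ev (\<lambda>z. c z * p (w z)) d * ev (\<lambda>z. c z * p (w z)) f = 0"
    and "nz q" "ev (\<lambda>z. c z * q (w z)) d \<noteq> 0"
    and "nz p"
  shows "ev (\<lambda>z. c z * p (w z)) f = 0"
proof -
  have "monom_subst c w d * monom_subst c w f = 0"
    by (rule ev_faithful) (simp add: ev_monom_subst assms(2))
  moreover have "monom_subst c w d \<noteq> 0" using assms(3,4) ev_monom_subst[of q c w d] by auto
  ultimately have "monom_subst c w f = 0" by simp
  then show ?thesis using ev_monom_subst[OF \<open>nz p\<close>, of c w f] by simp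
qed

text \<open>The primed elements are inverses and serve negative exponents:
  \<open>z' ^ k - w' ^ k\<close> is \<open>- (z ^ k - w ^ k)\<close> times the unit
  \<open>z' ^ k * w' ^ k\<close>.\<close>

lemma diff_dvd_powi_diff:
  fixes z w z' w' :: "'a::comm_ring_1"
  assumes "z * z' = 1" "w * w' = 1"
  shows "z - w dvd z ^ k - w ^ k" "z - w dvd z' ^ k - w' ^ k"
proof -
  show 1: "z - w dvd z ^ k - w ^ k" by (metis dvd_triv_left power_diff_sumr2)
  have a: "z ^ k * z' ^ k = 1" "w ^ k * w' ^ k = 1"
    using assms by (simp_all flip: power_mult_distrib)
  have "- (z ^ k - w ^ k) * (z' ^ k * w' ^ k) = (w ^ k * w' ^ k) * z' ^ k - (z ^ k * z' ^ k) * w' ^ k"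
    by (simp add: algebra_simps)
  then have "z' ^ k - w' ^ k = - (z ^ k - w ^ k) * (z' ^ k * w' ^ k)"
    by (simp add: a)
  then show "z - w dvd z' ^ k - w' ^ k" using 1 by (metis dvd_minus_iff dvd_mult2)
qed

abbreviation LV :: "var \<Rightarrow> laurent" where
  "LV z \<equiv> single (single z 1) 1"

abbreviation LC :: "complex \<Rightarrow> laurent" where
  "LC c \<equiv> single 0 c"

text \<open>Substituting \<open>c * w\<close> for \<open>z\<close> sends \<open>f\<close> to 0, and
  each monomial of \<open>f\<close> differs from its image by a multiple of the form, which divides
  \<open>z powi d - (c * w) powi d\<close> for every integer \<open>d\<close>.\<close>

lemma linear_form_dvd:
  assumes "z \<noteq> w" "c \<noteq> 0"
    and f: "\<And>p. nz p \<Longrightarrow> p z = c * p w \<Longrightarrow> ev p f = 0"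
  shows "LV z - LC c * LV w dvd f"
proof -
  define s where "s = (\<lambda>_::var. 1::complex)(z := c)"
  define r where "r = id(z := w)"
  let ?l = "LV z - LC c * LV w"
  have s: "nz s" using \<open>c \<noteq> 0\<close> by (simp add: s_def nz_def)
  have "monom_subst s r f = 0"
  proof (rule ev_faithful)
    fix p :: "var \<Rightarrow> complex" assume p: "nz p"
    have "nz (\<lambda>q. s q * p (r q))" using s p by (simp add: nz_def)
    moreover have "s z * p (r z) = c * (s w * p (r w))"
      using \<open>z \<noteq> w\<close> by (simp add: s_def r_def)
    ultimately show "ev p (monom_subst s r f) = 0" using f by (simp add: ev_monom_subst p)
  qed
  moreover have "?l dvd f - monom_subst s r f"
  proof -
    have "?l dvd single \<mu> a - single (pushforward r \<mu>) (a * monom_eval s \<mu>)" for \<mu> a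
    proof -
      \<comment> \<open>The monomial splits as \<open>m * Z\<close> with \<open>m\<close> free of
        \<open>z\<close>; the substitution fixes \<open>m\<close> and sends \<open>Z\<close> to
        \<open>W\<close>.\<close>
      define d where "d = lookup \<mu> z"
      define m where "m = single (\<mu> - single z d) a"
      define Z W where "Z = single (single z d) (1::complex)"
        and "W = single (single w d) (c powi d)"
      have ZW: "?l dvd Z - W"
      proof (cases "d \<ge> 0")
        case True
        have "Z = LV z ^ nat d"
          by (rule ev_eqI) (use True in \<open>simp add: Z_def power_int_def\<close>)
        moreover have "W = (LC c * LV w) ^ nat d"
          by (rule ev_eqI) (use True in \<open>simp add: W_def power_int_def mult_single power_mult_distrib\<close>)
        ultimately show ?thesis by (simp add: power_diff_sumr2)
      next
        case False
        define z' w' :: laurent where "z' = single (single z (-1)) (1::complex)"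
         and "w' = single (single w (-1)) (inverse c)"
        have "Z = z' ^ nat (-d)"
          by (rule ev_eqI) (use False in \<open>simp add: Z_def z'_def power_int_def power_int_minus power_inverse\<close>)
        moreover have "W = w' ^ nat (-d)"
          by (rule ev_eqI) (use False in \<open>simp add: W_def w'_def power_int_def power_int_minus power_inverse power_mult_distrib\<close>)
        moreover have "LV z * z' = 1" "LC c * LV w * w' = 1"
          by (simp_all add: mult_single z'_def w'_def \<open>c \<noteq> 0\<close> flip: single_add)
        ultimately show ?thesis using diff_dvd_powi_diff(2) by metis
      qed
      have "single \<mu> a - single (pushforward r \<mu>) (a * monom_eval s \<mu>) = m * (Z - W)"
      proof (rule ev_eqI)
        fix p :: "var \<Rightarrow> complex" assume p: "nz p"
        have mu: "\<mu> = (\<mu> - single z d) + single z d" by simp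
        have k: "q \<noteq> z" if "q \<in> keys (\<mu> - single z d)" for q
          using that by (auto simp: in_keys_iff lookup_minus d_def)
        have 1: "monom_eval q \<mu> = monom_eval q (\<mu> - single z d) * q z powi d"
          if "nz q" for q
          by (subst mu) (simp only: monom_eval_add[OF that] monom_eval_single)
        have 2: "nz (\<lambda>q. s q * p (r q))" using s p by (simp add: nz_def)
        have "monom_eval s \<mu> * monom_eval (p \<circ> r) \<mu> = monom_eval (\<lambda>q. s q * p (r q)) \<mu>"
          by (simp add: monom_eval_mult comp_def)
        also have "\<dots> = monom_eval (\<lambda>q. s q * p (r q)) (\<mu> - single z d) * (c * p w) powi d"
          by (subst 1[OF 2]) (simp add: s_def r_def)
        also have "monom_eval (\<lambda>q. s q * p (r q)) (\<mu> - single z d) = monom_eval p (\<mu> - single z d)"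
          by (rule monom_eval_cong) (use k in \<open>auto simp: s_def r_def\<close>)
        finally show "ev p (single \<mu> a - single (pushforward r \<mu>) (a * monom_eval s \<mu>)) = ev p (m * (Z - W))"
          using p by (simp add: monom_eval_pushforward m_def Z_def W_def 1[OF p] power_int_mult_distrib algebra_simps comp_def)
      qed
      then show ?thesis using ZW by simp
    qed
    then show ?thesis
      by (subst (1) poly_mapping_expand[of f]) (simp add: monom_subst_def dvd_sum flip: sum_subtractf)
  qed
  ultimately show ?thesis by simp
qed

lemma monom_subst_mult: "nz c \<Longrightarrow> monom_subst c w (f * g) = monom_subst c w f * monom_subst c w g"
  by (rule ev_eqI) (simp add: ev_monom_subst nz_def)

lemma monom_subst_prod: "nz c \<Longrightarrow> monom_subst c w (prod F A) = (\<Prod>a\<in>A. monom_subst c w (F a))"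
  by (rule ev_eqI) (simp add: ev_monom_subst nz_def)

text \<open>The quotient obtained from divisibility might involve foreign variables. Renaming these
  to \<open>z\<close> fixes both \<open>f\<close> and the linear form, so it produces a quotient
  with the right support.\<close>

lemma linear_form_quotient:
  assumes "z \<noteq> w" "c \<noteq> 0" "z \<in> vars n m" "w \<in> vars n m" "laurent_in n m f"
    and "\<And>p. nz p \<Longrightarrow> p z = c * p w \<Longrightarrow> ev p f = 0"
  shows "\<exists>g. laurent_in n m g \<and> f = (LV z - LC c * LV w) * g"
proof -
  obtain g where g: "f = (LV z - LC c * LV w) * g"
    using linear_form_dvd[of z w c f] assms by (auto simp: dvd_def)
  define r where "r = (\<lambda>q. if q \<in> vars n m then q else z)"
  have "laurent_in n m (monom_subst (\<lambda>_. 1) r g)"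
  proof -
    have "keys (pushforward r \<mu>) \<subseteq> vars n m" for \<mu> :: "var \<Rightarrow>\<^sub>0 int"
      using keys_pushforward[of r \<mu>] assms(3) by (auto simp: r_def split: if_splits)
    then show ?thesis unfolding monom_subst_def by (intro laurent_in_sum) (auto simp: laurent_in_vars)
  qed
  moreover have "f = (LV z - LC c * LV w) * monom_subst (\<lambda>_. 1) r g"
  proof (rule ev_eqI)
    fix p :: "var \<Rightarrow> complex" assume p: "nz p"
    have "ev p f = ev (p \<circ> r) f"
      by (rule ev_cong[OF assms(5)]) (simp add: r_def)
    also have "\<dots> = (p z - c * p w) * ev (p \<circ> r) g"
      using p assms(3,4) by (simp add: g r_def)
    finally show "ev p f = ev p ((LV z - LC c * LV w) * monom_subst (\<lambda>_. 1) r g)"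
      using p by (simp add: ev_monom_subst comp_def)
  qed
  ultimately show ?thesis by blast
qed

text \<open>The forms are split off one at a time. On the hyperplane of the next form none of the
  earlier ones vanishes identically, because their pairs of variables are different; hence the
  remaining quotient vanishes there.\<close>

lemma linear_forms_quotient:
  assumes "finite I" "inj_on (\<lambda>i. {z i, w i}) I"
    and "\<And>i. i \<in> I \<Longrightarrow> z i \<noteq> w i \<and> c i \<noteq> 0 \<and> z i \<in> vars n m \<and> w i \<in> vars n m"
    and "laurent_in n m f"
    and "\<And>i p. i \<in> I \<Longrightarrow> nz p \<Longrightarrow> p (z i) = c i * p (w i) \<Longrightarrow> ev p f = 0"
  shows "\<exists>g. laurent_in n m g \<and> f = (\<Prod>i\<in>I. LV (z i) - LC (c i) * LV (w i)) * g"
  using assms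
proof (induction I rule: finite_induct)
  case empty
  then show ?case by auto
next
  case (insert i I)
  let ?P = "\<Prod>i\<in>I. LV (z i) - LC (c i) * LV (w i)"
  obtain g where g: "laurent_in n m g" "f = ?P * g"
    using insert.IH insert.prems by (auto simp: inj_on_insert)
  define s where "s = (\<lambda>_::var. 1::complex)(z i := c i)"
  define r where "r = id(z i := w i)"
  have s: "nz s" using insert.prems(2) by (auto simp: s_def nz_def)
  have zw: "z i \<noteq> w i" using insert.prems(2) by auto
  have sr: "nz (\<lambda>q. s q * p (r q))" if "nz p" for p using s that by (simp add: nz_def)
  have "monom_subst s r f = 0"
  proof (rule ev_faithful)
    fix p :: "var \<Rightarrow> complex" assume p: "nz p"
    have "s (z i) * p (r (z i)) = c i * (s (w i) * p (r (w i)))"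
      using zw by (simp add: s_def r_def)
    then show "ev p (monom_subst s r f) = 0"
      using insert.prems(4)[of i, OF _ sr[OF p]] by (simp add: ev_monom_subst p)
  qed
  moreover have "monom_subst s r (LV (z j) - LC (c j) * LV (w j)) \<noteq> 0" if j: "j \<in> I" for j
  proof -
    have "{z j, w j} \<noteq> {z i, w i}" "z j \<noteq> w j"
      using insert.prems insert.hyps j by (auto simp: inj_on_def)
    then have rr: "r (z j) \<noteq> r (w j)" using zw by (auto simp: r_def)
    \<comment> \<open>At this point the two terms of the substituted form are
      \<open>2 * c j * s (w j)\<close> and \<open>c j * s (w j)\<close>, so their difference is
      nonzero.\<close>
    define p where "p = (\<lambda>_::var. 1::complex)(r (z j) := 2 * c j * s (w j) / s (z j))"
    have cj: "c j \<noteq> 0" using insert.prems j by auto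
    have p: "nz p" using cj s by (simp add: p_def nz_def)
    have "ev p (monom_subst s r (LV (z j) - LC (c j) * LV (w j))) = c j * s (w j)"
      using rr nzD[OF s] sr[OF p] p by (simp add: ev_monom_subst) (simp add: p_def)
    then show ?thesis using cj nzD[OF s] by (metis ev_0 mult_eq_0_iff)
  qed
  ultimately have "monom_subst s r g = 0"
    using insert.hyps by (auto simp: g monom_subst_mult[OF s] monom_subst_prod[OF s])
  have "\<exists>h. laurent_in n m h \<and> g = (LV (z i) - LC (c i) * LV (w i)) * h"
  proof (rule linear_form_quotient)
    fix p :: "var \<Rightarrow> complex" assume p: "nz p" "p (z i) = c i * p (w i)"
    have "(\<lambda>q. s q * p (r q)) = p" using p by (auto simp: s_def r_def)
    then show "ev p g = 0" using ev_monom_subst[OF p(1), of s r g] \<open>monom_subst s r g = 0\<close> by simp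
  qed (use insert.prems(2) g zw in auto)
  then obtain h where "laurent_in n m h" "g = (LV (z i) - LC (c i) * LV (w i)) * h" by blast
  then show ?case using insert.hyps g by (auto simp: mult_ac)
qed

section \<open>Evaluation in the variables \<open>x\<close> and \<open>y\<close>\<close>

abbreviation leval :: "point \<Rightarrow> point \<Rightarrow> laurent \<Rightarrow> complex" where
  "leval \<equiv> laurent_eval"

lemma leval_simps [simp]:
  "leval x y 0 = 0" "leval x y 1 = 1"
  "leval x y (f + g) = leval x y f + leval x y g" "leval x y (f - g) = leval x y f - leval x y g"
  "leval x y (- f) = - leval x y f"
  "leval x y (sum F A) = (\<Sum>a\<in>A. leval x y (F a))"
  "leval x y (LC c) = c"
  "leval x y (single (single (X i) a) c) = c * x i powi a"
  "leval x y (single (single (Y i) a) c) = c * y i powi a"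
  by (simp_all add: laurent_eval_ev)

lemma leval_mult [simp]: "nz x \<Longrightarrow> nz y \<Longrightarrow> leval x y (f * g) = leval x y f * leval x y g"
  and leval_prod [simp]: "nz x \<Longrightarrow> nz y \<Longrightarrow> leval x y (prod F A) = (\<Prod>a\<in>A. leval x y (F a))"
  and leval_rename [simp]: "nz x \<Longrightarrow> nz y \<Longrightarrow> leval x y (laurent_rename \<sigma> \<tau> f) = leval (x \<circ> \<sigma>) (y \<circ> \<tau>) f"
  by (simp_all add: laurent_eval_ev ev_rename case_var_rename)

lemma leval_of_int [simp]: "leval x y (of_int a) = of_int a"
proof -
  have "leval x y (of_nat k) = of_nat k" for k by (induction k) simp_all
  then show ?thesis by (cases a rule: int_cases2) simp_all
qed

lemma leval_eqI:
  assumes "\<And>x y. nz x \<Longrightarrow> nz y \<Longrightarrow> leval x y f = leval x y g"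
  shows "f = g"
proof (rule ev_eqI)
  fix p :: "var \<Rightarrow> complex" assume p: "nz p"
  have c: "case_var (\<lambda>i. p (X i)) (\<lambda>i. p (Y i)) = p"
  proof
    fix z show "case_var (\<lambda>i. p (X i)) (\<lambda>i. p (Y i)) z = p z" by (cases z) auto
  qed
  have "nz (\<lambda>i. p (X i))" "nz (\<lambda>i. p (Y i))" using p by (auto simp: nz_def)
  from assms[OF this] show "ev p f = ev p g" by (simp add: laurent_eval_ev c)
qed

lemma leval_cong:
  assumes "laurent_in n m f" "\<And>i. i < n \<Longrightarrow> x i = x' i" "\<And>j. j < m \<Longrightarrow> y j = y' j"
  shows "leval x y f = leval x' y' f"
  unfolding laurent_eval_ev
  by (rule ev_cong[OF assms(1)]) (use assms(2,3) in \<open>auto simp: vars_def\<close>)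

lemma case_var_upd:
  "case_var (x(i := c)) y = (case_var x y)(X i := c)"
  "case_var x (y(i := c)) = (case_var x y)(Y i := c)"
  by (auto simp: fun_eq_iff split: var.splits)

section \<open>Coefficients with respect to one variable\<close>

definition vcoeff :: "var \<Rightarrow> int \<Rightarrow> laurent \<Rightarrow> laurent" where
  "vcoeff z d f = (\<Sum>\<mu> | \<mu> \<in> keys f \<and> lookup \<mu> z = d.
     single (\<mu> - single z d) (lookup f \<mu>))"

definition deg_in :: "var \<Rightarrow> int \<Rightarrow> int \<Rightarrow> laurent \<Rightarrow> bool" where
  "deg_in z a b f \<longleftrightarrow>
     (\<forall>\<mu>\<in>keys f. a \<le> lookup \<mu> z \<and> lookup \<mu> z \<le> b)"

lemma lookup_vcoeff:
  "lookup (vcoeff z d f) \<nu> =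
     (if lookup \<nu> z = 0 then lookup f (\<nu> + single z d) else 0)"
proof -
  have "lookup (vcoeff z d f) \<nu> =
    (\<Sum>\<mu> | \<mu> \<in> keys f \<and> lookup \<mu> z = d.
       if \<mu> = \<nu> + single z d then lookup f \<mu> else 0)"
    unfolding vcoeff_def lookup_sum lookup_single when_def
    by (rule sum.cong) (auto simp: algebra_simps)
  also have "\<dots> = (if lookup \<nu> z = 0 then lookup f (\<nu> + single z d) else 0)"
    by (subst sum.delta) (auto simp: lookup_add in_keys_iff)
  finally show ?thesis .
qed

lemma vcoeff_diff: "vcoeff z d (f - g) = vcoeff z d f - vcoeff z d g"
  and vcoeff_0 [simp]: "vcoeff z d 0 = 0"
  by (rule poly_mapping_eqI; simp add: lookup_vcoeff lookup_add lookup_minus)+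

lemma lookup_LC_mult: "lookup (LC c * f) \<mu> = c * lookup f \<mu>"
proof -
  have "LC c * f = (\<Sum>k\<in>keys f. single k (c * lookup f k))"
    by (subst (1) poly_mapping_expand[of f]) (simp add: sum_distrib_left mult_single)
  then show ?thesis
    by (simp add: lookup_sum lookup_single when_def in_keys_iff)
qed

lemma vcoeff_LC_mult: "vcoeff z d (LC c * f) = LC c * vcoeff z d f"
  by (rule poly_mapping_eqI) (simp add: lookup_vcoeff lookup_LC_mult)

lemma ev_vcoeff_upd: "ev (p(z := c)) (vcoeff z d f) = ev p (vcoeff z d f)"
proof -
  have "monom_eval (p(z := c)) \<mu> = monom_eval p \<mu>" if "\<mu> \<in> keys (vcoeff z d f)" for \<mu>
    by (rule monom_eval_cong) (use that in \<open>auto simp: in_keys_iff lookup_vcoeff split: if_splits\<close>)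
  then show ?thesis by (simp add: ev_def)
qed

lemma keys_vcoeff:
  "\<nu> \<in> keys (vcoeff z d f) \<longleftrightarrow>
     lookup \<nu> z = 0 \<and> \<nu> + single z d \<in> keys f"
  by (simp add: in_keys_iff lookup_vcoeff)

lemma keys_vcoeff_vars:
  assumes "laurent_in n m f" "\<nu> \<in> keys (vcoeff z d f)"
  shows "keys \<nu> \<subseteq> vars n m - {z}"
proof
  fix q assume q: "q \<in> keys \<nu>"
  have 1: "lookup \<nu> z = 0" "\<nu> + single z d \<in> keys f"
    using assms(2) by (auto simp: keys_vcoeff)
  then have "q \<noteq> z" using q by (auto simp: in_keys_iff)
  moreover from this have "q \<in> keys (\<nu> + single z d)"
    using q by (simp add: in_keys_iff lookup_add lookup_single)
  ultimately show "q \<in> vars n m - {z}" using 1 assms(1) unfolding laurent_in_vars by blast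
qed

lemma laurent_in_vcoeff_X:
  assumes "laurent_in (Suc n) m f" shows "laurent_in n m (vcoeff (X n) d f)"
proof -
  have "vars (Suc n) m - {X n} \<subseteq> vars n m" by (auto simp: vars_def less_Suc_eq)
  then show ?thesis using keys_vcoeff_vars[OF assms] unfolding laurent_in_vars by (meson subset_trans)
qed

lemma laurent_in_vcoeff_Y:
  assumes "laurent_in n (Suc m) f" shows "laurent_in n m (vcoeff (Y m) d f)"
proof -
  have "vars n (Suc m) - {Y m} \<subseteq> vars n m" by (auto simp: vars_def less_Suc_eq)
  then show ?thesis using keys_vcoeff_vars[OF assms] unfolding laurent_in_vars by (meson subset_trans)
qed

lemma ev_vcoeff:
  assumes "nz p"
  shows "p z powi d * ev p (vcoeff z d f) =
    (\<Sum>\<mu> | \<mu> \<in> keys f \<and> lookup \<mu> z = d. lookup f \<mu> * monom_eval p \<mu>)"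
proof -
  have "p z powi d * monom_eval p (\<mu> - single z d) = monom_eval p \<mu>" for \<mu>
    using monom_eval_add[OF assms, of "single z d" "\<mu> - single z d"] by simp
  then show ?thesis by (simp add: vcoeff_def sum_distrib_left mult.left_commute[of "p z powi d"])
qed

lemma ev_vcoeff_expand:
  assumes "nz p" "finite D" "(\<lambda>\<mu>. lookup \<mu> z) ` keys f \<subseteq> D"
  shows "ev p f = (\<Sum>d\<in>D. p z powi d * ev p (vcoeff z d f))"
  unfolding ev_vcoeff[OF assms(1)] ev_def[of p f]
  using sum.group[OF _ assms(2,3), of "\<lambda>\<mu>. lookup f \<mu> * monom_eval p \<mu>"] by simp

lemma powi_independent:
  assumes "finite D" "\<And>T. T \<noteq> 0 \<Longrightarrow> (\<Sum>d\<in>D. T powi d * c d) = (0::complex)" "d \<in> D"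
  shows "c d = 0"
proof -
  define K where "K = single (X 0) ` D"
  have inj: "inj_on (single (X 0)) D"
    by (rule inj_onI) (metis lookup_single_eq)
  have "(\<lambda>\<mu>. c (lookup \<mu> (X 0))) (single (X 0) d) = 0"
  proof (rule monom_eval_independent[of K])
    fix p :: "var \<Rightarrow> complex" assume "nz p"
    then show "(\<Sum>\<mu>\<in>K. c (lookup \<mu> (X 0)) * monom_eval p \<mu>) = 0"
      using assms(2)[of "p (X 0)"] by (simp add: K_def sum.reindex[OF inj] nz_def mult.commute)
  qed (use assms in \<open>auto simp: K_def\<close>)
  then show ?thesis by simp
qed

text \<open>A proportionality between values of \<open>f\<close> that holds for every value
  \<open>T\<close> of \<open>z\<close> is an identity of Laurent polynomials in \<open>T\<close>,
  hence holds for each coefficient. Skewness and vanishing on chains pass to coefficients in this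
  way.\<close>

lemma ev_vcoeff_transfer:
  assumes "nz p" "nz q" "\<And>T. T \<noteq> 0 \<Longrightarrow> ev (q(z := T)) f = a * ev (p(z := T)) f"
  shows "ev q (vcoeff z d f) = a * ev p (vcoeff z d f)"
proof -
  define D where "D = insert d ((\<lambda>\<mu>. lookup \<mu> z) ` keys f)"
  have "ev q (vcoeff z d f) - a * ev p (vcoeff z d f) = 0"
  proof (rule powi_independent[of D "\<lambda>d. ev q (vcoeff z d f) - a * ev p (vcoeff z d f)"])
    fix T :: complex assume T: "T \<noteq> 0"
    have "(\<Sum>d\<in>D. T powi d * (ev q (vcoeff z d f) - a * ev p (vcoeff z d f)))
      = (\<Sum>d\<in>D. T powi d * ev q (vcoeff z d f)) - a * (\<Sum>d\<in>D. T powi d * ev p (vcoeff z d f))"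
      by (simp add: algebra_simps sum_subtractf sum_distrib_left)
    also have "(\<Sum>d\<in>D. T powi d * ev q (vcoeff z d f)) = ev (q(z := T)) f"
      by (subst ev_vcoeff_expand[of "q(z := T)" D z]) (use assms T in \<open>auto simp: D_def ev_vcoeff_upd\<close>)
    also have "(\<Sum>d\<in>D. T powi d * ev p (vcoeff z d f)) = ev (p(z := T)) f"
      by (subst ev_vcoeff_expand[of "p(z := T)" D z]) (use assms T in \<open>auto simp: D_def ev_vcoeff_upd\<close>)
    finally show "(\<Sum>d\<in>D. T powi d * (ev q (vcoeff z d f) - a * ev p (vcoeff z d f))) = 0"
      using assms(3)[OF T] by (simp add: fun_upd_def)
  qed (auto simp: D_def)
  then show ?thesis by simp
qed

lemma powi_neg_tendsto_0:
  assumes "e < 0" shows "((\<lambda>T::complex. T powi e) \<longlongrightarrow> 0) at_infinity"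
proof -
  define n where "n = nat (- e)"
  have n: "n > 0" "e = - int n" using assms by (auto simp: n_def)
  have "((\<lambda>T::complex. inverse T ^ n) \<longlongrightarrow> 0 ^ n) at_infinity"
    by (intro tendsto_power tendsto_inverse_0)
  then show ?thesis using n by (simp add: power_int_minus power_inverse zero_power)
qed

lemma eventually_nonzero_at_infinity: "eventually (\<lambda>T::complex. T \<noteq> 0) at_infinity"
  unfolding eventually_at_infinity by (intro exI[of _ 1]) auto

text \<open>After division by \<open>T powi b\<close> all lower terms tend to 0. Limits are
  multiplicative, so leading coefficients of products are found without expanding them. As
  \<open>b\<close> is only an upper bound, the limit may be 0.\<close>

lemma vcoeff_limit:
  assumes "nz p" "deg_in z a b f"
  shows "((\<lambda>T. ev (p(z := T)) f * T powi (- b)) \<longlongrightarrow> ev p (vcoeff z b f)) at_infinity"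
proof -
  define D where "D = insert b ((\<lambda>\<mu>. lookup \<mu> z) ` keys f)"
  have D: "finite D" "\<And>d. d \<in> D \<Longrightarrow> d \<le> b" "b \<in> D"
    using assms(2) by (auto simp: D_def deg_in_def)
  have "((\<lambda>T. \<Sum>d\<in>D. T powi (d - b) * ev p (vcoeff z d f)) \<longlongrightarrow> (\<Sum>d\<in>D. (if d = b then 1 else 0) * ev p (vcoeff z d f))) at_infinity"
  proof (intro tendsto_sum tendsto_mult tendsto_const)
    fix d assume "d \<in> D"
    show "((\<lambda>T::complex. T powi (d - b)) \<longlongrightarrow> (if d = b then 1 else 0)) at_infinity"
      using D(2)[OF \<open>d \<in> D\<close>] powi_neg_tendsto_0[of "d - b"] by auto
  qed
  moreover have "(\<Sum>d\<in>D. (if d = b then 1 else 0) * ev p (vcoeff z d f)) = ev p (vcoeff z b f)"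
    using D by (simp add: if_distrib[of "\<lambda>c. c * _"] cong: if_cong)
  moreover have "eventually (\<lambda>T. (\<Sum>d\<in>D. T powi (d - b) * ev p (vcoeff z d f)) = ev (p(z := T)) f * T powi (- b)) at_infinity"
    using eventually_nonzero_at_infinity
  proof eventually_elim
    case (elim T)
    have "ev (p(z := T)) f = (\<Sum>d\<in>D. T powi d * ev p (vcoeff z d f))"
      by (subst ev_vcoeff_expand[of "p(z := T)" D z]) (use assms elim D(1) in \<open>auto simp: D_def ev_vcoeff_upd\<close>)
    then show ?case using elim
      by (simp add: sum_distrib_left sum_distrib_right power_int_diff power_int_minus divide_inverse mult_ac)
  qed
  ultimately show ?thesis by (simp add: tendsto_cong)
qed

lemma deg_in_add [intro]: "deg_in z a b f \<Longrightarrow> deg_in z a b g \<Longrightarrow> deg_in z a b (f + g)"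
  unfolding deg_in_def using keys_add[of f g] by blast

lemma deg_in_uminus [intro]: "deg_in z a b f \<Longrightarrow> deg_in z a b (- f)"
  unfolding deg_in_def by simp

lemma deg_in_diff [intro]: "deg_in z a b f \<Longrightarrow> deg_in z a b g \<Longrightarrow> deg_in z a b (f - g)"
  using deg_in_add[of z a b f "- g"] by auto

lemma deg_in_0 [simp]: "deg_in z a b 0"
  by (simp add: deg_in_def)

lemma deg_in_sum [intro]: "(\<And>i. i \<in> I \<Longrightarrow> deg_in z a b (F i)) \<Longrightarrow> deg_in z a b (sum F I)"
  by (induction I rule: infinite_finite_induct) (auto simp: deg_in_add)

lemma deg_in_mult:
  assumes "deg_in z a b f" "deg_in z a' b' g"
  shows "deg_in z (a + a') (b + b') (f * g)"
  unfolding deg_in_def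
proof
  fix \<mu> assume "\<mu> \<in> keys (f * g)"
  then obtain k l where "k \<in> keys f" "l \<in> keys g" "\<mu> = k + l"
    using keys_mult[of f g] by blast
  then show "a + a' \<le> lookup \<mu> z \<and> lookup \<mu> z \<le> b + b'"
    using assms unfolding deg_in_def by (auto simp: lookup_add add_mono)
qed

lemma deg_in_prod:
  assumes "\<And>i. i \<in> I \<Longrightarrow> deg_in z (a i) (b i) (F i)"
  shows "deg_in z (sum a I) (sum b I) (prod F I)"
  using assms
proof (induction I rule: infinite_finite_induct)
  case (insert i I)
  then show ?case by (simp add: deg_in_mult)
qed (auto simp: deg_in_def simp flip: single_one)

lemma deg_in_mono: "deg_in z a b f \<Longrightarrow> a' \<le> a \<Longrightarrow> b \<le> b' \<Longrightarrow> deg_in z a' b' f"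
  unfolding deg_in_def by force

lemma deg_in_LC [simp]: "deg_in z 0 0 (LC c)"
  by (simp add: deg_in_def)

lemma deg_in_of_int [simp]: "deg_in z 0 0 (of_int k)"
proof -
  have "of_int k = LC (of_int k)" by (rule leval_eqI) simp
  then show ?thesis by (metis deg_in_LC)
qed

lemma deg_in_single: "deg_in z (if z = w then d else 0) (if z = w then d else 0) (single (single w d) c)"
  by (simp add: deg_in_def lookup_single when_def)

lemma deg_in_outside:
  assumes "laurent_in n m f" "z \<notin> vars n m" shows "deg_in z 0 0 f"
  unfolding deg_in_def
proof
  fix \<mu> assume "\<mu> \<in> keys f"
  then have "z \<notin> keys \<mu>" using assms unfolding laurent_in_vars by blast
  then show "0 \<le> lookup \<mu> z \<and> lookup \<mu> z \<le> 0" by (simp add: in_keys_iff)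
qed

lemma deg_in_exists: "\<exists>a b. \<forall>z\<in>Z. deg_in z a b f" if "finite Z"
proof -
  define S where "S = (\<lambda>(z, \<mu>). lookup \<mu> z) ` (Z \<times> keys f)"
  have "finite S" using that by (simp add: S_def)
  then obtain a b where "\<forall>s\<in>S. a \<le> s \<and> s \<le> (b::int)"
    by (metis Max_ge Min_le)
  then have "\<forall>z\<in>Z. deg_in z a b f" by (auto simp: S_def deg_in_def)
  then show ?thesis by blast
qed

lemma lookup_pushforward:
  assumes "inj h" shows "lookup (pushforward h f) (h k) = lookup f k"
  using assms by (auto simp: pushforward_def lookup_sum lookup_single when_def inj_eq in_keys_iff sum.delta)

lemma lookup_rename:
  assumes "inj \<sigma>" "inj \<tau>"
  shows "lookup (laurent_rename \<sigma> \<tau> f) (pushforward (rename_var \<sigma> \<tau>) \<mu>) = lookup f \<mu>"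
  unfolding laurent_rename_def by (intro lookup_pushforward inj_pushforward inj_rename_var assms)

lemma deg_in_rename:
  assumes "inj \<sigma>" "inj \<tau>" "deg_in z a b f"
  shows "deg_in (rename_var \<sigma> \<tau> z) a b (laurent_rename \<sigma> \<tau> f)"
  unfolding deg_in_def
proof
  fix \<mu> assume "\<mu> \<in> keys (laurent_rename \<sigma> \<tau> f)"
  then obtain \<nu> where \<nu>: "\<nu> \<in> keys f" "\<mu> = pushforward (rename_var \<sigma> \<tau>) \<nu>"
    using keys_pushforward[of "pushforward (rename_var \<sigma> \<tau>)" f] unfolding laurent_rename_def by auto
  then show "a \<le> lookup \<mu> (rename_var \<sigma> \<tau> z) \<and> lookup \<mu> (rename_var \<sigma> \<tau> z) \<le> b"
    using assms(3) by (simp add: deg_in_def lookup_pushforward inj_rename_var assms(1,2))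
qed

section \<open>Skew symmetry\<close>

text \<open>The index sets are arbitrary because the matched and the unmatched \<open>y\<close>
  later form two separate groups of skew variables.\<close>

definition skew :: "nat set \<Rightarrow> nat set \<Rightarrow> laurent \<Rightarrow> bool" where
  "skew A B f \<longleftrightarrow> (\<forall>\<sigma> \<tau> x y. \<sigma> permutes A \<longrightarrow> \<tau> permutes B \<longrightarrow> nz x \<longrightarrow> nz y \<longrightarrow>
     leval (x \<circ> \<sigma>) (y \<circ> \<tau>) f = of_int (sign \<sigma> * sign \<tau>) * leval x y f)"

lemma skewD:
  "skew A B f \<Longrightarrow> \<sigma> permutes A \<Longrightarrow> \<tau> permutes B \<Longrightarrow> nz x \<Longrightarrow> nz y \<Longrightarrow>
     leval (x \<circ> \<sigma>) (y \<circ> \<tau>) f = of_int (sign \<sigma> * sign \<tau>) * leval x y f"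
  unfolding skew_def by blast

lemma skewX:
  "skew A B f \<Longrightarrow> \<sigma> permutes A \<Longrightarrow> nz x \<Longrightarrow> nz y \<Longrightarrow> leval (x \<circ> \<sigma>) y f = of_int (sign \<sigma>) * leval x y f"
  using skewD[of A B f \<sigma> id x y] by (simp add: permutes_id)

lemma skewY:
  "skew A B f \<Longrightarrow> \<tau> permutes B \<Longrightarrow> nz x \<Longrightarrow> nz y \<Longrightarrow> leval x (y \<circ> \<tau>) f = of_int (sign \<tau>) * leval x y f"
  using skewD[of A B f id \<tau> x y] by (simp add: permutes_id)

lemma skewI:
  assumes "\<And>\<sigma> x y. \<sigma> permutes A \<Longrightarrow> nz x \<Longrightarrow> nz y \<Longrightarrow> leval (x \<circ> \<sigma>) y f = of_int (sign \<sigma>) * leval x y f"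
    and "\<And>\<tau> x y. \<tau> permutes B \<Longrightarrow> nz x \<Longrightarrow> nz y \<Longrightarrow> leval x (y \<circ> \<tau>) f = of_int (sign \<tau>) * leval x y f"
  shows "skew A B f"
  unfolding skew_def using assms by simp

lemma skew_0 [simp]: "skew A B 0"
  by (simp add: skew_def)

lemma skew_add: "skew A B f \<Longrightarrow> skew A B g \<Longrightarrow> skew A B (f + g)"
  by (simp add: skew_def algebra_simps)

lemma skew_diff: "skew A B f \<Longrightarrow> skew A B g \<Longrightarrow> skew A B (f - g)"
  by (simp add: skew_def algebra_simps)

lemma skew_LC_mult: "skew A B f \<Longrightarrow> skew A B (LC c * f)"
  by (simp add: skew_def)

lemma skew_coincide_Y:
  assumes "skew A B f" "i \<in> B" "j \<in> B" "i \<noteq> j" "y i = y j" "nz x" "nz y"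
  shows "leval x y f = 0"
proof -
  have "y \<circ> transpose i j = y" using assms(5) by (auto simp: fun_eq_iff transpose_def)
  then show ?thesis
    using skewY[OF assms(1) permutes_swap_id[OF assms(2,3)] assms(6,7)] assms(4)
    by (simp add: sign_swap_id)
qed

lemma skew_coincide_X:
  assumes "skew A B f" "i \<in> A" "j \<in> A" "i \<noteq> j" "x i = x j" "nz x" "nz y"
  shows "leval x y f = 0"
proof -
  have "x \<circ> transpose i j = x" using assms(5) by (auto simp: fun_eq_iff transpose_def)
  then show ?thesis
    using skewX[OF assms(1) permutes_swap_id[OF assms(2,3)] assms(6,7)] assms(4)
    by (simp add: sign_swap_id)
qed

lemma skew_vcoeff_Y:
  assumes f: "skew A B f" and "B' \<subseteq> B" "k \<notin> B'"
  shows "skew A B' (vcoeff (Y k) d f)"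
  unfolding skew_def
proof (intro allI impI)
  fix \<sigma> \<tau> and x y :: point
  assume \<sigma>: "\<sigma> permutes A" and \<tau>: "\<tau> permutes B'" and nz: "nz x" "nz y"
  have \<tau>': "\<tau> permutes B" using \<tau> assms(2) by (rule permutes_subset)
  have "\<tau> k = k" using \<tau> assms(3) by (simp add: permutes_def)
  then have \<tau>k: "\<tau> i = k \<longleftrightarrow> i = k" for i using permutes_inj[OF \<tau>] by (metis injD)
  have e: "(y \<circ> \<tau>)(k := T) = y(k := T) \<circ> \<tau>" for T using \<tau>k by (auto simp: fun_eq_iff)
  show "leval (x \<circ> \<sigma>) (y \<circ> \<tau>) (vcoeff (Y k) d f) = of_int (sign \<sigma> * sign \<tau>) * leval x y (vcoeff (Y k) d f)"
    unfolding laurent_eval_ev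
  proof (rule ev_vcoeff_transfer)
    fix T :: complex assume "T \<noteq> 0"
    then show "ev ((case_var (x \<circ> \<sigma>) (y \<circ> \<tau>))(Y k := T)) f = of_int (sign \<sigma> * sign \<tau>) * ev ((case_var x y)(Y k := T)) f"
      using skewD[OF f \<sigma> \<tau>' nz(1), of "y(k := T)"] nz(2)
      by (simp add: laurent_eval_ev flip: case_var_upd e)
  qed (use nz in auto)
qed

lemma skew_vcoeff_X:
  assumes f: "skew A B f" and "A' \<subseteq> A" "k \<notin> A'"
  shows "skew A' B (vcoeff (X k) d f)"
  unfolding skew_def
proof (intro allI impI)
  fix \<sigma> \<tau> and x y :: point
  assume \<sigma>: "\<sigma> permutes A'" and \<tau>: "\<tau> permutes B" and nz: "nz x" "nz y"
  have \<sigma>': "\<sigma> permutes A" using \<sigma> assms(2) by (rule permutes_subset)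
  have "\<sigma> k = k" using \<sigma> assms(3) by (simp add: permutes_def)
  then have \<sigma>k: "\<sigma> i = k \<longleftrightarrow> i = k" for i using permutes_inj[OF \<sigma>] by (metis injD)
  have e: "(x \<circ> \<sigma>)(k := T) = x(k := T) \<circ> \<sigma>" for T using \<sigma>k by (auto simp: fun_eq_iff)
  show "leval (x \<circ> \<sigma>) (y \<circ> \<tau>) (vcoeff (X k) d f) = of_int (sign \<sigma> * sign \<tau>) * leval x y (vcoeff (X k) d f)"
    unfolding laurent_eval_ev
  proof (rule ev_vcoeff_transfer)
    fix T :: complex assume "T \<noteq> 0"
    then show "ev ((case_var (x \<circ> \<sigma>) (y \<circ> \<tau>))(X k := T)) f = of_int (sign \<sigma> * sign \<tau>) * ev ((case_var x y)(X k := T)) f"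
      using skewD[OF f \<sigma>' \<tau> _ nz(2), of "x(k := T)"] nz(1)
      by (simp add: laurent_eval_ev flip: case_var_upd e)
  qed (use nz in auto)
qed

lemma skewY_transpositions:
  assumes "finite B"
    and f: "\<And>a b x y. a \<in> B \<Longrightarrow> b \<in> B \<Longrightarrow> a \<noteq> b \<Longrightarrow> nz x \<Longrightarrow> nz y \<Longrightarrow> leval x (y \<circ> transpose a b) f = - leval x y f"
    and \<tau>: "\<tau> permutes B" and nz: "nz x" "nz y"
  shows "leval x (y \<circ> \<tau>) f = of_int (sign \<tau>) * leval x y f"
  using \<tau> assms(1) nz(2)
proof (induction arbitrary: y rule: permutes_induct)
  case id
  then show ?case by simp
next
  case (swap a b p)
  have "sign (transpose a b \<circ> p) = sign (transpose a b) * sign p"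
    by (rule sign_compose) (use swap(4) assms(1) permutation_swap_id permutes_imp_permutation in auto)
  moreover have "leval x (y \<circ> (transpose a b \<circ> p)) f = of_int (sign p) * leval x (y \<circ> transpose a b) f"
    unfolding comp_assoc[symmetric] by (rule swap.IH) (use swap.prems in \<open>simp add: nz_def\<close>)
  ultimately show ?case using f[OF swap(1,2,3) nz(1) swap.prems] swap(3) by (simp add: sign_swap_id comp_def)
qed

text \<open>Coset decomposition of an antisymmetrisation: \<open>transpose k b\<close>, \<open>b \<le> k\<close>, represent
  \<open>S\<^bsub>k+1\<^esub> / S\<^bsub>k\<^esub>\<close>.\<close>

lemma antisym_cosets:
  fixes \<Phi> :: "point \<Rightarrow> complex"
  assumes "\<And>\<tau> y. \<tau> permutes {..<k} \<Longrightarrow> nz y \<Longrightarrow> \<Phi> (y \<circ> \<tau>) = of_int (sign \<tau>) * \<Phi> y" "nz y"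
  shows "(\<Sum>\<tau> | \<tau> permutes {..<Suc k}. of_int (sign \<tau>) * \<Phi> (y \<circ> \<tau>)) =
    of_nat (fact k) * (\<Sum>b\<le>k. of_int (sign (transpose k b)) * \<Phi> (y \<circ> transpose k b))"
proof -
  have "(\<Sum>\<tau> | \<tau> permutes {..<Suc k}. of_int (sign \<tau>) * \<Phi> (y \<circ> \<tau>)) =
    (\<Sum>b\<in>insert k {..<k}. \<Sum>q | q permutes {..<k}. of_int (sign (transpose k b \<circ> q)) * \<Phi> (y \<circ> (transpose k b \<circ> q)))"
    unfolding lessThan_Suc by (rule sum_over_permutations_insert) auto
  also have "\<dots> = (\<Sum>b\<in>insert k {..<k}. \<Sum>q | q permutes {..<k}. of_int (sign (transpose k b)) * \<Phi> (y \<circ> transpose k b))"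
  proof (intro sum.cong refl)
    fix b q assume "q \<in> {q. q permutes {..<k}}"
    then have q: "q permutes {..<k}" by simp
    have s: "sign (transpose k b \<circ> q) = sign (transpose k b) * sign q"
      by (rule sign_compose) (use q permutation_swap_id permutes_imp_permutation in auto)
    have "\<Phi> (y \<circ> (transpose k b \<circ> q)) = of_int (sign q) * \<Phi> (y \<circ> transpose k b)"
      using assms(1)[OF q, of "y \<circ> transpose k b"] assms(2) by (simp add: comp_assoc)
    then show "of_int (sign (transpose k b \<circ> q)) * \<Phi> (y \<circ> (transpose k b \<circ> q)) = of_int (sign (transpose k b)) * \<Phi> (y \<circ> transpose k b)"
      by (simp add: s mult.assoc flip: of_int_mult)
  qed
  also have "\<dots> = of_nat (fact k) * (\<Sum>b\<le>k. of_int (sign (transpose k b)) * \<Phi> (y \<circ> transpose k b))"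
    by (simp add: card_permutations sum_distrib_left lessThan_Suc_atMost flip: lessThan_Suc)
  finally show ?thesis .
qed

text \<open>By the coset decomposition the sum is the full antisymmetrisation divided by
  \<open>fact k\<close>, and there \<open>\<rho>\<close> acts by reindexing the group.\<close>

lemma antisym_skew:
  fixes \<Phi> :: "point \<Rightarrow> complex"
  assumes "\<And>\<tau> y. \<tau> permutes {..<k} \<Longrightarrow> nz y \<Longrightarrow> \<Phi> (y \<circ> \<tau>) = of_int (sign \<tau>) * \<Phi> y" "nz y"
    and \<rho>: "\<rho> permutes {..<Suc k}"
  shows "(\<Sum>b\<le>k. of_int (sign (transpose k b)) * \<Phi> (y \<circ> \<rho> \<circ> transpose k b)) =
    of_int (sign \<rho>) * (\<Sum>b\<le>k. of_int (sign (transpose k b)) * \<Phi> (y \<circ> transpose k b))"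
proof -
  have "of_int (sign \<rho>) * (\<Sum>\<tau> | \<tau> permutes {..<Suc k}. of_int (sign \<tau>) * \<Phi> (y \<circ> \<tau>))
    = of_int (sign \<rho>) * (\<Sum>\<tau> | \<tau> permutes {..<Suc k}. of_int (sign (\<rho> \<circ> \<tau>)) * \<Phi> (y \<circ> (\<rho> \<circ> \<tau>)))"
    by (subst setum_permutations_compose_left[OF \<rho>]) (rule refl)
  also have "\<dots> = (\<Sum>\<tau> | \<tau> permutes {..<Suc k}. of_int (sign \<tau>) * \<Phi> (y \<circ> \<rho> \<circ> \<tau>))"
    unfolding sum_distrib_left
  proof (intro sum.cong refl)
    fix \<tau> assume "\<tau> \<in> {\<tau>. \<tau> permutes {..<Suc k}}"
    then have "sign (\<rho> \<circ> \<tau>) = sign \<rho> * sign \<tau>"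
      by (intro sign_compose) (use \<rho> permutes_imp_permutation in auto)
    then show "of_int (sign \<rho>) * (of_int (sign (\<rho> \<circ> \<tau>)) * \<Phi> (y \<circ> (\<rho> \<circ> \<tau>))) = of_int (sign \<tau>) * \<Phi> (y \<circ> \<rho> \<circ> \<tau>)"
      by (simp add: comp_assoc flip: mult.assoc of_int_mult)
  qed
  finally show ?thesis
    using antisym_cosets[of k \<Phi> y] antisym_cosets[of k \<Phi> "y \<circ> \<rho>"] assms by (simp add: mult.left_commute)
qed

section \<open>The Vandermonde product\<close>

definition vandermonde :: "nat \<Rightarrow> point \<Rightarrow> complex" where
  "vandermonde k y = (\<Prod>j<k. \<Prod>i<j. y j - y i)"

lemma vandermonde_Suc: "vandermonde (Suc k) y = vandermonde k y * (\<Prod>i<k. y k - y i)"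
  by (simp add: vandermonde_def)

lemma vandermonde_cong: "(\<And>i. i < k \<Longrightarrow> y i = y' i) \<Longrightarrow> vandermonde k y = vandermonde k y'"
  unfolding vandermonde_def by (intro prod.cong) auto

lemma vandermonde_neq_0: "inj_on y {..<k} \<Longrightarrow> vandermonde k y \<noteq> 0"
  unfolding vandermonde_def inj_on_def by (simp, metis lessThan_iff less_trans nat_neq_iff)

lemma vandermonde_swap: "vandermonde (Suc (Suc k)) (y \<circ> transpose k (Suc k)) = - vandermonde (Suc (Suc k)) y"
proof -
  have 1: "vandermonde k (y \<circ> transpose k (Suc k)) = vandermonde k y"
    by (rule vandermonde_cong) (simp add: transpose_def)
  have 2: "(\<Prod>i<k. c - (y \<circ> transpose k (Suc k)) i) = (\<Prod>i<k. c - y i)" for c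
    by (rule prod.cong) (simp_all add: transpose_def)
  show ?thesis
    by (simp add: vandermonde_Suc 1 2) (simp add: algebra_simps)
qed

lemma vandermonde_permute:
  "\<sigma> permutes {..<k} \<Longrightarrow> vandermonde k (y \<circ> \<sigma>) = of_int (sign \<sigma>) * vandermonde k y"
proof (induction k arbitrary: \<sigma> y)
  case 0
  then show ?case by simp
next
  case (Suc k)
  define b where "b = \<sigma> k"
  define q where "q = transpose k b \<circ> \<sigma>"
  have q: "q permutes {..<k}"
    using permutes_insert_lemma[of \<sigma> k "{..<k}"] Suc.prems by (simp add: q_def b_def lessThan_Suc)
  have \<sigma>: "\<sigma> = transpose k b \<circ> q" by (simp add: q_def fun_eq_iff)
  have b: "b \<le> k" using permutes_in_image[OF Suc.prems, of k] by (simp add: b_def)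
  have low: "vandermonde (Suc k) (z \<circ> p) = of_int (sign p) * vandermonde (Suc k) z"
    if p: "p permutes {..<k}" for p and z :: point
  proof -
    have "p k = k" using p by (simp add: permutes_def)
    moreover have "(\<Prod>i<k. z k - z (p i)) = (\<Prod>i<k. z k - z i)"
      using prod.permute[OF p, of "\<lambda>i. z k - z i"] by (simp add: comp_def)
    ultimately show ?thesis using Suc.IH[OF p, of z]
      by (simp add: vandermonde_Suc comp_def)
  qed
  have "vandermonde (Suc k) (y \<circ> transpose k b) = of_int (sign (transpose k b)) * vandermonde (Suc k) y"
  proof (cases "b = k")
    case False
    then obtain l where l: "k = Suc l" using b by (cases k) auto
    \<comment> \<open>A transposition that moves \<open>k\<close> is conjugate, under one that fixes
      \<open>k\<close>, to the transposition of the last two indices.\<close>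
    define r where "r = transpose b l"
    have r: "r permutes {..<k}" using b False l by (auto simp: r_def intro: permutes_swap_id)
    have "transpose k b = r \<circ> transpose l (Suc l) \<circ> r"
      using b False l by (auto simp: fun_eq_iff transpose_def r_def)
    then have "vandermonde (Suc k) (y \<circ> transpose k b) = vandermonde (Suc k) (y \<circ> r \<circ> transpose l (Suc l) \<circ> r)"
      by (simp add: comp_assoc)
    also have "\<dots> = of_int (sign r) * (- (of_int (sign r) * vandermonde (Suc k) y))"
      by (subst low[OF r]) (simp add: l vandermonde_swap flip: low[OF r, unfolded l])
    finally show ?thesis using False by (simp add: sign_swap_id flip: mult.assoc of_int_mult)
  qed simp
  moreover have "sign \<sigma> = sign (transpose k b) * sign q"
    unfolding \<sigma> by (rule sign_compose) (use q permutation_swap_id permutes_imp_permutation in auto)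
  moreover have "vandermonde (Suc k) (y \<circ> \<sigma>) = of_int (sign q) * vandermonde (Suc k) (y \<circ> transpose k b)"
    using low[OF q, of "y \<circ> transpose k b"] by (simp add: \<sigma> comp_assoc)
  ultimately show ?case by (simp only: of_int_mult mult_ac)
qed

definition vandermonde_poly :: "nat \<Rightarrow> laurent" where
  "vandermonde_poly k = (\<Prod>j<k. \<Prod>i<j. LV (Y j) - LV (Y i))"

lemma leval_vandermonde_poly [simp]: "nz x \<Longrightarrow> nz y \<Longrightarrow> leval x y (vandermonde_poly k) = vandermonde k y"
  by (simp add: vandermonde_poly_def vandermonde_def)

lemma ex_nz_inj: "\<exists>y :: nat \<Rightarrow> complex. nz y \<and> inj y"
  by (rule exI[of _ "\<lambda>i. of_nat (Suc i)"]) (auto simp: nz_def inj_def simp del: of_nat_Suc)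

lemma vandermonde_poly_neq_0 [simp]: "vandermonde_poly k \<noteq> 0"
proof
  assume "vandermonde_poly k = 0"
  obtain y :: point where "nz y" "inj y" using ex_nz_inj by blast
  then show False
    using leval_vandermonde_poly[of y y k] vandermonde_neq_0[of y k] \<open>vandermonde_poly k = 0\<close> by (simp add: inj_on_subset)
qed

lemma at_infinity_neq_bot: "(at_infinity :: complex filter) \<noteq> bot"
proof
  assume "(at_infinity :: complex filter) = bot"
  then have "eventually (\<lambda>_::complex. False) at_infinity" by simp
  then obtain b where "\<forall>z::complex. b \<le> norm z \<longrightarrow> False"
    unfolding eventually_at_infinity by auto
  from this[rule_format, of "of_real \<bar>b\<bar>"] show False using abs_ge_self[of b] by simp
qed

lemma linear_form_limit: "((\<lambda>T. (T - c) * T powi (-1)) \<longlongrightarrow> (1::complex)) at_infinity"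
proof -
  have "((\<lambda>T::complex. 1 - c * inverse T) \<longlongrightarrow> 1 - c * 0) at_infinity"
    by (intro tendsto_intros tendsto_inverse_0)
  moreover have "eventually (\<lambda>T::complex. 1 - c * inverse T = (T - c) * T powi (-1)) at_infinity"
    using eventually_nonzero_at_infinity by eventually_elim (simp add: power_int_minus field_simps)
  ultimately show ?thesis by (simp add: tendsto_cong)
qed

lemma linear_forms_limit:
  "finite I \<Longrightarrow> ((\<lambda>T. (\<Prod>i\<in>I. T - c i) * T powi (- int (card I))) \<longlongrightarrow> (1::complex)) at_infinity"
proof (induction I rule: finite_induct)
  case (insert i I)
  have "((\<lambda>T. (T - c i) * T powi (-1) * ((\<Prod>i\<in>I. T - c i) * T powi (- int (card I)))) \<longlongrightarrow> 1 * 1) at_infinity"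
    by (intro tendsto_mult linear_form_limit insert.IH)
  moreover have "eventually (\<lambda>T::complex. (T - c i) * T powi (-1) * ((\<Prod>i\<in>I. T - c i) * T powi (- int (card I)))
    = (\<Prod>i\<in>insert i I. T - c i) * T powi (- int (card (insert i I)))) at_infinity"
    using eventually_nonzero_at_infinity
    by eventually_elim (use insert.hyps in \<open>simp add: power_int_diff power_int_minus field_simps\<close>)
  ultimately show ?case by (simp add: tendsto_cong)
qed simp

lemma deg_in_linear_form:
  "deg_in z 0 (if z = Y k \<or> z = Y i then 1 else 0) (LV (Y k) - LC c * LV (Y i))"
proof (rule deg_in_diff)
  show "deg_in z 0 (if z = Y k \<or> z = Y i then 1 else 0) (LV (Y k))"
    by (rule deg_in_mono[OF deg_in_single]) auto
  have "deg_in z (0 + (if z = Y i then 1 else 0)) (0 + (if z = Y i then 1 else 0)) (LC c * LV (Y i))"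
    by (intro deg_in_mult deg_in_LC deg_in_single)
  then show "deg_in z 0 (if z = Y k \<or> z = Y i then 1 else 0) (LC c * LV (Y i))"
    by (rule deg_in_mono) auto
qed

lemma deg_in_vandermonde_poly: "deg_in (Y m) 0 (int m) (vandermonde_poly (Suc m))"
proof -
  have "deg_in (Y m) (\<Sum>j<Suc m. \<Sum>i<j. 0) (\<Sum>j<Suc m. \<Sum>i<j. if j = m then 1 else 0) (vandermonde_poly (Suc m))"
    unfolding vandermonde_poly_def
  proof (intro deg_in_prod)
    fix j i assume "j \<in> {..<Suc m}" "i \<in> {..<j}"
    then show "deg_in (Y m) 0 (if j = m then 1 else 0) (LV (Y j) - LV (Y i))"
      using deg_in_linear_form[of "Y m" j i 1] by (auto simp: deg_in_def split: if_splits)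
  qed
  moreover have "(\<Sum>j<Suc m. \<Sum>i<j. if j = m then 1 else 0 :: int) = int m"
    by simp
  ultimately show ?thesis by (simp only:) simp
qed

text \<open>As \<open>y m\<close> tends to infinity, \<open>vandermonde (Suc m)\<close> grows like
  the \<open>m\<close>-th power of \<open>y m\<close> times \<open>vandermonde m\<close>; this is
  the shift of the exponent by \<open>m\<close>.\<close>

lemma vcoeff_vandermonde_poly_mult:
  assumes "deg_in (Y m) a b s"
  shows "vcoeff (Y m) (b + int m) (vandermonde_poly (Suc m) * s) = vandermonde_poly m * vcoeff (Y m) b s"
proof (rule leval_eqI)
  fix x y :: point assume nz: "nz x" "nz y"
  let ?p = "case_var x y"
  have "deg_in (Y m) (0 + a) (int m + b) (vandermonde_poly (Suc m) * s)"
    by (intro deg_in_mult deg_in_vandermonde_poly assms)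
  then have 1: "((\<lambda>T. ev (?p(Y m := T)) (vandermonde_poly (Suc m) * s) * T powi (- (int m + b))) \<longlongrightarrow>
    ev ?p (vcoeff (Y m) (int m + b) (vandermonde_poly (Suc m) * s))) at_infinity"
    by (intro vcoeff_limit) (use nz in auto)
  have "((\<lambda>T. vandermonde m y * ((\<Prod>i<m. T - y i) * T powi (- int (card {..<m}))) * (ev (?p(Y m := T)) s * T powi (- b)))
    \<longlongrightarrow> vandermonde m y * 1 * ev ?p (vcoeff (Y m) b s)) at_infinity"
    by (intro tendsto_mult tendsto_const linear_forms_limit vcoeff_limit[OF _ assms]) (use nz in auto)
  moreover have "eventually (\<lambda>T. vandermonde m y * ((\<Prod>i<m. T - y i) * T powi (- int (card {..<m}))) * (ev (?p(Y m := T)) s * T powi (- b))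
    = ev (?p(Y m := T)) (vandermonde_poly (Suc m) * s) * T powi (- (int m + b))) at_infinity"
    using eventually_nonzero_at_infinity
  proof eventually_elim
    case (elim T)
    have "ev (?p(Y m := T)) (vandermonde_poly (Suc m)) = vandermonde (Suc m) (y(m := T))"
      using leval_vandermonde_poly[of x "y(m := T)" "Suc m"] nz elim by (simp add: laurent_eval_ev case_var_upd)
    also have "\<dots> = vandermonde m y * (\<Prod>i<m. T - y i)"
      using vandermonde_cong[of m "y(m := T)" y] by (simp add: vandermonde_Suc)
    finally show ?case using nz elim
      by (simp add: power_int_diff power_int_minus field_simps)
  qed
  ultimately have "((\<lambda>T. ev (?p(Y m := T)) (vandermonde_poly (Suc m) * s) * T powi (- (int m + b)))
    \<longlongrightarrow> vandermonde m y * ev ?p (vcoeff (Y m) b s)) at_infinity"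
    by (simp add: tendsto_cong)
  from tendsto_unique[OF at_infinity_neq_bot 1 this]
  show "leval x y (vcoeff (Y m) (b + int m) (vandermonde_poly (Suc m) * s)) = leval x y (vandermonde_poly m * vcoeff (Y m) b s)"
    using nz by (simp add: laurent_eval_ev[symmetric] add.commute[of b])
qed

text \<open>Swapping two variables of equal exponent fixes the monomial but negates its
  coefficient.\<close>

lemma skew_keys_distinct:
  assumes "skew A B f" "\<mu> \<in> keys f" "i \<in> B" "j \<in> B" "i \<noteq> j"
  shows "lookup \<mu> (Y i) \<noteq> lookup \<mu> (Y j)"
proof
  assume eq: "lookup \<mu> (Y i) = lookup \<mu> (Y j)"
  let ?h = "rename_var id (transpose i j)"
  have hh: "?h (?h q) = q" for q by (cases q) auto
  have inj: "inj ?h" by (simp add: inj_rename_var)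
  have "laurent_rename id (transpose i j) f = - f"
  proof (rule leval_eqI)
    fix x y :: point assume "nz x" "nz y"
    then show "leval x y (laurent_rename id (transpose i j) f) = leval x y (- f)"
      using skewY[OF assms(1) permutes_swap_id[OF assms(3,4)], of x y] assms(5)
      by (simp add: sign_swap_id)
  qed
  moreover have "pushforward ?h \<mu> = \<mu>"
  proof (rule poly_mapping_eqI)
    fix q
    have "lookup (pushforward ?h \<mu>) (?h (?h q)) = lookup \<mu> (?h q)"
      by (rule lookup_pushforward[OF inj])
    also have "\<dots> = lookup \<mu> q"
      using eq by (cases q) (auto simp: transpose_def)
    finally show "lookup (pushforward ?h \<mu>) q = lookup \<mu> q" by (simp add: hh)
  qed
  ultimately have "- lookup f \<mu> = lookup f \<mu>"
    using lookup_rename[of id "transpose i j" f \<mu>] by simp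
  then show False using assms(2) by (simp add: in_keys_iff)
qed

text \<open>The \<open>k\<close> exponents of a monomial in skew variables are pairwise distinct, so
  they need an interval with at least \<open>k\<close> integers. This is where the induction on the
  degree ends.\<close>

lemma skew_narrow_eq_0:
  assumes "skew A {..<k} f" "\<And>i. i < k \<Longrightarrow> deg_in (Y i) a b f" "0 < k" "b - a + 1 < int k"
  shows "f = 0"
proof (rule ccontr)
  assume "f \<noteq> 0"
  then obtain \<mu> where \<mu>: "\<mu> \<in> keys f" by fastforce
  let ?e = "\<lambda>i. lookup \<mu> (Y i)"
  have "inj_on ?e {..<k}" using skew_keys_distinct[OF assms(1) \<mu>] by (auto simp: inj_on_def)
  moreover have "?e ` {..<k} \<subseteq> {a..b}" using assms(2) \<mu> by (auto simp: deg_in_def)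
  ultimately have "k \<le> card {a..b}" by (metis card_image card_lessThan card_mono finite_atLeastAtMost_int)
  then show False using assms(3,4) by simp
qed

lemma prod_transpose:
  fixes k l :: nat
  assumes "l \<le> k"
  shows "(\<Prod>i<k. h (transpose k l i)) = (\<Prod>i\<in>{..k} - {l}. h i)"
proof (rule prod.reindex_bij_betw)
  have "bij_betw (transpose k l) {..k} {..k}"
    by (rule permutes_imp_bij[OF permutes_swap_id]) (use assms in simp_all)
  then have "bij_betw (transpose k l) ({..k} - {k}) ({..k} - {transpose k l k})"
    by (rule bij_betw_DiffI) (use assms in auto)
  moreover have "{..k} - {k} = {..<k}" by auto
  ultimately show "bij_betw (transpose k l) {..<k} ({..k} - {l})" by simp
qed

lemma deg_in_LC_mult: "deg_in z a b f \<Longrightarrow> deg_in z a b (LC c * f)"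
  using deg_in_mult[OF deg_in_LC[of z c], of a b f] by simp

section \<open>Symmetric functions vanishing on wheels\<close>

locale wheel =
  fixes t :: nat and v :: complex
  assumes t_pos: "t \<ge> 1" and prim: "primitive_root_of_unity (2 * t) v"
begin

definition u :: complex where "u = - inverse v"

definition w :: complex where "w = v ^ 2"

lemma v_nz [simp]: "v \<noteq> 0"
  using prim unfolding primitive_root_of_unity_def by (metis power_0_left zero_neq_one less_numeral_extra(3))

lemma u_nz [simp]: "u \<noteq> 0"
  by (simp add: u_def)

lemma w_nz [simp]: "w \<noteq> 0"
  by (simp add: w_def)

lemma uuw: "u * u * w = 1"
  by (simp add: u_def w_def power2_eq_square field_simps)

lemma w_pow_t: "w ^ t = 1"
  using prim by (simp add: w_def primitive_root_of_unity_def flip: power_mult)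

lemma w_pow_neq_1: "0 < j \<Longrightarrow> j < t \<Longrightarrow> w ^ j \<noteq> 1"
  using prim by (simp add: w_def primitive_root_of_unity_def flip: power_mult)

lemma w_pow_inj: "inj_on (\<lambda>i. w ^ i) {..<t}"
proof (rule linorder_inj_onI)
  fix i j assume "i < j" "i \<in> {..<t}" "j \<in> {..<t}"
  then have "w ^ (j - i) \<noteq> 1" by (intro w_pow_neq_1) auto
  moreover have "w ^ j = w ^ i * w ^ (j - i)" using \<open>i < j\<close> by (simp flip: power_add)
  ultimately show "w ^ i \<noteq> w ^ j" by auto
qed auto

definition qint :: "nat \<Rightarrow> complex" where "qint j = (\<Sum>i<j. w ^ i)"

lemma qint_neq_0: "0 < j \<Longrightarrow> j < t \<Longrightarrow> qint j \<noteq> 0"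
proof
  assume "0 < j" "j < t" "qint j = 0"
  then have "w ^ j - 1 = 0" using power_diff_1_eq[of w j] by (simp add: qint_def)
  then show False using w_pow_neq_1[OF \<open>0 < j\<close> \<open>j < t\<close>] by simp
qed

lemma qint_Suc: "qint (Suc j) = 1 + w * qint j"
  unfolding qint_def by (subst sum.lessThan_Suc_shift) (simp add: sum_distrib_left)

text \<open>The chain condition on the matched variables \<open>z\<close>, stored as
  \<open>Y 0, ..., Y (k - 1)\<close>. The chain closes up cyclically because
  \<open>w ^ t = 1\<close>. For \<open>t = 1\<close> a chain is a single variable, so for positive
  \<open>k\<close> the condition forces \<open>f = 0\<close>.\<close>

definition zwheel :: "nat \<Rightarrow> laurent \<Rightarrow> bool" where
  "zwheel k f \<longleftrightarrow> (\<forall>\<alpha> x y. nz x \<longrightarrow> nz y \<longrightarrow> inj_on \<alpha> {..<t} \<longrightarrow> \<alpha> ` {..<t} \<subseteq> {..<k} \<longrightarrow>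
     (\<forall>i. Suc i < t \<longrightarrow> y (\<alpha> (Suc i)) = w * y (\<alpha> i)) \<longrightarrow> leval x y f = 0)"

lemma zwheelD:
  "zwheel k f \<Longrightarrow> nz x \<Longrightarrow> nz y \<Longrightarrow> inj_on \<alpha> {..<t} \<Longrightarrow> \<alpha> ` {..<t} \<subseteq> {..<k} \<Longrightarrow>
     (\<And>i. Suc i < t \<Longrightarrow> y (\<alpha> (Suc i)) = w * y (\<alpha> i)) \<Longrightarrow> leval x y f = 0"
  unfolding zwheel_def by blast

lemma zwheel_0 [simp]: "zwheel k 0"
  by (simp add: zwheel_def)

lemma zwheel_diff: "zwheel k f \<Longrightarrow> zwheel k g \<Longrightarrow> zwheel k (f - g)"
  by (simp add: zwheel_def)

lemma zwheel_LC_mult: "zwheel k f \<Longrightarrow> zwheel k (LC c * f)"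
  by (simp add: zwheel_def)

lemma wheel_values: "(\<And>i. Suc i < t \<Longrightarrow> y (\<alpha> (Suc i)) = w * y (\<alpha> i)) \<Longrightarrow> i < t \<Longrightarrow> y (\<alpha> i) = w ^ i * y (\<alpha> 0)"
  by (induction i) auto

text \<open>Up to Vandermonde factors, \<open>zshuffle a k\<close> is the shuffle product with the one-variable function
  \<open>z\<^sup>a\<close> for the kernel \<open>(z - w z') / (z - z')\<close>.\<close>

definition zshuffle :: "int \<Rightarrow> nat \<Rightarrow> laurent \<Rightarrow> laurent" where
  "zshuffle a k f = (\<Sum>l\<le>k. of_int (sign (transpose k l)) * laurent_rename id (transpose k l)
     (single (single (Y k) a) 1 * (\<Prod>i<k. LV (Y k) - LC w * LV (Y i)) * f))"

lemma leval_zshuffle: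
  assumes "nz x" "nz y"
  shows "leval x y (zshuffle a k f) = (\<Sum>l\<le>k. of_int (sign (transpose k l)) *
    (y l powi a * (\<Prod>i\<in>{..k} - {l}. y l - w * y i) * leval x (y \<circ> transpose k l) f))"
  using assms by (simp add: zshuffle_def prod_transpose[of _ k "\<lambda>i. y _ - w * y i"])

lemma laurent_in_zshuffle:
  assumes "laurent_in r k f" shows "laurent_in r (Suc k) (zshuffle a k f)"
  unfolding zshuffle_def
proof (intro laurent_in_sum laurent_in_mult)
  fix l assume "l \<in> {..k}"
  have "laurent_in r (Suc k) f" by (rule laurent_in_mono[OF assms]) auto
  then have "laurent_in r (Suc k) (single (single (Y k) a) 1 * (\<Prod>i<k. LV (Y k) - LC w * LV (Y i)) * f)"
    by (intro laurent_in_mult laurent_in_prod laurent_in_diff) auto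
  then show "laurent_in r (Suc k) (laurent_rename id (transpose k l) (single (single (Y k) a) 1 * (\<Prod>i<k. LV (Y k) - LC w * LV (Y i)) * f))"
    by (rule laurent_in_rename) (use \<open>l \<in> {..k}\<close> in \<open>auto simp: vars_def transpose_def\<close>)
  show "laurent_in r (Suc k) (of_int (sign (transpose k l)))"
    by (metis laurent_in_const leval_eqI leval_of_int leval_simps(7))
qed

lemma skew_zshuffle:
  assumes f: "skew A {..<k} f"
  shows "skew A {..<Suc k} (zshuffle a k f)"
proof (rule skewI)
  fix \<sigma> and x y :: point
  assume "\<sigma> permutes A" "nz x" "nz y"
  then show "leval (x \<circ> \<sigma>) y (zshuffle a k f) = of_int (sign \<sigma>) * leval x y (zshuffle a k f)"
    by (simp add: leval_zshuffle skewX[OF f] sum_distrib_left mult_ac)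
next
  fix \<rho> and x y :: point
  assume \<rho>: "\<rho> permutes {..<Suc k}" and nz: "nz x" "nz y"
  define \<Phi> where "\<Phi> = (\<lambda>y. y k powi a * (\<Prod>i<k. y k - w * y i) * leval x y f)"
  have \<Phi>: "\<Phi> (y \<circ> \<tau>) = of_int (sign \<tau>) * \<Phi> y" if \<tau>: "\<tau> permutes {..<k}" and "nz y" for \<tau> y
  proof -
    have "\<tau> k = k" using \<tau> by (simp add: permutes_def)
    moreover have "(\<Prod>i<k. y k - w * y (\<tau> i)) = (\<Prod>i<k. y k - w * y i)"
      using prod.permute[OF \<tau>, of "\<lambda>i. y k - w * y i"] by (simp add: comp_def)
    ultimately show ?thesis using skewY[OF f \<tau> nz(1) \<open>nz y\<close>] by (simp add: \<Phi>_def)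
  qed
  have eq: "leval x y (zshuffle a k f) = (\<Sum>b\<le>k. of_int (sign (transpose k b)) * \<Phi> (y \<circ> transpose k b))" if "nz y" for y
    using that nz(1) by (simp add: zshuffle_def \<Phi>_def)
  show "leval x (y \<circ> \<rho>) (zshuffle a k f) = of_int (sign \<rho>) * leval x y (zshuffle a k f)"
    using antisym_skew[of k \<Phi> y \<rho>, OF \<Phi> nz(2) \<rho>] nz(2) by (simp add: eq)
qed

text \<open>In the summand for \<open>l\<close>, if \<open>y l\<close> lies on the chain, the kernel
  factor of its cyclic predecessor vanishes; the predecessor is another variable because
  \<open>t \<ge> 2\<close>. If \<open>y l\<close> is not on the chain, the whole chain consists of
  arguments of \<open>f\<close>.\<close>

lemma zwheel_zshuffle:
  assumes f: "zwheel k f" and t: "t \<ge> 2"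
  shows "zwheel (Suc k) (zshuffle a k f)"
  unfolding zwheel_def
proof (intro allI impI)
  fix \<alpha> and x y :: point
  assume nz: "nz x" "nz y" and \<alpha>: "inj_on \<alpha> {..<t}" "\<alpha> ` {..<t} \<subseteq> {..<Suc k}"
    and wh: "\<forall>i. Suc i < t \<longrightarrow> y (\<alpha> (Suc i)) = w * y (\<alpha> i)"
  have "(\<Prod>i\<in>{..k} - {l}. y l - w * y i) * leval x (y \<circ> transpose k l) f = 0" if l: "l \<le> k" for l
  proof (cases "l \<in> \<alpha> ` {..<t}")
    case True
    then obtain j where j: "j < t" "l = \<alpha> j" by auto
    obtain j' where j': "j' < t" "j' \<noteq> j" "y (\<alpha> j) = w * y (\<alpha> j')"
    proof (cases j)
      \<comment> \<open>The predecessor of the first variable of the chain is the last one, by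
        \<open>w ^ t = 1\<close>.\<close>
      case 0
      have "y (\<alpha> (t - 1)) = w ^ (t - 1) * y (\<alpha> 0)"
        by (rule wheel_values) (use wh t in auto)
      then have "w * y (\<alpha> (t - 1)) = w ^ t * y (\<alpha> 0)"
        using t by (simp flip: mult.assoc power_Suc)
      then show ?thesis using that[of "t - 1"] t 0 w_pow_t by simp
    next
      case (Suc i)
      then show ?thesis using that[of i] wh j by simp
    qed
    have "\<alpha> j' \<in> {..k} - {l}"
      using j j' \<alpha> by (auto simp: inj_on_def less_Suc_eq_le image_subset_iff)
    then have "(\<Prod>i\<in>{..k} - {l}. y l - w * y i) = 0"
      using j j'(3) by (intro prod_zero bexI[of _ "\<alpha> j'"]) auto
    then show ?thesis by simp
  next
    case False
    have "leval x (y \<circ> transpose k l) f = 0"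
    proof (rule zwheelD[OF f])
      show "inj_on (transpose k l \<circ> \<alpha>) {..<t}"
        using \<alpha>(1) by (simp add: comp_inj_on inj_on_subset)
      show "(transpose k l \<circ> \<alpha>) ` {..<t} \<subseteq> {..<k}"
        using \<alpha>(2) False l by (auto simp: transpose_def image_subset_iff less_Suc_eq)
    qed (use nz wh in auto)
    then show ?thesis by simp
  qed
  then show "leval x y (zshuffle a k f) = 0"
    using nz by (auto simp: leval_zshuffle mult.assoc intro!: sum.neutral simp del: mult_eq_0_iff)
qed

text \<open>The kernel adds degree \<open>k\<close> to the exponent \<open>b\<close> of the new
  variable and degree at most 1 to each variable of \<open>f\<close>. Both reach at most
  \<open>b + int k\<close>, which is the bound of the same family for \<open>Suc k\<close>
  variables.\<close>

lemma deg_in_zshuffle: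
  assumes f: "laurent_in r k f" "\<And>i. i < k \<Longrightarrow> deg_in (Y i) a (b + int k - 1) f" and "a \<le> b" "i \<le> k"
  shows "deg_in (Y i) a (b + int k) (zshuffle b k f)"
  unfolding zshuffle_def
proof (intro deg_in_sum)
  fix l assume l: "l \<in> {..k}"
  let ?P = "single (single (Y k) b) 1 * (\<Prod>i<k. LV (Y k) - LC w * LV (Y i)) * f"
  have P: "deg_in (Y j) a (b + int k) ?P" if "j \<le> k" for j
  proof (cases "j = k")
    case True
    have "deg_in (Y k) (b + (\<Sum>i<k. 0) + 0) (b + (\<Sum>i<k. 1) + 0) ?P"
    proof (intro deg_in_mult deg_in_prod)
      show "deg_in (Y k) b b (single (single (Y k) b) 1)"
        using deg_in_single[of "Y k" "Y k" b 1] by simp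
      show "deg_in (Y k) 0 1 (LV (Y k) - LC w * LV (Y i))" for i
        using deg_in_linear_form[of "Y k" k i w] by simp
      show "deg_in (Y k) 0 0 f" by (rule deg_in_outside[OF f(1)]) simp
    qed
    then show ?thesis using True \<open>a \<le> b\<close> by (auto intro: deg_in_mono)
  next
    case False
    then have j: "j < k" using that by simp
    have "deg_in (Y j) (0 + (\<Sum>i<k. 0) + a) (0 + (\<Sum>i<k. if i = j then 1 else 0) + (b + int k - 1)) ?P"
    proof (intro deg_in_mult deg_in_prod f(2) j)
      show "deg_in (Y j) 0 0 (single (single (Y k) b) 1)"
        using deg_in_single[of "Y j" "Y k" b 1] False by simp
      show "deg_in (Y j) 0 (if i = j then 1 else 0) (LV (Y k) - LC w * LV (Y i))" if "i \<in> {..<k}" for i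
        using deg_in_linear_form[of "Y j" k i w] False by (auto split: if_splits)
    qed
    then show ?thesis using j by simp
  qed
  have "transpose k l i \<le> k" using l assms(4) by (auto simp: transpose_def)
  from deg_in_rename[OF _ _ P[OF this], of id "transpose k l"]
  have "deg_in (Y i) a (b + int k) (laurent_rename id (transpose k l) ?P)" by simp
  from deg_in_mult[OF deg_in_of_int this]
  show "deg_in (Y i) a (b + int k) (of_int (sign (transpose k l)) * laurent_rename id (transpose k l) ?P)"
    by simp
qed

lemma zshuffle_add: "zshuffle a k (f + g) = zshuffle a k f + zshuffle a k g"
  by (rule leval_eqI) (simp add: leval_zshuffle algebra_simps sum.distrib)

lemma zshuffle_LC_mult: "zshuffle a k (LC c * f) = LC c * zshuffle a k f"
  by (rule leval_eqI) (simp add: leval_zshuffle sum_distrib_left mult_ac)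

lemma zshuffle_0 [simp]: "zshuffle a k 0 = 0"
  by (rule leval_eqI) (simp add: leval_zshuffle)

lemma prod_upd_limit:
  fixes y :: point
  assumes "l < k"
  shows "((\<lambda>T. (\<Prod>i\<in>{..k} - {l}. y l - w * (y(k := T)) i) * T powi (-1)) \<longlongrightarrow>
    - w * (\<Prod>i\<in>{..<k} - {l}. y l - w * y i)) at_infinity"
proof -
  have "((\<lambda>T. - w * ((T - y l / w) * T powi (-1)) * (\<Prod>i\<in>{..<k} - {l}. y l - w * y i)) \<longlongrightarrow>
    - w * 1 * (\<Prod>i\<in>{..<k} - {l}. y l - w * y i)) at_infinity"
    by (intro tendsto_mult tendsto_const linear_form_limit)
  moreover have "(\<Prod>i\<in>{..k} - {l}. y l - w * (y(k := T)) i) * T powi (-1) =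
    - w * ((T - y l / w) * T powi (-1)) * (\<Prod>i\<in>{..<k} - {l}. y l - w * y i)" for T
  proof -
    have e: "y l - w * T = - w * (T - y l / w)" by (simp add: field_simps)
    have "{..k} - {l} = insert k ({..<k} - {l})" using assms by auto
    then have "(\<Prod>i\<in>{..k} - {l}. y l - w * (y(k := T)) i) = (y l - w * T) * (\<Prod>i\<in>{..<k} - {l}. y l - w * (y(k := T)) i)"
      by simp
    also have "(\<Prod>i\<in>{..<k} - {l}. y l - w * (y(k := T)) i) = (\<Prod>i\<in>{..<k} - {l}. y l - w * y i)"
      by (rule prod.cong) auto
    finally show ?thesis
      using e by (simp only: mult_ac)
  qed
  ultimately show ?thesis by simp
qed

text \<open>As the last variable tends to infinity, the summand \<open>l = k\<close> of \<open>zshuffle b k f\<close> contributes \<open>f\<close>;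
  in the summands with \<open>l < k\<close> it is the \<open>l\<close>-th argument of \<open>f\<close> that tends to infinity.\<close>

lemma leval_vcoeff_zshuffle:
  assumes f: "laurent_in r k f" "\<And>i. i < k \<Longrightarrow> deg_in (Y i) a (b + int k - 1) f" and "a \<le> b"
    and nz: "nz x" "nz y"
  shows "leval x y (vcoeff (Y k) (b + int k) (zshuffle b k f)) = leval x y f +
    (\<Sum>l<k. w * y l powi b * (\<Prod>i\<in>{..<k} - {l}. y l - w * y i) * leval x y (vcoeff (Y l) (b + int k - 1) f))"
proof -
  let ?p = "case_var x y"
  define G where "G = (\<lambda>l T. of_int (sign (transpose k l)) * ((y(k := T)) l powi b *
     (\<Prod>i\<in>{..k} - {l}. (y(k := T)) l - w * (y(k := T)) i) * leval x (y(k := T) \<circ> transpose k l) f)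
     * T powi (- (b + int k)))"
  have lim_k: "(G k \<longlongrightarrow> leval x y f) at_infinity"
  proof -
    have "((\<lambda>T. ((\<Prod>i\<in>{..<k}. T - w * y i) * T powi (- int (card {..<k}))) * leval x y f) \<longlongrightarrow> 1 * leval x y f) at_infinity"
      by (intro tendsto_mult tendsto_const linear_forms_limit) auto
    moreover have "eventually (\<lambda>T. ((\<Prod>i\<in>{..<k}. T - w * y i) * T powi (- int (card {..<k}))) * leval x y f = G k T) at_infinity"
      using eventually_nonzero_at_infinity
    proof eventually_elim
      case (elim T)
      have 1: "leval x (y(k := T)) f = leval x y f" by (rule leval_cong[OF f(1)]) auto
      have 2: "{..k} - {k} = {..<k}" by auto
      show ?case using elim
        by (simp add: G_def 1 2 power_int_add power_int_minus power_int_diff field_simps)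
    qed
    ultimately show ?thesis by (simp add: tendsto_cong)
  qed
  have lim_l: "(G l \<longlongrightarrow> w * y l powi b * (\<Prod>i\<in>{..<k} - {l}. y l - w * y i) * leval x y (vcoeff (Y l) (b + int k - 1) f)) at_infinity"
    if l: "l < k" for l
  proof -
    have "((\<lambda>T. - (y l powi b) * ((\<Prod>i\<in>{..k} - {l}. y l - w * (y(k := T)) i) * T powi (-1)) *
        (ev (?p(Y l := T)) f * T powi (- (b + int k - 1)))) \<longlongrightarrow>
      - (y l powi b) * (- w * (\<Prod>i\<in>{..<k} - {l}. y l - w * y i)) * ev ?p (vcoeff (Y l) (b + int k - 1) f)) at_infinity"
      by (rule tendsto_mult[OF tendsto_mult[OF tendsto_const prod_upd_limit[OF l]] vcoeff_limit[OF _ f(2)[OF l]]])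
         (use nz in auto)
    moreover have "eventually (\<lambda>T. - (y l powi b) * ((\<Prod>i\<in>{..k} - {l}. y l - w * (y(k := T)) i) * T powi (-1)) *
        (ev (?p(Y l := T)) f * T powi (- (b + int k - 1))) = G l T) at_infinity"
      using eventually_nonzero_at_infinity
    proof eventually_elim
      case (elim T)
      have 1: "leval x (y(k := T) \<circ> transpose k l) f = ev (?p(Y l := T)) f"
        unfolding case_var_upd[symmetric] laurent_eval_ev[symmetric]
        by (rule leval_cong[OF f(1)]) (use l in \<open>auto simp: transpose_def\<close>)
      have 2: "T powi (- (b + int k)) = T powi (-1) * T powi (- (b + int k - 1))"
        using elim power_int_add[of T "-1" "- (b + int k - 1)"] by simp
      show ?case using l unfolding G_def 1 2 by (simp add: sign_swap_id del: prod.insert)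
    qed
    ultimately show ?thesis by (simp add: tendsto_cong laurent_eval_ev mult_ac)
  qed
  have 1: "((\<lambda>T. \<Sum>l\<le>k. G l T) \<longlongrightarrow> leval x y f + (\<Sum>l<k. w * y l powi b * (\<Prod>i\<in>{..<k} - {l}. y l - w * y i) * leval x y (vcoeff (Y l) (b + int k - 1) f))) at_infinity"
  proof -
    have "(\<lambda>T. \<Sum>l\<le>k. G l T) = (\<lambda>T. G k T + (\<Sum>l<k. G l T))"
      by (simp add: lessThan_Suc_atMost[symmetric] add.commute)
    then show ?thesis by (simp only:) (intro tendsto_add tendsto_sum lim_k lim_l, auto)
  qed
  have "((\<lambda>T. ev (?p(Y k := T)) (zshuffle b k f) * T powi (- (b + int k))) \<longlongrightarrow> ev ?p (vcoeff (Y k) (b + int k) (zshuffle b k f))) at_infinity"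
    by (rule vcoeff_limit[OF _ deg_in_zshuffle[OF f(1,2) \<open>a \<le> b\<close>]]) (use nz in auto)
  moreover have "eventually (\<lambda>T. ev (?p(Y k := T)) (zshuffle b k f) * T powi (- (b + int k)) = (\<Sum>l\<le>k. G l T)) at_infinity"
    using eventually_nonzero_at_infinity
  proof eventually_elim
    case (elim T)
    have "ev (?p(Y k := T)) (zshuffle b k f) = leval x (y(k := T)) (zshuffle b k f)"
      by (simp add: laurent_eval_ev case_var_upd)
    then show ?case using nz elim
      by (simp only: leval_zshuffle nz_upd G_def sum_distrib_right mult.assoc not_False_eq_True)
  qed
  ultimately have "((\<lambda>T. \<Sum>l\<le>k. G l T) \<longlongrightarrow> leval x y (vcoeff (Y k) (b + int k) (zshuffle b k f))) at_infinity"
    by (simp add: tendsto_cong laurent_eval_ev)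
  from tendsto_unique[OF at_infinity_neq_bot this 1] show ?thesis .
qed

text \<open>The upper bound grows with \<open>k\<close> because a skew function contains the
  Vandermonde product, of degree \<open>k - 1\<close> in each variable. On the symmetric quotient
  the bound is \<open>b\<close> for every \<open>k\<close>, so that shuffling with exponent
  \<open>b\<close> stays in the class when \<open>a \<le> b\<close> and
  \<open>t \<ge> 2\<close>.\<close>

definition box_wheel :: "nat \<Rightarrow> int \<Rightarrow> int \<Rightarrow> nat \<Rightarrow> laurent \<Rightarrow> bool" where
  "box_wheel r a b k f \<longleftrightarrow> laurent_in r k f \<and> skew {..<r} {..<k} f \<and> zwheel k f \<and>
     (\<forall>i<k. deg_in (Y i) a (b + int k - 1) f)"

lemma box_wheelD:
  assumes "box_wheel r a b k f"
  shows "laurent_in r k f" "skew {..<r} {..<k} f" "zwheel k f" "i < k \<Longrightarrow> deg_in (Y i) a (b + int k - 1) f"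
  using assms by (auto simp: box_wheel_def)

lemma box_wheel_0 [simp]: "box_wheel r a b k 0"
  by (simp add: box_wheel_def)

lemma box_wheel_diff: "box_wheel r a b k f \<Longrightarrow> box_wheel r a b k g \<Longrightarrow> box_wheel r a b k (f - g)"
  by (auto simp: box_wheel_def skew_diff zwheel_diff)

lemma box_wheel_LC_mult: "box_wheel r a b k f \<Longrightarrow> box_wheel r a b k (LC c * f)"
  by (auto simp: box_wheel_def skew_LC_mult zwheel_LC_mult deg_in_LC_mult)

lemma box_wheel_zshuffle: "box_wheel r a b k f \<Longrightarrow> a \<le> b \<Longrightarrow> t \<ge> 2 \<Longrightarrow> box_wheel r a b (Suc k) (zshuffle b k f)"
  using deg_in_zshuffle[of r k f a b]
  by (auto simp: box_wheel_def laurent_in_zshuffle skew_zshuffle zwheel_zshuffle)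

lemma zwheel_vcoeff:
  assumes f: "zwheel k' f" and "k \<le> k'" "k \<le> j"
  shows "zwheel k (vcoeff (Y j) d f)"
  unfolding zwheel_def
proof (intro allI impI)
  fix \<alpha> and x y :: point
  assume nz: "nz x" "nz y" and \<alpha>: "inj_on \<alpha> {..<t}" "\<alpha> ` {..<t} \<subseteq> {..<k}"
    and wh: "\<forall>i. Suc i < t \<longrightarrow> y (\<alpha> (Suc i)) = w * y (\<alpha> i)"
  have "ev (case_var x y) (vcoeff (Y j) d f) = 0 * ev (case_var x y) (vcoeff (Y j) d f)"
  proof (rule ev_vcoeff_transfer)
    fix T :: complex assume "T \<noteq> 0"
    have "\<alpha> i \<noteq> j" if "i < t" for i using \<alpha>(2) that assms(3) by (force simp: image_subset_iff)
    then have "leval x (y(j := T)) f = 0"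
      using nz \<open>T \<noteq> 0\<close> \<alpha> wh assms(2) by (intro zwheelD[OF f, where \<alpha> = \<alpha>]) auto
    then show "ev ((case_var x y)(Y j := T)) f = 0 * ev ((case_var x y)(Y j := T)) f"
      by (simp add: laurent_eval_ev case_var_upd)
  qed (use nz in auto)
  then show "leval x y (vcoeff (Y j) d f) = 0" by (simp add: laurent_eval_ev)
qed

text \<open>By skewness no other variable can have the extracted exponent \<open>b + int k\<close>,
  so the bound for the remaining \<open>k\<close> variables drops by one, as
  \<open>box_wheel\<close> demands.\<close>

lemma box_wheel_vcoeff:
  assumes f: "box_wheel r a b (Suc k) f"
  shows "box_wheel r a b k (vcoeff (Y k) (b + int k) f)"
  unfolding box_wheel_def
proof (intro conjI allI impI)
  show "laurent_in r k (vcoeff (Y k) (b + int k) f)"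
    by (rule laurent_in_vcoeff_Y[OF box_wheelD(1)[OF f]])
  show "skew {..<r} {..<k} (vcoeff (Y k) (b + int k) f)"
    by (rule skew_vcoeff_Y[OF box_wheelD(2)[OF f]]) auto
  show "zwheel k (vcoeff (Y k) (b + int k) f)"
    by (rule zwheel_vcoeff[OF box_wheelD(3)[OF f]]) auto
  fix i assume i: "i < k"
  show "deg_in (Y i) a (b + int k - 1) (vcoeff (Y k) (b + int k) f)"
    unfolding deg_in_def
  proof
    fix \<nu> assume "\<nu> \<in> keys (vcoeff (Y k) (b + int k) f)"
    then have \<mu>: "\<nu> + single (Y k) (b + int k) \<in> keys f" "lookup \<nu> (Y k) = 0"
      by (simp_all add: keys_vcoeff)
    have "lookup \<nu> (Y i) \<noteq> b + int k"
      using skew_keys_distinct[OF box_wheelD(2)[OF f] \<mu>(1), of i k] \<mu>(2) i by (simp add: lookup_add lookup_single)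
    moreover have "a \<le> lookup \<nu> (Y i)" "lookup \<nu> (Y i) \<le> b + int k"
      using box_wheelD(4)[OF f, of i] \<mu>(1) i unfolding deg_in_def by (force simp: lookup_add lookup_single)+
    ultimately show "a \<le> lookup \<nu> (Y i) \<and> lookup \<nu> (Y i) \<le> b + int k - 1"
      by simp
  qed
qed

lemma vcoeff_zshuffle_0:
  assumes "box_wheel r a b 0 f" "a \<le> b"
  shows "vcoeff (Y 0) b (zshuffle b 0 f) = f"
  using leval_vcoeff_zshuffle[OF box_wheelD(1,4)[OF assms(1)] assms(2)] by (intro leval_eqI) simp

text \<open>The relation \<open>D T = 1 + w T D\<close> for \<open>T = zshuffle b\<close> and
  \<open>D\<close> the leading coefficient in the last variable. Skewness expresses the leading
  coefficient in the \<open>l\<close>-th variable by the one in the last variable at transposed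
  arguments, and the terms with \<open>l \<le> k\<close> then add up to a shuffle.\<close>

lemma vcoeff_zshuffle_Suc:
  assumes f: "box_wheel r a b (Suc k) f" "a \<le> b"
  shows "vcoeff (Y (Suc k)) (b + int (Suc k)) (zshuffle b (Suc k) f) = f + LC w * zshuffle b k (vcoeff (Y k) (b + int k) f)"
proof (rule leval_eqI)
  fix x y :: point assume nz: "nz x" "nz y"
  have "leval x y (vcoeff (Y l) (b + int k) f) = of_int (sign (transpose k l)) * leval x (y \<circ> transpose k l) (vcoeff (Y k) (b + int k) f)"
    if l: "l \<le> k" for l
  proof -
    have \<tau>: "transpose k l permutes {..<Suc k}" using l by (intro permutes_swap_id) auto
    have 1: "((\<lambda>T. ev ((case_var x y)(Y l := T)) f * T powi (- (b + int (Suc k) - 1))) \<longlongrightarrow> ev (case_var x y) (vcoeff (Y l) (b + int (Suc k) - 1) f)) at_infinity"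
      by (rule vcoeff_limit[OF _ box_wheelD(4)[OF f(1)]]) (use nz l in auto)
    have 2: "((\<lambda>T. of_int (sign (transpose k l)) * (ev ((case_var x (y \<circ> transpose k l))(Y k := T)) f * T powi (- (b + int (Suc k) - 1)))) \<longlongrightarrow>
      of_int (sign (transpose k l)) * ev (case_var x (y \<circ> transpose k l)) (vcoeff (Y k) (b + int (Suc k) - 1) f)) at_infinity"
      by (intro tendsto_mult tendsto_const vcoeff_limit[OF _ box_wheelD(4)[OF f(1)]]) (use nz in auto)
    have 3: "eventually (\<lambda>T. of_int (sign (transpose k l)) * (ev ((case_var x (y \<circ> transpose k l))(Y k := T)) f * T powi (- (b + int (Suc k) - 1)))
      = ev ((case_var x y)(Y l := T)) f * T powi (- (b + int (Suc k) - 1))) at_infinity"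
      using eventually_nonzero_at_infinity
    proof eventually_elim
      case (elim T)
      have e: "(y \<circ> transpose k l)(k := T) = y(l := T) \<circ> transpose k l"
        by (auto simp: fun_eq_iff transpose_def)
      have "leval x ((y \<circ> transpose k l)(k := T)) f = of_int (sign (transpose k l)) * leval x (y(l := T)) f"
        unfolding e by (rule skewY[OF box_wheelD(2)[OF f(1)] \<tau>]) (use nz elim in auto)
      then show ?case
        by (simp add: laurent_eval_ev case_var_upd flip: mult.assoc of_int_mult)
    qed
    from tendsto_unique[OF at_infinity_neq_bot 1 Lim_transform_eventually[OF 2 3]]
    show ?thesis by (simp add: laurent_eval_ev)
  qed
  then have "(\<Sum>l\<le>k. w * y l powi b * (\<Prod>i\<in>{..k} - {l}. y l - w * y i) * leval x y (vcoeff (Y l) (b + int k) f)) =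
    w * leval x y (zshuffle b k (vcoeff (Y k) (b + int k) f))"
    using nz by (simp add: leval_zshuffle sum_distrib_left mult_ac)
  then show "leval x y (vcoeff (Y (Suc k)) (b + int (Suc k)) (zshuffle b (Suc k) f)) = leval x y (f + LC w * zshuffle b k (vcoeff (Y k) (b + int k) f))"
    using leval_vcoeff_zshuffle[OF box_wheelD(1,4)[OF f(1)] f(2) nz] nz by (simp add: lessThan_Suc_atMost)
qed

section \<open>Leading coefficients of iterated shuffles\<close>

primrec zshuffle_iter :: "int \<Rightarrow> nat \<Rightarrow> nat \<Rightarrow> laurent \<Rightarrow> laurent" where
  "zshuffle_iter b 0 k f = f"
| "zshuffle_iter b (Suc j) k f = zshuffle b (k + j) (zshuffle_iter b j k f)"

lemma zshuffle_iter_0 [simp]: "zshuffle_iter b j k 0 = 0"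
  by (induction j) simp_all

lemma box_wheel_zshuffle_iter: "box_wheel r a b k f \<Longrightarrow> a \<le> b \<Longrightarrow> t \<ge> 2 \<Longrightarrow> box_wheel r a b (k + j) (zshuffle_iter b j k f)"
  by (induction j) (simp_all add: box_wheel_zshuffle)

text \<open>Without variables there is no leading coefficient to take, so the relation starts from
  \<open>D T = 1\<close> and only the \<open>w\<close>-integer survives.\<close>

lemma vcoeff_zshuffle_iter_0:
  assumes "box_wheel r a b 0 f" "a \<le> b" "t \<ge> 2"
  shows "vcoeff (Y j) (b + int j) (zshuffle_iter b (Suc j) 0 f) = LC (qint (Suc j)) * zshuffle_iter b j 0 f"
proof (induction j)
  case 0
  then show ?case using vcoeff_zshuffle_0[OF assms(1,2)] by (simp add: qint_def)
next
  case (Suc j)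
  have "vcoeff (Y (Suc j)) (b + int (Suc j)) (zshuffle_iter b (Suc (Suc j)) 0 f) =
    zshuffle_iter b (Suc j) 0 f + LC w * zshuffle b j (LC (qint (Suc j)) * zshuffle_iter b j 0 f)"
    using vcoeff_zshuffle_Suc[OF box_wheel_zshuffle_iter[OF assms, of "Suc j", simplified], OF assms(2)] Suc by simp
  also have "\<dots> = LC (qint (Suc (Suc j))) * zshuffle_iter b (Suc j) 0 f"
    by (rule leval_eqI, simp only: zshuffle_LC_mult, simp add: qint_Suc[of "Suc j"] algebra_simps)
  finally show ?case .
qed

text \<open>Iterating \<open>D T = 1 + w T D\<close> gives
  \<open>D T^(j+1) = [j+1] T^j + w^(j+1) T^(j+1) D\<close>, with \<open>[j+1] = 1 + w [j]\<close>
  for the \<open>w\<close>-integers.\<close>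

lemma vcoeff_zshuffle_iter_Suc:
  assumes "box_wheel r a b (Suc k) f" "a \<le> b" "t \<ge> 2"
  shows "vcoeff (Y (Suc k + j)) (b + int (Suc k + j)) (zshuffle_iter b (Suc j) (Suc k) f) =
    LC (qint (Suc j)) * zshuffle_iter b j (Suc k) f + LC (w ^ Suc j) * zshuffle_iter b (Suc j) k (vcoeff (Y k) (b + int k) f)"
proof (induction j)
  case 0
  then show ?case using vcoeff_zshuffle_Suc[OF assms(1,2)] by (simp add: qint_def)
next
  case (Suc j)
  have "vcoeff (Y (Suc (Suc k + j))) (b + int (Suc (Suc k + j))) (zshuffle_iter b (Suc (Suc j)) (Suc k) f) =
    zshuffle_iter b (Suc j) (Suc k) f + LC w * zshuffle b (Suc k + j) (vcoeff (Y (Suc k + j)) (b + int (Suc k + j)) (zshuffle_iter b (Suc j) (Suc k) f))"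
    using vcoeff_zshuffle_Suc[of r a b "Suc k + j" "zshuffle_iter b (Suc j) (Suc k) f"] box_wheel_zshuffle_iter[OF assms, of "Suc j"] assms(2) by simp
  also have "\<dots> = LC (qint (Suc (Suc j))) * zshuffle_iter b (Suc j) (Suc k) f + LC (w ^ Suc (Suc j)) * zshuffle_iter b (Suc (Suc j)) k (vcoeff (Y k) (b + int k) f)"
    unfolding Suc
    by (rule leval_eqI, simp only: zshuffle_LC_mult zshuffle_add, simp add: qint_Suc[of "Suc j"] algebra_simps)
  finally show ?case by simp
qed

section \<open>Symmetric quotients by the Vandermonde product\<close>

definition symY :: "nat \<Rightarrow> laurent \<Rightarrow> bool" where
  "symY k s \<longleftrightarrow> (\<forall>\<tau> x y. \<tau> permutes {..<k} \<longrightarrow> nz x \<longrightarrow> nz y \<longrightarrow> leval x (y \<circ> \<tau>) s = leval x y s)"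

lemma lookup_pushforward_sum:
  assumes "finite K" "keys \<mu> \<subseteq> K"
  shows "lookup (pushforward h \<mu>) q = (\<Sum>k | k \<in> K \<and> h k = q. lookup \<mu> k)"
  unfolding pushforward_superset[OF assms] lookup_sum
  by (rule sum.mono_neutral_cong_right) (use assms in \<open>auto simp: lookup_single when_def\<close>)

text \<open>The locus of a chain is the image of a torus under \<open>c\<close> and
  \<open>\<omega>\<close>, and it contains a point with pairwise distinct \<open>y\<close> and no
  relation \<open>x i = u * y j\<close>. A factor \<open>P\<close> that is nonzero at such points
  can be cancelled on the whole locus.\<close>

lemma zwheel_cancel:
  assumes "\<And>\<alpha> x y. nz x \<Longrightarrow> nz y \<Longrightarrow> inj_on \<alpha> {..<t} \<Longrightarrow> \<alpha> ` {..<t} \<subseteq> {..<k} \<Longrightarrow>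
      (\<And>i. Suc i < t \<Longrightarrow> y (\<alpha> (Suc i)) = w * y (\<alpha> i)) \<Longrightarrow> leval x y P * leval x y s = 0"
    and "\<And>x y. nz x \<Longrightarrow> nz y \<Longrightarrow> inj y \<Longrightarrow> (\<And>i j. x i \<noteq> u * y j) \<Longrightarrow> leval x y P \<noteq> 0"
  shows "zwheel k s"
  unfolding zwheel_def
  proof (intro allI impI)
  fix \<alpha> and x y :: point
  assume nz: "nz x" "nz y" and \<alpha>: "inj_on \<alpha> {..<t}" "\<alpha> ` {..<t} \<subseteq> {..<k}"
    and wh: "\<forall>i. Suc i < t \<longrightarrow> y (\<alpha> (Suc i)) = w * y (\<alpha> i)"
  define e where "e = inv_into {..<t} \<alpha>"
  have e: "e (\<alpha> i) = i" if "i < t" for i using inv_into_f_f[OF \<alpha>(1)] that by (simp add: e_def)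
  define B where "B = Y ` \<alpha> ` {..<t}"
  define c where "c = (\<lambda>z. case z of X i \<Rightarrow> 1 | Y i \<Rightarrow> if i \<in> \<alpha> ` {..<t} then w ^ e i else 1)"
  define \<omega> where "\<omega> = (\<lambda>z. if z \<in> B then Y (\<alpha> 0) else z)"
  have c: "nz c" by (auto simp: c_def nz_def split: var.splits)
  have val: "w ^ e i * y (\<alpha> 0) = y i" if i: "i \<in> \<alpha> ` {..<t}" for i
  proof -
    obtain j where j: "j < t" "i = \<alpha> j" using i by auto
    have "y (\<alpha> j) = w ^ j * y (\<alpha> 0)" by (rule wheel_values) (use wh j in auto)
    then show ?thesis by (simp add: j e)
  qed
  have YB: "Y i \<in> B \<longleftrightarrow> i \<in> \<alpha> ` {..<t}" "X i \<notin> B" for i by (auto simp: B_def)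
  have pt: "(\<lambda>z. c z * case_var x y (\<omega> z)) = case_var x y"
  proof
    fix z show "c z * case_var x y (\<omega> z) = case_var x y z"
      using val by (cases z) (simp_all add: c_def \<omega>_def YB)
  qed
  have par: "(\<lambda>z. c z * p (\<omega> z)) = case_var (\<lambda>i. p (X i)) (\<lambda>i. if i \<in> \<alpha> ` {..<t} then w ^ e i * p (Y (\<alpha> 0)) else p (Y i))" for p
    by (rule ext) (simp add: c_def \<omega>_def YB split: var.splits)
  have "ev (\<lambda>z. c z * case_var x y (\<omega> z)) s = 0"
  proof (rule ev_eq_0_dense[OF c, where d = P])
    fix p :: "var \<Rightarrow> complex" assume p: "nz p"
    let ?x = "\<lambda>i. p (X i)" and ?y = "\<lambda>i. if i \<in> \<alpha> ` {..<t} then w ^ e i * p (Y (\<alpha> 0)) else p (Y i)"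
    have nz': "nz ?x" "nz ?y" using p by (auto simp: nz_def)
    have "leval ?x ?y P * leval ?x ?y s = 0"
      by (rule assms(1)[OF nz' \<alpha>]) (simp add: e)
    then show "ev (\<lambda>z. c z * p (\<omega> z)) P * ev (\<lambda>z. c z * p (\<omega> z)) s = 0"
      by (simp only: par laurent_eval_ev)
  next
    \<comment> \<open>\<open>C\<close> exceeds every \<open>norm (w ^ i)\<close> with
      \<open>i < t\<close>. With the values \<open>w ^ i\<close> on the chain, \<open>C + i\<close>
      at the other \<open>y\<close> and \<open>- u * C\<close> at every \<open>x\<close>, the
      \<open>y\<close> are distinct and no \<open>x\<close> equals \<open>u\<close> times a
      \<open>y\<close>.\<close>
    define C :: real where "C = (\<Sum>i<t. norm (w ^ i)) + 1"
    define q :: "var \<Rightarrow> complex" where "q = (\<lambda>z. case z of X i \<Rightarrow> u * of_real (- C) | Y i \<Rightarrow> if i \<in> \<alpha> ` {..<t} then 1 else of_real (C + of_nat i))"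
    have C: "norm (w ^ i) < C" if "i < t" for i
      using member_le_sum[of i "{..<t}" "\<lambda>i. norm (w ^ i)"] that by (simp add: C_def)
    have "C \<ge> 1" unfolding C_def by (simp add: sum_nonneg)
    then have C0: "of_real C + of_nat i \<noteq> (0::complex)" for i
    proof -
      have "C + real i \<noteq> 0" using \<open>C \<ge> 1\<close> by linarith
      then have "complex_of_real (C + real i) \<noteq> 0" by (simp only: of_real_eq_0_iff not_False_eq_True)
      then show ?thesis by simp
    qed
    show q: "nz q" using C0 \<open>C \<ge> 1\<close> by (auto simp: q_def nz_def split: var.splits)
    let ?y = "\<lambda>i. if i \<in> \<alpha> ` {..<t} then w ^ e i * q (Y (\<alpha> 0)) else q (Y i)"
    have \<alpha>0: "\<alpha> 0 \<in> \<alpha> ` {..<t}" using t_pos by auto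
    have "inj ?y"
    proof (rule injI)
      fix i j assume eq: "?y i = ?y j"
      have ne: "w ^ a \<noteq> of_real C + of_nat b" if "a < t" for a b
      proof
        assume "w ^ a = of_real C + of_nat b"
        then have "norm (w ^ a) = norm (complex_of_real (C + real b))" by simp
        also have "\<dots> = C + real b" using \<open>C \<ge> 1\<close> by (subst norm_of_real) simp
        finally show False using C[OF that] by simp
      qed
      show "i = j"
      proof (cases "i \<in> \<alpha> ` {..<t}"; cases "j \<in> \<alpha> ` {..<t}")
        assume ij: "i \<in> \<alpha> ` {..<t}" "j \<in> \<alpha> ` {..<t}"
        then obtain a b where "a < t" "b < t" "i = \<alpha> a" "j = \<alpha> b" by auto
        moreover from this have "w ^ a = w ^ b" using eq ij \<alpha>0 by (simp add: q_def e)
        ultimately show "i = j" using inj_onD[OF w_pow_inj, of a b] by auto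
      next
        assume ij: "i \<in> \<alpha> ` {..<t}" "j \<notin> \<alpha> ` {..<t}"
        then obtain a where "a < t" "i = \<alpha> a" by auto
        then show "i = j" using eq ij \<alpha>0 ne[of a j] by (simp add: q_def e)
      next
        assume ij: "i \<notin> \<alpha> ` {..<t}" "j \<in> \<alpha> ` {..<t}"
        then obtain a where "a < t" "j = \<alpha> a" by auto
        then show "i = j" using eq ij \<alpha>0 ne[of a i] by (simp add: q_def e)
      next
        assume "i \<notin> \<alpha> ` {..<t}" "j \<notin> \<alpha> ` {..<t}"
        then show "i = j" using eq by (simp add: q_def)
      qed
    qed
    moreover have "q (X i) \<noteq> u * ?y j" for i j
    proof (cases "j \<in> \<alpha> ` {..<t}")
      case True
      then obtain a where a: "a < t" "j = \<alpha> a" by auto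
      have "w ^ a \<noteq> - of_real C"
      proof
        assume "w ^ a = - of_real C"
        then have "norm (w ^ a) = \<bar>C\<bar>" by simp
        then show False using C[OF a(1)] by simp
      qed
      then show ?thesis using a \<alpha>0 by (simp add: q_def e) (metis mult_cancel_left mult_minus_right u_nz)
    next
      case False
      have "- C \<noteq> C + real j" using \<open>C \<ge> 1\<close> by linarith
      then have "complex_of_real (- C) \<noteq> of_real (C + real j)" by (simp only: of_real_eq_iff not_False_eq_True)
      then have "u * complex_of_real (- C) \<noteq> u * of_real (C + real j)" using u_nz by (metis mult_cancel_left)
      then show ?thesis using False by (simp add: q_def)
    qed
    moreover have "nz (\<lambda>i. q (X i))" "nz ?y" using q by (auto simp: nz_def)
    ultimately show "ev (\<lambda>z. c z * q (\<omega> z)) P \<noteq> 0"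
      unfolding par laurent_eval_ev[symmetric] by (intro assms(2)) auto
  qed (use nz in auto)
  then show "leval x y s = 0" by (simp add: pt laurent_eval_ev)
  qed

text \<open>\<open>f\<close> vanishes where two of the \<open>y\<close> coincide, so the Vandermonde
  product divides it. A generic chain has distinct variables, so the chain condition passes to the
  quotient.\<close>

lemma skew_quotient:
  assumes "laurent_in r k f" "skew {..<r} {..<k} f" "zwheel k f"
  shows "\<exists>s. laurent_in r k s \<and> f = vandermonde_poly k * s \<and> symY k s \<and> zwheel k s"
proof -
  define I where "I = (SIGMA j:{..<k}. {..<j})"
  have "\<exists>g. laurent_in r k g \<and> f = (\<Prod>i\<in>I. LV (Y (fst i)) - LC 1 * LV (Y (snd i))) * g"
  proof (rule linear_forms_quotient)
    show "inj_on (\<lambda>i. {Y (fst i), Y (snd i)}) I"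
      by (rule inj_onI) (auto simp: I_def doubleton_eq_iff)
    fix i p assume i: "i \<in> I" and p: "nz p" "p (Y (fst i)) = 1 * p (Y (snd i))"
    have "leval (\<lambda>i. p (X i)) (\<lambda>i. p (Y i)) f = 0"
      by (rule skew_coincide_Y[OF assms(2), of "fst i" "snd i"]) (use i p in \<open>auto simp: I_def nz_def\<close>)
    moreover have "case_var (\<lambda>i. p (X i)) (\<lambda>i. p (Y i)) = p"
    proof
      fix z show "case_var (\<lambda>i. p (X i)) (\<lambda>i. p (Y i)) z = p z" by (cases z) auto
    qed
    ultimately show "ev p f = 0" by (simp add: laurent_eval_ev)
  qed (use assms(1) in \<open>auto simp: I_def\<close>)
  then obtain s where s: "laurent_in r k s" "f = (\<Prod>i\<in>I. LV (Y (fst i)) - LC 1 * LV (Y (snd i))) * s" by blast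
  moreover have "(\<Prod>i\<in>I. LV (Y (fst i)) - LC 1 * LV (Y (snd i))) = vandermonde_poly k"
    by (simp add: vandermonde_poly_def I_def prod.Sigma split_def)
  ultimately have f: "f = vandermonde_poly k * s" by simp
  have "symY k s"
    unfolding symY_def
  proof (intro allI impI)
    fix \<tau> and x y :: point assume \<tau>: "\<tau> permutes {..<k}" and nz: "nz x" "nz y"
    have "vandermonde_poly k * (laurent_rename id \<tau> s - s) = 0"
    proof (rule leval_eqI)
      fix x y :: point assume nz: "nz x" "nz y"
      have "of_int (sign \<tau>) * (vandermonde k y * leval x (y \<circ> \<tau>) s) = of_int (sign \<tau>) * (vandermonde k y * leval x y s)"
        using skewY[OF assms(2) \<tau> nz] nz by (simp add: f vandermonde_permute[OF \<tau>])
      then show "leval x y (vandermonde_poly k * (laurent_rename id \<tau> s - s)) = leval x y 0"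
        using nz by (simp add: algebra_simps sign_def split: if_splits)
    qed
    then have "laurent_rename id \<tau> s = s" by simp
    then show "leval x (y \<circ> \<tau>) s = leval x y s" using leval_rename[OF nz, of id \<tau> s] by simp
  qed
  moreover have "zwheel k s"
    by (rule zwheel_cancel[where P = "vandermonde_poly k"])
       (use assms(3) in \<open>auto simp: zwheel_def f vandermonde_neq_0 inj_on_subset\<close>)
  ultimately show ?thesis using s(1) f by blast
qed

text \<open>The leading coefficient of the product is that of \<open>s\<close> times a Vandermonde
  product, hence nonzero. So the exact degree \<open>E\<close> of \<open>s\<close> in the last
  variable satisfies \<open>E + int m \<le> b + int k - 1\<close> with \<open>k = Suc m\<close>; the
  other variables follow by symmetry.\<close>

lemma deg_in_quotient:
  assumes s: "symY k s" and f: "\<And>i. i < k \<Longrightarrow> deg_in (Y i) a (b + int k - 1) (vandermonde_poly k * s)"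
  shows "\<exists>a'. \<forall>i<k. deg_in (Y i) a' b s"
proof (cases "k = 0 \<or> s = 0")
  case False
  then obtain m where m: "k = Suc m" by (cases k) auto
  obtain a' e where ae: "\<forall>z\<in>{Y m}. deg_in z a' e s" using deg_in_exists[of "{Y m}" s] by auto
  define E where "E = Max ((\<lambda>\<mu>. lookup \<mu> (Y m)) ` keys s)"
  have ne: "keys s \<noteq> {}" using False by simp
  then have "E \<in> (\<lambda>\<mu>. lookup \<mu> (Y m)) ` keys s"
    unfolding E_def by (intro Max_in) auto
  then obtain \<mu> where \<mu>: "\<mu> \<in> keys s" "lookup \<mu> (Y m) = E" by auto
  have dE: "deg_in (Y m) a' E s" using ae by (auto simp: deg_in_def E_def)
  have "E \<le> b"
  proof (rule ccontr)
    assume "\<not> E \<le> b"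
    have "vcoeff (Y m) (E + int m) (vandermonde_poly (Suc m) * s) = 0"
    proof (rule poly_mapping_eqI, rule ccontr)
      fix \<nu> assume "lookup (vcoeff (Y m) (E + int m) (vandermonde_poly (Suc m) * s)) \<nu> \<noteq> lookup 0 \<nu>"
      then have "lookup \<nu> (Y m) = 0" "\<nu> + single (Y m) (E + int m) \<in> keys (vandermonde_poly k * s)"
        by (auto simp: lookup_vcoeff in_keys_iff m split: if_splits)
      then have "E + int m \<le> b + int k - 1"
        using f[of m] m by (auto simp: deg_in_def lookup_add)
      then show False using \<open>\<not> E \<le> b\<close> m by simp
    qed
    then have "vcoeff (Y m) E s = 0" by (simp add: vcoeff_vandermonde_poly_mult[OF dE])
    moreover have "lookup (vcoeff (Y m) E s) (\<mu> - single (Y m) E) = lookup s \<mu>"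
      using \<mu>(2) by (simp add: lookup_vcoeff lookup_minus)
    ultimately show False using \<mu>(1) by (simp add: in_keys_iff)
  qed
  then have d: "deg_in (Y m) a' b s" using dE by (auto intro: deg_in_mono)
  have "deg_in (Y i) a' b s" if "i < k" for i
  proof -
    have "laurent_rename id (transpose m i) s = s"
      by (rule leval_eqI) (use s that m in \<open>simp add: symY_def permutes_swap_id\<close>)
    then show ?thesis using deg_in_rename[OF _ _ d, of id "transpose m i"] by simp
  qed
  then show ?thesis by blast
qed (auto simp: deg_in_def)

primrec top_coeff_iter :: "int \<Rightarrow> nat \<Rightarrow> nat \<Rightarrow> laurent \<Rightarrow> laurent" where
  "top_coeff_iter b 0 k f = f"
| "top_coeff_iter b (Suc j) k f = vcoeff (Y (k - Suc j)) (b + int (k - Suc j)) (top_coeff_iter b j k f)"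

primrec vcoeff_iter :: "int \<Rightarrow> nat \<Rightarrow> nat \<Rightarrow> laurent \<Rightarrow> laurent" where
  "vcoeff_iter b 0 k s = s"
| "vcoeff_iter b (Suc j) k s = vcoeff (Y (k - Suc j)) b (vcoeff_iter b j k s)"

lemma lookup_vcoeff_iter:
  assumes "j \<le> k"
  shows "lookup (vcoeff_iter b j k s) \<nu> = (if \<forall>i\<in>{k - j..<k}. lookup \<nu> (Y i) = 0
    then lookup s (\<nu> + (\<Sum>i\<in>{k - j..<k}. single (Y i) b)) else 0)"
  using assms
proof (induction j arbitrary: \<nu>)
  case (Suc j)
  have e: "{k - Suc j..<k} = insert (k - Suc j) {k - j..<k}" using Suc.prems by auto
  have "(\<forall>i\<in>{k - j..<k}. lookup (\<nu> + single (Y (k - Suc j)) b) (Y i) = 0) \<longleftrightarrow>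
    (\<forall>i\<in>{k - j..<k}. lookup \<nu> (Y i) = 0)"
  proof (rule ball_cong[OF refl])
    fix i assume "i \<in> {k - j..<k}"
    then have "k - j \<le> i" by simp
    then have "i \<noteq> k - Suc j" using Suc.prems by arith
    then show "lookup (\<nu> + single (Y (k - Suc j)) b) (Y i) = 0 \<longleftrightarrow> lookup \<nu> (Y i) = 0"
      by (simp add: lookup_add lookup_single when_def)
  qed
  moreover have "(\<Sum>i\<in>{k - Suc j..<k}. single (Y i) b) =
    single (Y (k - Suc j)) b + (\<Sum>i\<in>{k - j..<k}. single (Y i) b)"
    unfolding e using Suc.prems by (subst sum.insert) auto
  ultimately show ?case
    using Suc.IH[of "\<nu> + single (Y (k - Suc j)) b"] Suc.prems
    by (simp only: vcoeff_iter.simps lookup_vcoeff e ball_simps add.assoc) auto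
qed simp

lemma deg_in_vcoeff_iter:
  assumes "j \<le> k" "i < k - j" "deg_in (Y i) a b' s"
  shows "deg_in (Y i) a b' (vcoeff_iter b j k s)"
  unfolding deg_in_def
proof
  fix \<nu> assume "\<nu> \<in> keys (vcoeff_iter b j k s)"
  then have "\<nu> + (\<Sum>i\<in>{k - j..<k}. single (Y i) b) \<in> keys s"
    by (auto simp: in_keys_iff lookup_vcoeff_iter[OF assms(1)] split: if_splits)
  moreover have "lookup (\<nu> + (\<Sum>i\<in>{k - j..<k}. single (Y i) b)) (Y i) = lookup \<nu> (Y i)"
    using assms(2) by (simp add: lookup_add lookup_sum lookup_single when_def)
  ultimately show "a \<le> lookup \<nu> (Y i) \<and> lookup \<nu> (Y i) \<le> b'"
    using assms(3) by (auto simp: deg_in_def)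
qed

text \<open>The exponents extracted on the left are \<open>b + k - 1\<close>,
  \<open>b + k - 2\<close> and so on. Their excess over \<open>b\<close> is the degree of the
  Vandermonde product in the variable removed, so on the quotient each step extracts exponent
  \<open>b\<close>.\<close>

lemma top_coeff_iter_vandermonde_poly_mult:
  assumes "j \<le> k" "\<And>i. i < k \<Longrightarrow> deg_in (Y i) a b s"
  shows "top_coeff_iter b j k (vandermonde_poly k * s) = vandermonde_poly (k - j) * vcoeff_iter b j k s"
  using assms(1)
proof (induction j)
  case (Suc j)
  then have e: "k - j = Suc (k - Suc j)" by simp
  have "deg_in (Y (k - Suc j)) a b (vcoeff_iter b j k s)"
    using Suc.prems by (intro deg_in_vcoeff_iter assms(2)) auto
  then show ?case using Suc vcoeff_vandermonde_poly_mult[of "k - Suc j" a b "vcoeff_iter b j k s"] by (simp add: e)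
qed simp

text \<open>On a wheel \<open>z\<^sub>i = w\<^sup>i c\<close>, the only monomials contributing to \<open>c\<^bsup>tb\<^esup>\<close> are those of exponent
  exactly \<open>b\<close> in all the wheel variables.\<close>

lemma vcoeff_iter_zwheel:
  assumes s: "zwheel k s" and "t \<le> k" and deg: "\<And>i. i < k \<Longrightarrow> deg_in (Y i) a b s"
  shows "vcoeff_iter b t k s = 0"
proof (rule poly_mapping_eqI)
  fix \<nu>
  define \<beta> where "\<beta> = (\<Sum>i\<in>{k - t..<k}. single (Y i) b)"
  define \<mu>0 where "\<mu>0 = \<nu> + \<beta>"
  define N where "N = Y ` {k - t..<k}"
  define c where "c = (\<lambda>z. case z of X i \<Rightarrow> 1 | Y i \<Rightarrow> if i \<in> {k - t..<k} then w ^ (i - (k - t)) else 1)"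
  define \<omega> where "\<omega> = (\<lambda>z. if z \<in> N then Y (k - t) else z)"
  have c: "nz c" by (auto simp: c_def nz_def split: var.splits)
  have par: "(\<lambda>z. c z * p (\<omega> z)) = case_var (\<lambda>i. p (X i)) (\<lambda>i. if i \<in> {k - t..<k} then w ^ (i - (k - t)) * p (Y (k - t)) else p (Y i))" for p
    by (rule ext) (auto simp: c_def \<omega>_def N_def split: var.splits)
  have s0: "monom_subst c \<omega> s = 0"
  proof (rule ev_faithful)
    fix p :: "var \<Rightarrow> complex" assume p: "nz p"
    have "leval (\<lambda>i. p (X i)) (\<lambda>i. if i \<in> {k - t..<k} then w ^ (i - (k - t)) * p (Y (k - t)) else p (Y i)) s = 0"
      by (rule zwheelD[OF s, where \<alpha> = "\<lambda>i. k - t + i"]) (use p \<open>t \<le> k\<close> in \<open>auto simp: nz_def inj_on_def\<close>)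
    then show "ev p (monom_subst c \<omega> s) = 0" by (simp add: ev_monom_subst p par laurent_eval_ev)
  qed
  show "lookup (vcoeff_iter b t k s) \<nu> = lookup 0 \<nu>"
  proof (cases "\<forall>i\<in>{k - t..<k}. lookup \<nu> (Y i) = 0")
    case True
    have \<mu>0: "lookup \<mu>0 (Y i) = b" if "i \<in> {k - t..<k}" for i
      using True that by (simp add: \<mu>0_def \<beta>_def lookup_add lookup_sum lookup_single when_def)
    \<comment> \<open>On the chain the exponents of \<open>\<mu>\<close> are at most
      \<open>b\<close> and have the same sum as those of \<open>\<mu>0\<close>, which all equal
      \<open>b\<close>; off the chain the substitution changes nothing.\<close>
    have key: "\<mu> = \<mu>0" if \<mu>: "\<mu> \<in> keys s" and eq: "pushforward \<omega> \<mu> = pushforward \<omega> \<mu>0" for \<mu>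
    proof -
      define K where "K = keys \<mu> \<union> keys \<mu>0 \<union> N"
      have K: "finite K" "keys \<mu> \<subseteq> K" "keys \<mu>0 \<subseteq> K" by (auto simp: K_def N_def)
      have sums: "(\<Sum>z | z \<in> K \<and> \<omega> z = q. lookup \<mu> z) = (\<Sum>z | z \<in> K \<and> \<omega> z = q. lookup \<mu>0 z)" for q
        using eq lookup_pushforward_sum[OF K(1,2), of \<omega> q] lookup_pushforward_sum[OF K(1,3), of \<omega> q] by simp
      show "\<mu> = \<mu>0"
      proof (rule poly_mapping_eqI)
        fix q
        show "lookup \<mu> q = lookup \<mu>0 q"
        proof (cases "q \<in> N")
          case False
          have "Y (k - t) \<in> N" using \<open>t \<le> k\<close> t_pos by (auto simp: N_def)
          then have "{z \<in> K. \<omega> z = q} = (if q \<in> K then {q} else {})"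
            using False by (auto simp: \<omega>_def split: if_splits)
          moreover have "lookup \<mu> q = 0 \<and> lookup \<mu>0 q = 0" if "q \<notin> K"
            using K that by (meson in_keys_iff subsetD)
          ultimately show ?thesis using sums[of q] by (auto split: if_splits)
        next
          case True
          have "{z \<in> K. \<omega> z = Y (k - t)} = N"
            using \<open>t \<le> k\<close> t_pos by (auto simp: \<omega>_def K_def N_def split: if_splits)
          then have "(\<Sum>z\<in>N. lookup \<mu>0 z - lookup \<mu> z) = 0"
            using sums[of "Y (k - t)"] by (simp add: sum_subtractf)
          moreover have "0 \<le> lookup \<mu>0 z - lookup \<mu> z" if "z \<in> N" for z
            using that \<mu>0 deg \<mu> by (auto simp: N_def deg_in_def)
          ultimately have "lookup \<mu>0 q - lookup \<mu> q = 0"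
            using True by (subst (asm) sum_nonneg_eq_0_iff) (auto simp: N_def)
          then show ?thesis by simp
        qed
      qed
    qed
    have "lookup s \<mu>0 = 0"
    proof (rule ccontr)
      assume "lookup s \<mu>0 \<noteq> 0"
      then have k0: "\<mu>0 \<in> keys s" by (simp add: in_keys_iff)
      have "0 = (\<Sum>\<mu>\<in>keys s. if \<mu> = \<mu>0 then lookup s \<mu> * monom_eval c \<mu> else 0)"
        using arg_cong[OF s0, of "\<lambda>g. lookup g (pushforward \<omega> \<mu>0)"] key
        unfolding monom_subst_def lookup_sum lookup_single when_def
        by (smt (verit) lookup_zero sum.cong)
      also have "\<dots> = lookup s \<mu>0 * monom_eval c \<mu>0" using k0 by simp
      finally show False using \<open>lookup s \<mu>0 \<noteq> 0\<close> monom_eval_nz[OF c] by simp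
    qed
    then show ?thesis by (simp add: lookup_vcoeff_iter[OF \<open>t \<le> k\<close>] \<mu>0_def \<beta>_def)
  next
    case False
    then show ?thesis by (simp only: lookup_vcoeff_iter[OF \<open>t \<le> k\<close>] if_False lookup_zero)
  qed
qed

text \<open>On the symmetric quotient this is the coefficient at which the last \<open>t\<close>
  variables all have the maximal exponent \<open>b\<close>, and the chain condition kills
  it.\<close>

lemma top_coeff_iter_zwheel:
  assumes "box_wheel r a b k f" "t \<le> k"
  shows "top_coeff_iter b t k f = 0"
proof -
  obtain s where s: "f = vandermonde_poly k * s" "symY k s" "zwheel k s"
    using skew_quotient[OF box_wheelD(1,2,3)[OF assms(1)]] by blast
  obtain a' where "\<forall>i<k. deg_in (Y i) a' b s"
    using deg_in_quotient[OF s(2)] box_wheelD(4)[OF assms(1)] s(1) by blast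
  then show ?thesis
    using top_coeff_iter_vandermonde_poly_mult[OF assms(2), of a' b s] vcoeff_iter_zwheel[OF s(3) assms(2), of a' b] s(1) by simp
qed

lemma box_wheel_top_coeff_iter: "box_wheel r a b k f \<Longrightarrow> j \<le> k \<Longrightarrow> box_wheel r a b (k - j) (top_coeff_iter b j k f)"
proof (induction j)
  case (Suc j)
  then have e: "k - j = Suc (k - Suc j)" by simp
  show ?case using box_wheel_vcoeff[of r a b "k - Suc j" "top_coeff_iter b j k f"] Suc by (simp add: e)
qed simp

text \<open>Write \<open>T\<close> for \<open>zshuffle b\<close> and \<open>D\<close> for the leading coefficient in the last variable. Since
  \<open>D T = 1 + w T D\<close>, one has \<open>D f = D S\<close> for a combination \<open>S\<close> of the \<open>T\<^sup>j D\<^sup>j f\<close> with \<open>j \<ge> 1\<close>. The recursion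
  for its coefficients divides by the \<open>w\<close>-integers of \<open>j\<close>, and it stops before the vanishing \<open>w\<close>-integer
  of \<open>t\<close> because the wheel condition forces \<open>D\<^sup>t f = 0\<close>.\<close>

lemma leading_term_lift:
  assumes f: "box_wheel r a b k f" "a \<le> b"
    and R0: "\<And>k. R k 0" and Rdiff: "\<And>k f g. R k f \<Longrightarrow> R k g \<Longrightarrow> R k (f - g)"
    and Rmult: "\<And>k f c. R k f \<Longrightarrow> R k (LC c * f)"
    and RT: "\<And>k f. t \<ge> 2 \<Longrightarrow> laurent_in r k f \<Longrightarrow> R k f \<Longrightarrow> R (Suc k) (zshuffle b k f)"
    and IH: "\<And>k' g. k' < k \<Longrightarrow> box_wheel r a b k' g \<Longrightarrow> R k' g"
    and j: "1 \<le> j" "j \<le> t" "j \<le> k"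
  shows "\<exists>S. R k S \<and> box_wheel r a b k S \<and> vcoeff (Y (k - 1)) (b + int (k - 1)) S = zshuffle_iter b (j - 1) (k - j) (top_coeff_iter b j k f)"
  using j
\<comment> \<open>Downward induction on \<open>j\<close>, from \<open>j = t\<close>, where the
  prescribed leading coefficient is 0.\<close>
proof (induction "t - j" arbitrary: j)
  case 0
  then have "j = t" by simp
  then have "top_coeff_iter b j k f = 0" using top_coeff_iter_zwheel[OF f(1)] 0 by simp
  then show ?case using R0 by (intro exI[of _ 0]) simp
next
  case (Suc n)
  then have t: "t \<ge> 2" "j < t" by auto
  obtain i where i: "j = Suc i" using Suc.prems by (cases j) auto
  define g where "g = top_coeff_iter b j k f"
  have g: "box_wheel r a b (k - j) g" unfolding g_def by (rule box_wheel_top_coeff_iter[OF f(1)]) (use Suc in auto)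
  have Rg: "R (k - j + i') (zshuffle_iter b i' (k - j) g)" for i'
  proof (induction i')
    case 0
    then show ?case using IH[OF _ g] Suc.prems by simp
  next
    case (Suc i')
    then show ?case using RT[OF t(1) box_wheelD(1)[OF box_wheel_zshuffle_iter[OF g f(2) t(1), of i']]] by simp
  qed
  have Tg: "R k (zshuffle_iter b j (k - j) g)" "box_wheel r a b k (zshuffle_iter b j (k - j) g)"
    using Rg[of j] box_wheel_zshuffle_iter[OF g f(2) t(1), of j] Suc.prems by simp_all
  have q: "qint j \<noteq> 0" using qint_neq_0 Suc.prems t by simp
  have inv: "LC (inverse (qint j)) * (LC (qint j) * h) = h" for h
    by (rule leval_eqI) (simp add: q)
  show ?case
  proof (cases "j = k")
    case True
    \<comment> \<open>No variable is left in \<open>g\<close>, so the relation has no term with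
      \<open>D g\<close>.\<close>
    have "vcoeff (Y (k - 1)) (b + int (k - 1)) (zshuffle_iter b j (k - j) g) = LC (qint j) * zshuffle_iter b i 0 g"
      using vcoeff_zshuffle_iter_0[of r a b g i] g f(2) t(1) unfolding True[symmetric] i by (simp del: zshuffle_iter.simps)
    then have "vcoeff (Y (k - 1)) (b + int (k - 1)) (LC (inverse (qint j)) * zshuffle_iter b j (k - j) g) =
      zshuffle_iter b (j - 1) (k - j) (top_coeff_iter b j k f)"
      using i True by (simp only: vcoeff_LC_mult inv[unfolded i] g_def diff_Suc_1 diff_self_eq_0)
    then show ?thesis
      by (intro exI[of _ "LC (inverse (qint j)) * zshuffle_iter b j (k - j) g"] conjI Rmult box_wheel_LC_mult Tg)
  next
    case False
    then obtain m where m: "k - j = Suc m" using Suc.prems by (cases "k - j") auto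
    have km: "k = Suc m + j" "k - Suc j = m" "k - 1 = Suc m + i" using m i by auto
    have "n = t - Suc j" "1 \<le> Suc j" "Suc j \<le> t" "Suc j \<le> k"
      using Suc.hyps(2) Suc.prems False by linarith+
    from Suc.hyps(1)[OF this]
    obtain S where S: "R k S" "box_wheel r a b k S"
      "vcoeff (Y (k - 1)) (b + int (k - 1)) S = zshuffle_iter b j m (top_coeff_iter b (Suc j) k f)"
      unfolding km(2) diff_Suc_1 by blast
    have "vcoeff (Y (k - 1)) (b + int (k - 1)) (zshuffle_iter b j (k - j) g) =
      LC (qint j) * zshuffle_iter b i (k - j) g + LC (w ^ j) * zshuffle_iter b j m (top_coeff_iter b (Suc j) k f)"
      using vcoeff_zshuffle_iter_Suc[of r a b m g i] g f(2) t(1) m i km by (simp add: g_def)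
    \<comment> \<open>Solves \<open>D T^j g = [j] T^(j-1) g + w^j T^j D g\<close> for
      \<open>T^(j-1) g\<close>; the induction supplies \<open>S\<close> with
      \<open>D S = T^j D g\<close>.\<close>
    then have "vcoeff (Y (k - 1)) (b + int (k - 1)) (LC (inverse (qint j)) * (zshuffle_iter b j (k - j) g - LC (w ^ j) * S)) =
      zshuffle_iter b (j - 1) (k - j) (top_coeff_iter b j k f)"
      using i by (simp only: vcoeff_LC_mult vcoeff_diff S(3) add_diff_cancel_right' inv[unfolded i] g_def diff_Suc_1)
    then show ?thesis
      by (intro exI[of _ "LC (inverse (qint j)) * (zshuffle_iter b j (k - j) g - LC (w ^ j) * S)"] conjI
          Rmult Rdiff box_wheel_LC_mult box_wheel_diff Tg S(1,2))
  qed
qed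

text \<open>Outer induction on the number of variables, inner induction on the width of the box.
  Subtracting an \<open>S\<close> with the same leading coefficient lowers the degree of
  \<open>f\<close> in one variable, hence by skewness in all, so \<open>b\<close> drops to
  \<open>b - 1\<close> until the box is too narrow for a nonzero skew function.\<close>

lemma box_wheel_induct:
  assumes "box_wheel r a b k f"
    and R0: "\<And>f. laurent_in r 0 f \<Longrightarrow> skew {..<r} {} f \<Longrightarrow> R 0 f" "\<And>k. R k 0"
    and Rdiff: "\<And>k f g. R k f \<Longrightarrow> R k g \<Longrightarrow> R k (f - g)"
    and Rmult: "\<And>k f c. R k f \<Longrightarrow> R k (LC c * f)"
    and RT: "\<And>b k f. t \<ge> 2 \<Longrightarrow> laurent_in r k f \<Longrightarrow> R k f \<Longrightarrow> R (Suc k) (zshuffle b k f)"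
  shows "R k f"
  using assms(1)
proof (induction k arbitrary: a b f rule: less_induct)
  case (less k)
  show ?case
  proof (cases "k = 0")
    case True
    then show ?thesis using R0(1)[of f] less.prems by (simp add: box_wheel_def)
  next
    case False
    from less.prems show ?thesis
    proof (induction "nat (b - a + 1)" arbitrary: b f)
      case 0
      have "f = 0"
        by (rule skew_narrow_eq_0[OF box_wheelD(2)[OF 0(2)] box_wheelD(4)[OF 0(2)]]) (use 0 False in auto)
      then show ?case by (simp add: R0)
    next
      case (Suc n)
      then have ab: "a \<le> b" by simp
      have IH: "R k' g" if "k' < k" "box_wheel r a b k' g" for k' g
        using less.IH that by blast
      obtain S where S: "R k S" "box_wheel r a b k S"
        "vcoeff (Y (k - 1)) (b + int (k - 1)) S = zshuffle_iter b (1 - 1) (k - 1) (top_coeff_iter b 1 k f)"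
        using leading_term_lift[where R = R and j = 1, OF Suc.prems ab R0(2) Rdiff Rmult RT IH] t_pos False by auto
      have "vcoeff (Y (k - 1)) (b + int (k - 1)) (f - S) = 0"
        using S(3) by (simp add: vcoeff_diff)
      have fS: "box_wheel r a b k (f - S)" using Suc.prems S(2) by (rule box_wheel_diff)
      have "deg_in (Y (k - 1)) a (b - 1 + int k - 1) (f - S)"
        unfolding deg_in_def
      proof
        fix \<mu> assume \<mu>: "\<mu> \<in> keys (f - S)"
        have d: "a \<le> lookup \<mu> (Y (k - 1))" "lookup \<mu> (Y (k - 1)) \<le> b + int k - 1"
          using box_wheelD(4)[OF fS, of "k - 1"] False \<mu> by (auto simp: deg_in_def)
        moreover have "lookup \<mu> (Y (k - 1)) \<noteq> b + int k - 1"
        proof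
          assume e: "lookup \<mu> (Y (k - 1)) = b + int k - 1"
          then have "lookup (vcoeff (Y (k - 1)) (b + int (k - 1)) (f - S)) (\<mu> - single (Y (k - 1)) (b + int (k - 1))) = lookup (f - S) \<mu>"
            using False by (simp add: lookup_vcoeff lookup_minus of_nat_diff)
          then show False using \<mu> \<open>vcoeff (Y (k - 1)) (b + int (k - 1)) (f - S) = 0\<close> by (simp add: in_keys_iff)
        qed
        ultimately show "a \<le> lookup \<mu> (Y (k - 1)) \<and> lookup \<mu> (Y (k - 1)) \<le> b - 1 + int k - 1"
          by simp
      qed
      note top = this
      have "deg_in (Y i) a (b - 1 + int k - 1) (f - S)" if "i < k" for i
      proof -
        have "laurent_rename id (transpose (k - 1) i) (f - S) = LC (of_int (sign (transpose (k - 1) i))) * (f - S)"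
        proof (rule leval_eqI)
          fix x y :: point assume nz: "nz x" "nz y"
          have "transpose (k - 1) i permutes {..<k}" using that by (intro permutes_swap_id) auto
          from skewY[OF box_wheelD(2)[OF fS] this nz]
          show "leval x y (laurent_rename id (transpose (k - 1) i) (f - S)) = leval x y (LC (of_int (sign (transpose (k - 1) i))) * (f - S))"
            using nz by simp
        qed
        then have e: "f - S = LC (of_int (sign (transpose (k - 1) i))) * laurent_rename id (transpose (k - 1) i) (f - S)"
          by (intro leval_eqI) (simp flip: mult.assoc of_int_mult)
        have "deg_in (Y i) a (b - 1 + int k - 1) (laurent_rename id (transpose (k - 1) i) (f - S))"
          using deg_in_rename[OF _ _ top, of id "transpose (k - 1) i"] by simp
        from deg_in_LC_mult[OF this, of "of_int (sign (transpose (k - 1) i))"]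
        show ?thesis by (simp only: e[symmetric])
      qed
      then have "box_wheel r a (b - 1) k (f - S)" using fS by (simp add: box_wheel_def)
      then have "R k (f - S)" using Suc.hyps(1)[of "b - 1" "f - S"] Suc.hyps(2) by simp
      \<comment> \<open>\<open>R\<close> is closed under differences and scalars, so
        \<open>f\<close> is recovered as \<open>(f - S) - (-1) * S\<close>.\<close>
      then have "R k (f - S - LC (-1) * S)" using Rdiff Rmult S(1) by blast
      moreover have "f - S - LC (-1) * S = f" by (rule leval_eqI) simp
      ultimately show ?case by simp
    qed
  qed
qed

text \<open>The spanning statement as an induction principle, so that a realisation in the shuffle
  algebra can be followed through linear combinations and shuffles. Its shuffle case carries
  \<open>t \<ge> 2\<close>, on which the realisation of a matched pair depends.\<close>

lemma zwheel_induct [consumes 3, case_names skew zero diff scale zshuffle]: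
  assumes "laurent_in r k f" "skew {..<r} {..<k} f" "zwheel k f"
    and "\<And>f. laurent_in r 0 f \<Longrightarrow> skew {..<r} {} f \<Longrightarrow> R 0 f" "\<And>k. R k 0"
    and "\<And>k f g. R k f \<Longrightarrow> R k g \<Longrightarrow> R k (f - g)"
    and "\<And>k f c. R k f \<Longrightarrow> R k (LC c * f)"
    and "\<And>b k f. t \<ge> 2 \<Longrightarrow> laurent_in r k f \<Longrightarrow> R k f \<Longrightarrow> R (Suc k) (zshuffle b k f)"
  shows "R k f"
proof -
  obtain a b where "\<forall>z\<in>Y ` {..<k}. deg_in z a b f"
    using deg_in_exists[of "Y ` {..<k}" f] by auto
  \<comment> \<open>The shift brings the exponent bound \<open>b\<close> into the form
    \<open>b' + int k - 1\<close> of \<open>box_wheel\<close>.\<close>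
  then have "box_wheel r a (b - int k + 1) k f" using assms(1-3) by (simp add: box_wheel_def)
  then show ?thesis using box_wheel_induct[where R = R] assms(4-8) by blast
qed

end

section \<open>Numerators\<close>

definition denom :: "nat \<Rightarrow> nat \<Rightarrow> laurent" where
  "denom n m = (\<Prod>i<n. \<Prod>j<m. LV (X i) - LV (Y j))"

definition quo :: "nat \<Rightarrow> nat \<Rightarrow> laurent \<Rightarrow> ratfun" where
  "quo n m f = to_fract f / to_fract (denom n m)"

lemma to_fract_prod: "to_fract (prod F A) = (\<Prod>a\<in>A. to_fract (F a))"
  by (induction A rule: infinite_finite_induct) simp_all

lemma to_fract_denom: "to_fract (denom n m) = (\<Prod>i<n. \<Prod>j<m. rx i - ry j)"
  by (simp add: denom_def to_fract_prod rvar_def)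

lemma LV_diff_neq_0: "z \<noteq> z' \<Longrightarrow> LV z - LV z' \<noteq> 0"
proof
  assume "z \<noteq> z'" "LV z - LV z' = 0"
  then have "ev ((\<lambda>_. 1)(z := 2)) (LV z - LV z') = 0" by simp
  then show False using \<open>z \<noteq> z'\<close> by (simp del: right_minus_eq)
qed

lemma denom_neq_0 [simp]: "denom n m \<noteq> 0"
  by (simp add: denom_def LV_diff_neq_0 del: right_minus_eq)

lemma leval_denom: "nz x \<Longrightarrow> nz y \<Longrightarrow> leval x y (denom n m) = (\<Prod>i<n. \<Prod>j<m. x i - y j)"
  by (simp add: denom_def)

lemma quo_0 [simp]: "quo n m 0 = 0"
  and quo_add: "quo n m (f + g) = quo n m f + quo n m g"
  and quo_diff: "quo n m (f - g) = quo n m f - quo n m g"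
  and quo_LC_mult: "quo n m (LC c * f) = rconst c * quo n m f"
  and quo_of_int_mult: "quo n m (of_int a * f) = of_int a * quo n m f"
proof -
  have "to_fract (of_nat k) = (of_nat k :: ratfun)" for k by (induction k) simp_all
  then have "to_fract (of_int a) = (of_int a :: ratfun)" by (cases a rule: int_cases2) simp_all
  then show "quo n m (of_int a * f) = of_int a * quo n m f" by (simp add: quo_def)
qed (simp_all add: quo_def rconst_def add_divide_distrib diff_divide_distrib)

lemma quo_inject [simp]: "quo n m f = quo n m g \<longleftrightarrow> f = g"
  by (simp add: quo_def)

lemma quo_eq_0_iff [simp]: "quo n m f = 0 \<longleftrightarrow> f = 0"
  by (simp add: quo_def)

lemma is_numerator_iff: "is_numerator n m f F \<longleftrightarrow> laurent_in n m f \<and> F = quo n m f"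
  by (simp add: is_numerator_def quo_def to_fract_denom)

lemma ratfun_rename_to_fract:
  "inj \<sigma> \<Longrightarrow> inj \<tau> \<Longrightarrow> ratfun_rename \<sigma> \<tau> (to_fract a / to_fract b) =
     to_fract (laurent_rename \<sigma> \<tau> a) / to_fract (laurent_rename \<sigma> \<tau> b)"
  using ratfun_rename_Fract[of \<sigma> \<tau> a b] by (simp add: to_fract_def)

lemma rename_denom:
  assumes "\<sigma> permutes {..<n}" "\<tau> permutes {..<m}"
  shows "laurent_rename \<sigma> \<tau> (denom n m) = denom n m"
proof (rule leval_eqI)
  fix x y :: point assume nz: "nz x" "nz y"
  have "(\<Prod>i<n. \<Prod>j<m. x (\<sigma> i) - y (\<tau> j)) = (\<Prod>i<n. \<Prod>j<m. x (\<sigma> i) - y j)"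
    using prod.permute[OF assms(2), of "\<lambda>j. x _ - y j"] by (simp add: comp_def)
  also have "\<dots> = (\<Prod>i<n. \<Prod>j<m. x i - y j)"
    using prod.permute[OF assms(1), of "\<lambda>i. \<Prod>j<m. x i - y j"] by (simp add: comp_def)
  finally show "leval x y (laurent_rename \<sigma> \<tau> (denom n m)) = leval x y (denom n m)"
    using nz by (simp add: leval_denom)
qed

lemma ratfun_rename_quo:
  "\<sigma> permutes {..<n} \<Longrightarrow> \<tau> permutes {..<m} \<Longrightarrow>
     ratfun_rename \<sigma> \<tau> (quo n m f) = quo n m (laurent_rename \<sigma> \<tau> f)"
  unfolding quo_def by (subst ratfun_rename_to_fract) (simp_all add: permutes_inj rename_denom)

lemma skew_symmetric_quo: "skew_symmetric n m (quo n m f) \<longleftrightarrow> skew {..<n} {..<m} f"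
proof
  assume "skew_symmetric n m (quo n m f)"
  then have 1: "\<sigma> permutes {..<n} \<Longrightarrow> laurent_rename \<sigma> id f = of_int (sign \<sigma>) * f"
    and 2: "\<tau> permutes {..<m} \<Longrightarrow> laurent_rename id \<tau> f = of_int (sign \<tau>) * f" for \<sigma> \<tau>
    unfolding skew_symmetric_def
    by (simp_all add: ratfun_rename_quo permutes_id flip: quo_of_int_mult)
  show "skew {..<n} {..<m} f"
  proof (rule skewI)
    fix \<sigma> and x y :: point assume "\<sigma> permutes {..<n}" "nz x" "nz y"
    then show "leval (x \<circ> \<sigma>) y f = of_int (sign \<sigma>) * leval x y f"
      using arg_cong[OF 1, of \<sigma> "leval x y"] by simp
  next
    fix \<tau> and x y :: point assume "\<tau> permutes {..<m}" "nz x" "nz y"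
    then show "leval x (y \<circ> \<tau>) f = of_int (sign \<tau>) * leval x y f"
      using arg_cong[OF 2, of \<tau> "leval x y"] by simp
  qed
next
  assume s: "skew {..<n} {..<m} f"
  have "laurent_rename \<sigma> id f = of_int (sign \<sigma>) * f" if "\<sigma> permutes {..<n}" for \<sigma>
    by (rule leval_eqI) (simp add: skewX[OF s that])
  moreover have "laurent_rename id \<tau> f = of_int (sign \<tau>) * f" if "\<tau> permutes {..<m}" for \<tau>
    by (rule leval_eqI) (simp add: skewY[OF s that])
  ultimately show "skew_symmetric n m (quo n m f)"
    unfolding skew_symmetric_def by (simp add: ratfun_rename_quo permutes_id quo_of_int_mult)
qed

lemma shuffle_component_iff:
  "F \<in> shuffle_component n m \<longleftrightarrow> (\<exists>f. laurent_in n m f \<and> skew {..<n} {..<m} f \<and> F = quo n m f)"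
  unfolding shuffle_component_def is_numerator_iff by (auto simp: skew_symmetric_quo)

text \<open>With this, skewness moves a wheel or a matching at arbitrary indices into a standard
  position.\<close>

lemma extend_to_permutation:
  assumes "inj_on \<alpha> {..<t}" "\<alpha> ` {..<t} \<subseteq> {..<n}"
  obtains \<sigma> where "\<sigma> permutes {..<n::nat}" "\<And>i. i < t \<Longrightarrow> \<sigma> i = \<alpha> i" "t \<le> n"
proof -
  have c: "card (\<alpha> ` {..<t}) = t" using assms(1) by (simp add: card_image)
  then have tn: "t \<le> n" using card_mono[OF _ assms(2)] by simp
  have "card ({..<n} - {..<t}) = card ({..<n} - \<alpha> ` {..<t})"
    using assms(2) c tn by (simp add: card_Diff_subset)
  then obtain h where h: "bij_betw h ({..<n} - {..<t}) ({..<n} - \<alpha> ` {..<t})"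
    using finite_same_card_bij[of "{..<n} - {..<t}" "{..<n} - \<alpha> ` {..<t}"] by auto
  define \<sigma> where "\<sigma> = (\<lambda>i. if i < t then \<alpha> i else if i < n then h i else i)"
  have "bij_betw \<sigma> ({..<t} \<union> ({..<n} - {..<t})) (\<alpha> ` {..<t} \<union> ({..<n} - \<alpha> ` {..<t}))"
  proof (rule bij_betw_combine)
    show "bij_betw \<sigma> {..<t} (\<alpha> ` {..<t})"
      using assms(1) by (simp add: bij_betw_def \<sigma>_def inj_on_def)
    show "bij_betw \<sigma> ({..<n} - {..<t}) ({..<n} - \<alpha> ` {..<t})"
      using h by (subst bij_betw_cong[of _ _ h]) (auto simp: \<sigma>_def)
  qed auto
  moreover have "{..<t} \<union> ({..<n} - {..<t}) = {..<n}" "\<alpha> ` {..<t} \<union> ({..<n} - \<alpha> ` {..<t}) = {..<n}"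
    using tn assms(2) by auto
  ultimately have "\<sigma> permutes {..<n}"
    using tn by (intro bij_imp_permutes) (auto simp: \<sigma>_def)
  then show ?thesis using that[of \<sigma>] tn by (simp add: \<sigma>_def)
qed

section \<open>The wheel condition on numerators\<close>

context wheel
begin

text \<open>Wheels sit at arbitrary indices, not at the first \<open>t\<close>. For skew numerators
  vanishing on them is the same condition, but this form is invariant under permutations and passes
  directly to the operands of a product.\<close>

definition on_wheel :: "nat \<Rightarrow> nat \<Rightarrow> point \<Rightarrow> point \<Rightarrow> bool" where
  "on_wheel n m x y \<longleftrightarrow> nz x \<and> nz y \<and> (\<exists>\<alpha> \<beta>.
     inj_on \<alpha> {..<t} \<and> \<alpha> ` {..<t} \<subseteq> {..<n} \<and> inj_on \<beta> {..<t} \<and> \<beta> ` {..<t} \<subseteq> {..<m} \<and>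
     (\<forall>i<t. x (\<alpha> i) = u * y (\<beta> i) \<and> y (\<beta> i) = u * x (\<alpha> (Suc i mod t))))"

definition xwheel :: "nat \<Rightarrow> nat \<Rightarrow> laurent \<Rightarrow> bool" where
  "xwheel n m f \<longleftrightarrow> (\<forall>x y. on_wheel n m x y \<longrightarrow> leval x y f = 0)"

lemma on_wheelE:
  assumes "on_wheel n m x y"
  obtains \<alpha> \<beta> where "nz x" "nz y" "inj_on \<alpha> {..<t}" "\<alpha> ` {..<t} \<subseteq> {..<n}" "inj_on \<beta> {..<t}"
    "\<beta> ` {..<t} \<subseteq> {..<m}"
    "\<And>i. i < t \<Longrightarrow> x (\<alpha> i) = u * y (\<beta> i) \<and> y (\<beta> i) = u * x (\<alpha> (Suc i mod t))"
  using assms unfolding on_wheel_def by metis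

lemma on_wheel_nz: "on_wheel n m x y \<Longrightarrow> nz x \<and> nz y"
  by (simp add: on_wheel_def)

lemma xwheelD:
  assumes "xwheel n m f" "nz x" "nz y" "inj_on \<alpha> {..<t}" "\<alpha> ` {..<t} \<subseteq> {..<n}"
     "inj_on \<beta> {..<t}" "\<beta> ` {..<t} \<subseteq> {..<m}"
     "\<And>i. i < t \<Longrightarrow> x (\<alpha> i) = u * y (\<beta> i) \<and> y (\<beta> i) = u * x (\<alpha> (Suc i mod t))"
  shows "leval x y f = 0"
proof -
  have "on_wheel n m x y"
    unfolding on_wheel_def by (intro conjI exI[of _ \<alpha>] exI[of _ \<beta>] allI impI assms(2-7)
        assms(8)[THEN conjunct1] assms(8)[THEN conjunct2])
  then show ?thesis using assms(1) by (simp add: xwheel_def)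
qed

lemma wheel_component_quo:
  assumes f: "laurent_in n m f" "skew {..<n} {..<m} f"
  shows "wheel_component v t n m (quo n m f) \<longleftrightarrow> xwheel n m f"
proof
  assume w: "wheel_component v t n m (quo n m f)"
  show "xwheel n m f"
    unfolding xwheel_def
  proof (intro allI impI)
    fix x y assume "on_wheel n m x y"
    then obtain \<alpha> \<beta> where nz: "nz x" "nz y" and \<alpha>: "inj_on \<alpha> {..<t}" "\<alpha> ` {..<t} \<subseteq> {..<n}"
      and \<beta>: "inj_on \<beta> {..<t}" "\<beta> ` {..<t} \<subseteq> {..<m}"
      and wh: "\<And>i. i < t \<Longrightarrow> x (\<alpha> i) = u * y (\<beta> i) \<and> y (\<beta> i) = u * x (\<alpha> (Suc i mod t))"
      by (erule on_wheelE)
    obtain \<sigma> where \<sigma>: "\<sigma> permutes {..<n}" "\<And>i. i < t \<Longrightarrow> \<sigma> i = \<alpha> i" "t \<le> n"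
      using extend_to_permutation[OF \<alpha>] by blast
    obtain \<tau> where \<tau>: "\<tau> permutes {..<m}" "\<And>i. i < t \<Longrightarrow> \<tau> i = \<beta> i" "t \<le> m"
      using extend_to_permutation[OF \<beta>] by blast
    have "(x \<circ> \<sigma>) i / (y \<circ> \<tau>) i = - inverse v \<and> (y \<circ> \<tau>) i / (x \<circ> \<sigma>) (Suc i mod t) = - inverse v"
      if i: "i < t" for i
    proof -
      have "Suc i mod t < t" using t_pos by simp
      then have e: "\<sigma> (Suc i mod t) = \<alpha> (Suc i mod t)" by (rule \<sigma>(2))
      have "x (\<alpha> i) = u * y (\<beta> i)" "y (\<beta> i) = u * x (\<alpha> (Suc i mod t))" using wh[OF i] by auto
      then show ?thesis using nzD[OF nz(1)] nzD[OF nz(2)]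
        by (simp only: comp_apply \<sigma>(2)[OF i] \<tau>(2)[OF i] e u_def[symmetric]) (metis nonzero_mult_div_cancel_right)
    qed
    then have "leval (x \<circ> \<sigma>) (y \<circ> \<tau>) f = 0"
      using w \<sigma>(3) \<tau>(3) f nzD[OF nz(1)] nzD[OF nz(2)]
      unfolding wheel_component_def is_numerator_iff by (simp add: comp_def)
    then show "leval x y f = 0" using skewD[OF f(2) \<sigma>(1) \<tau>(1) nz] by (simp add: sign_def split: if_splits)
  qed
next
  assume w: "xwheel n m f"
  show "wheel_component v t n m (quo n m f)"
    unfolding wheel_component_def is_numerator_iff
  proof (intro allI impI)
    fix g x y assume tn: "t \<le> n \<and> t \<le> m" and g: "laurent_in n m g \<and> quo n m f = quo n m g"
      and x: "\<forall>i<n. x i \<noteq> 0" and y: "\<forall>j<m. y j \<noteq> 0"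
      and wh: "\<forall>i<t. x i / y i = - inverse v \<and> y i / x (Suc i mod t) = - inverse v"
    \<comment> \<open>\<open>wheel_component\<close> constrains only the coordinates in use; the
      others are set to 1 to obtain a point without zeros.\<close>
    define x' y' where "x' = (\<lambda>i. if i < n then x i else 1)" and "y' = (\<lambda>i. if i < m then y i else 1)"
    have "leval x' y' f = 0"
    proof (rule xwheelD[OF w, of x' y' id id])
      fix i assume i: "i < t"
      have next_lt: "Suc i mod t < t" using t_pos by simp
      have "i < n" "i < m" "Suc i mod t < n" using i order_less_le_trans[OF next_lt] tn by auto
      moreover from this have "x i \<noteq> 0" "y i \<noteq> 0" "x (Suc i mod t) \<noteq> 0" using x y by auto
      moreover have "x i / y i = u" "y i / x (Suc i mod t) = u" using wh i by (auto simp: u_def)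
      ultimately show "x' (id i) = u * y' (id i) \<and> y' (id i) = u * x' (id (Suc i mod t))"
        by (simp add: x'_def y'_def divide_eq_eq)
    qed (use x y tn in \<open>simp_all add: x'_def y'_def nz_def\<close>)
    moreover have "leval x' y' f = leval x y f"
      by (rule leval_cong[OF f(1)]) (auto simp: x'_def y'_def)
    ultimately show "leval x y g = 0" using g by simp
  qed
qed

definition wheel_numer :: "nat \<Rightarrow> nat \<Rightarrow> laurent \<Rightarrow> bool" where
  "wheel_numer n m f \<longleftrightarrow> laurent_in n m f \<and> skew {..<n} {..<m} f \<and> xwheel n m f"

lemma wheel_numer_0 [simp]: "wheel_numer n m 0"
  by (simp add: wheel_numer_def xwheel_def)

lemma wheel_numer_add: "wheel_numer n m f \<Longrightarrow> wheel_numer n m g \<Longrightarrow> wheel_numer n m (f + g)"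
  by (simp add: wheel_numer_def skew_add xwheel_def)

lemma wheel_numer_diff: "wheel_numer n m f \<Longrightarrow> wheel_numer n m g \<Longrightarrow> wheel_numer n m (f - g)"
  by (simp add: wheel_numer_def skew_diff xwheel_def)

lemma wheel_numer_LC_mult: "wheel_numer n m f \<Longrightarrow> wheel_numer n m (LC c * f)"
  by (simp add: wheel_numer_def skew_LC_mult xwheel_def on_wheel_nz)

lemma wheel_numer_short:
  assumes "laurent_in n m f" "skew {..<n} {..<m} f" "n = 0 \<or> m = 0"
  shows "wheel_numer n m f"
proof -
  have "0 \<in> {..<t}" using t_pos by simp
  then have "{..<t} \<noteq> {}" by blast
  then have "\<not> on_wheel n m x y" for x y using assms(3) unfolding on_wheel_def by auto
  then show ?thesis using assms(1,2) by (simp add: wheel_numer_def xwheel_def)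
qed

section \<open>The shuffle product on numerators\<close>

definition shuffle_kernel :: "nat \<Rightarrow> nat \<Rightarrow> nat \<Rightarrow> nat \<Rightarrow> laurent \<Rightarrow> laurent \<Rightarrow> laurent" where
  "shuffle_kernel k1 l1 k2 l2 f g = f * laurent_rename (\<lambda>i. k1 + i) (\<lambda>j. l1 + j) g *
     (\<Prod>i<k1. \<Prod>j\<in>{l1..<l1 + l2}. LV (X i) - LC u * LV (Y j)) *
     (\<Prod>i\<in>{k1..<k1 + k2}. \<Prod>j<l1. LV (Y j) - LC u * LV (X i))"

definition asym_numer :: "nat \<Rightarrow> nat \<Rightarrow> laurent \<Rightarrow> laurent" where
  "asym_numer n m f = (\<Sum>\<sigma> | \<sigma> permutes {..<n}. \<Sum>\<tau> | \<tau> permutes {..<m}.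
     of_int (sign \<sigma>) * of_int (sign \<tau>) * laurent_rename \<sigma> \<tau> f)"

lemma asym_quo: "asym n m (quo n m f) = quo n m (LC (1 / of_nat (fact n * fact m)) * asym_numer n m f)"
proof -
  have "to_fract (of_nat k) = (of_nat k :: ratfun)" for k by (induction k) simp_all
  moreover have "LC (of_nat k) = of_nat k" for k
    by (rule leval_eqI) (metis leval_of_int leval_simps(7) of_int_of_nat_eq)
  ultimately have r: "rconst (of_nat k) = of_nat k" for k by (simp add: rconst_def)
  have "rconst (1 / of_nat (fact n * fact m)) * rconst (of_nat (fact n * fact m)) = 1"
    unfolding rconst_def to_fract_mult[symmetric] mult_single by (simp add: single_one del: of_nat_fact of_nat_mult)
  then have e: "rconst (1 / of_nat (fact n * fact m)) * of_nat (fact n * fact m) = (1 :: ratfun)"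
    unfolding r .
  then have "of_nat (fact n * fact m) \<noteq> (0 :: ratfun)" by (metis mult_zero_right zero_neq_one)
  from nonzero_eq_divide_eq[OF this] e
  have "1 / of_nat (fact n * fact m) = rconst (1 / of_nat (fact n * fact m))" by metis
  moreover have "(\<Sum>\<sigma> | \<sigma> permutes {..<n}. \<Sum>\<tau> | \<tau> permutes {..<m}.
      of_int (sign \<sigma>) * of_int (sign \<tau>) * ratfun_rename \<sigma> \<tau> (quo n m f)) = quo n m (asym_numer n m f)"
  proof -
    have s: "quo n m (sum F A) = (\<Sum>a\<in>A. quo n m (F a))" for F :: "(nat \<Rightarrow> nat) \<Rightarrow> laurent" and A
      by (induction A rule: infinite_finite_induct) (simp_all add: quo_add)
    show ?thesis
      unfolding asym_numer_def s
      by (intro sum.cong refl) (simp add: ratfun_rename_quo quo_of_int_mult mult.assoc)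
  qed
  ultimately show ?thesis unfolding asym_def quo_LC_mult by (simp only:)
qed

text \<open>The sign arises because the second product in \<open>shuffle_hom\<close> divides by
  \<open>y j - x i\<close>, while \<open>denom\<close> contains \<open>x i - y j\<close>; there are
  \<open>k2 * l1\<close> such factors. The factors of \<open>shuffle_kernel\<close> come from
  \<open>inverse v = - u\<close>.\<close>

lemma shuffle_hom_quo:
  "shuffle_hom v (k1, l1) (k2, l2) (quo k1 l1 f) (quo k2 l2 g) =
     quo (k1 + k2) (l1 + l2) (LC ((-1) ^ (k2 * l1) / of_nat (fact (k1 + k2) * fact (l1 + l2))) *
       asym_numer (k1 + k2) (l1 + l2) (shuffle_kernel k1 l1 k2 l2 f g))"
proof -
  let ?n = "k1 + k2" and ?m = "l1 + l2"
  let ?A1 = "\<Prod>i<k1. \<Prod>j\<in>{l1..<l1 + l2}. LV (X i) - LC u * LV (Y j)"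
  let ?A2 = "\<Prod>i\<in>{k1..<k1 + k2}. \<Prod>j<l1. LV (Y j) - LC u * LV (X i)"
  let ?B1 = "\<Prod>i<k1. \<Prod>j\<in>{l1..<l1 + l2}. LV (X i) - LV (Y j)"
  let ?B2 = "\<Prod>i\<in>{k1..<k1 + k2}. \<Prod>j<l1. LV (Y j) - LV (X i)"
  let ?g = "laurent_rename (\<lambda>i. k1 + i) (\<lambda>j. l1 + j) g"
  let ?D = "laurent_rename (\<lambda>i. k1 + i) (\<lambda>j. l1 + j) (denom k2 l2)"
  let ?s = "(-1) ^ (k2 * l1) :: complex"
  have neg: "LV z + LC (inverse v) * LV z' = LV z - LC u * LV z'" for z z'
    by (rule ev_eqI) (simp add: u_def)
  have P: "rx i + rconst (inverse v) * ry j = to_fract (LV (X i) - LC u * LV (Y j))"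
    "ry j + rconst (inverse v) * rx i = to_fract (LV (Y j) - LC u * LV (X i))" for i j
    unfolding neg[symmetric] by (simp_all add: rvar_def rconst_def)
  \<comment> \<open>The denominators of the two operands and of the two products together contain
    each pair of an \<open>x\<close> and a \<open>y\<close> exactly once.\<close>
  have "denom k1 l1 * ?D * ?B1 * ?B2 = LC ?s * denom ?n ?m"
  proof (rule leval_eqI)
    fix x y :: point assume nz: "nz x" "nz y"
    have n: "{..<?n} = {..<k1} \<union> {k1..<k1 + k2}" "{..<?m} = {..<l1} \<union> {l1..<l1 + l2}" by auto
    have m': "(\<Prod>j<?m. h j) = (\<Prod>j<l1. h j) * (\<Prod>j\<in>{l1..<l1 + l2}. h j)" for h :: point
      unfolding n by (rule prod.union_disjoint) auto
    have n': "(\<Prod>j<?n. h j) = (\<Prod>j<k1. h j) * (\<Prod>j\<in>{k1..<k1 + k2}. h j)" for h :: point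
      unfolding n by (rule prod.union_disjoint) auto
    have sh: "(\<Prod>i<k2. \<Prod>j<l2. x (k1 + i) - y (l1 + j)) = (\<Prod>i\<in>{k1..<k1 + k2}. \<Prod>j\<in>{l1..<l1 + l2}. x i - y j)"
      by (simp add: prod.atLeastLessThan_shift_0[of _ k1] prod.atLeastLessThan_shift_0[of _ l1] atLeast0LessThan add.commute)
    have "(\<Prod>i\<in>{k1..<k1 + k2}. \<Prod>j<l1. y j - x i) = (\<Prod>i\<in>{k1..<k1 + k2}. \<Prod>j<l1. - 1 * (x i - y j))"
      by simp
    also have "\<dots> = ?s * (\<Prod>i\<in>{k1..<k1 + k2}. \<Prod>j<l1. x i - y j)"
      unfolding prod.distrib by (simp add: power_mult[symmetric] mult.commute)
    finally show "leval x y (denom k1 l1 * ?D * ?B1 * ?B2) = leval x y (LC ?s * denom ?n ?m)"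
      using nz by (simp add: leval_denom sh) (simp add: m' n' prod.distrib mult_ac)
  qed
  then have D: "to_fract (denom k1 l1) * to_fract ?D * to_fract ?B1 * to_fract ?B2 = to_fract (LC ?s) * to_fract (denom ?n ?m)"
    by (simp flip: to_fract_mult)
  have s1: "LC ?s * LC ?s = 1"
    by (rule leval_eqI) (simp add: mult_single flip: power_mult_distrib single_one)
  have s2: "to_fract (LC ?s) * to_fract (LC ?s) = 1"
    unfolding to_fract_mult[symmetric] s1 by simp
  have "(\<Prod>i\<in>{..<k1}. \<Prod>j\<in>{l1..<l1 + l2}. (rx i + rconst (inverse v) * ry j) / (rx i - ry j)) = to_fract ?A1 / to_fract ?B1"
    unfolding P to_fract_prod prod_dividef[symmetric] by (simp add: rvar_def)
  moreover have "(\<Prod>i\<in>{k1..<k1 + k2}. \<Prod>j\<in>{..<l1}. (ry j + rconst (inverse v) * rx i) / (ry j - rx i)) = to_fract ?A2 / to_fract ?B2"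
    unfolding P to_fract_prod prod_dividef[symmetric] by (simp add: rvar_def)
  moreover have "ratfun_rename (\<lambda>i. k1 + i) (\<lambda>j. l1 + j) (quo k2 l2 g) = to_fract ?g / to_fract ?D"
    unfolding quo_def by (rule ratfun_rename_to_fract) (auto simp: inj_def)
  ultimately have "quo k1 l1 f * ratfun_rename (\<lambda>i. k1 + i) (\<lambda>j. l1 + j) (quo k2 l2 g) *
        (\<Prod>i\<in>{..<k1}. \<Prod>j\<in>{l1..<l1 + l2}. (rx i + rconst (inverse v) * ry j) / (rx i - ry j)) *
        (\<Prod>i\<in>{k1..<k1 + k2}. \<Prod>j\<in>{..<l1}. (ry j + rconst (inverse v) * rx i) / (ry j - rx i))
    = to_fract (shuffle_kernel k1 l1 k2 l2 f g) / (to_fract (LC ?s) * to_fract (denom ?n ?m))"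
    unfolding D[symmetric] shuffle_kernel_def by (simp add: quo_def)
  \<comment> \<open>The sign squares to 1, so it can be moved from the denominator to the
    numerator.\<close>
  also have "\<dots> = (to_fract (LC ?s) * to_fract (LC ?s)) * to_fract (shuffle_kernel k1 l1 k2 l2 f g) / (to_fract (LC ?s) * to_fract (denom ?n ?m))"
    unfolding s2 by simp
  also have "\<dots> = quo ?n ?m (LC ?s * shuffle_kernel k1 l1 k2 l2 f g)"
  proof -
    have ne: "to_fract (LC ?s) \<noteq> 0" using s2 by (metis mult_zero_right zero_neq_one)
    show ?thesis
      by (simp only: mult.assoc mult_divide_mult_cancel_left[OF ne] quo_def to_fract_mult)
  qed
  finally have "shuffle_hom v (k1, l1) (k2, l2) (quo k1 l1 f) (quo k2 l2 g) =
    quo ?n ?m (LC (1 / of_nat (fact ?n * fact ?m)) * asym_numer ?n ?m (LC ?s * shuffle_kernel k1 l1 k2 l2 f g))"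
    unfolding shuffle_hom_def prod.case by (simp only: asym_quo)
  also have "LC (1 / of_nat (fact ?n * fact ?m)) * asym_numer ?n ?m (LC ?s * shuffle_kernel k1 l1 k2 l2 f g) =
    LC (?s / of_nat (fact ?n * fact ?m)) * asym_numer ?n ?m (shuffle_kernel k1 l1 k2 l2 f g)"
    by (rule leval_eqI) (simp add: asym_numer_def sum_distrib_left sum_divide_distrib mult_ac)
  finally show ?thesis .
qed

lemma leval_asym_numer:
  "nz x \<Longrightarrow> nz y \<Longrightarrow> leval x y (asym_numer n m f) = (\<Sum>\<sigma> | \<sigma> permutes {..<n}. \<Sum>\<tau> | \<tau> permutes {..<m}.
     of_int (sign \<sigma>) * of_int (sign \<tau>) * leval (x \<circ> \<sigma>) (y \<circ> \<tau>) f)"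
  by (simp add: asym_numer_def)

lemma skew_asym_numer: "skew {..<n} {..<m} (asym_numer n m f)"
proof (rule skewI)
  fix \<rho> and x y :: point assume \<rho>: "\<rho> permutes {..<n}" and nz: "nz x" "nz y"
  have "of_int (sign \<rho>) * leval x y (asym_numer n m f) = of_int (sign \<rho>) * (\<Sum>\<sigma> | \<sigma> permutes {..<n}. \<Sum>\<tau> | \<tau> permutes {..<m}.
     of_int (sign (\<rho> \<circ> \<sigma>)) * of_int (sign \<tau>) * leval (x \<circ> (\<rho> \<circ> \<sigma>)) (y \<circ> \<tau>) f)"
    unfolding leval_asym_numer[OF nz] by (subst setum_permutations_compose_left[OF \<rho>]) (rule refl)
  also have "\<dots> = (\<Sum>\<sigma> | \<sigma> permutes {..<n}. \<Sum>\<tau> | \<tau> permutes {..<m}.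
     of_int (sign \<sigma>) * of_int (sign \<tau>) * leval (x \<circ> \<rho> \<circ> \<sigma>) (y \<circ> \<tau>) f)"
    unfolding sum_distrib_left
  proof (intro sum.cong refl)
    fix \<sigma> \<tau> assume "\<sigma> \<in> {\<sigma>. \<sigma> permutes {..<n}}"
    then have "sign (\<rho> \<circ> \<sigma>) = sign \<rho> * sign \<sigma>"
      by (intro sign_compose) (use \<rho> permutes_imp_permutation in auto)
    then show "of_int (sign \<rho>) * (of_int (sign (\<rho> \<circ> \<sigma>)) * of_int (sign \<tau>) * leval (x \<circ> (\<rho> \<circ> \<sigma>)) (y \<circ> \<tau>) f) =
      of_int (sign \<sigma>) * of_int (sign \<tau>) * leval (x \<circ> \<rho> \<circ> \<sigma>) (y \<circ> \<tau>) f"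
      by (simp add: comp_assoc flip: mult.assoc of_int_mult)
  qed
  finally show "leval (x \<circ> \<rho>) y (asym_numer n m f) = of_int (sign \<rho>) * leval x y (asym_numer n m f)"
    using nz by (simp add: leval_asym_numer)
next
  fix \<rho> and x y :: point assume \<rho>: "\<rho> permutes {..<m}" and nz: "nz x" "nz y"
  have "of_int (sign \<rho>) * leval x y (asym_numer n m f) = of_int (sign \<rho>) * (\<Sum>\<sigma> | \<sigma> permutes {..<n}. \<Sum>\<tau> | \<tau> permutes {..<m}.
     of_int (sign \<sigma>) * of_int (sign (\<rho> \<circ> \<tau>)) * leval (x \<circ> \<sigma>) (y \<circ> (\<rho> \<circ> \<tau>)) f)"
    unfolding leval_asym_numer[OF nz] by (subst setum_permutations_compose_left[OF \<rho>]) (rule refl)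
  also have "\<dots> = (\<Sum>\<sigma> | \<sigma> permutes {..<n}. \<Sum>\<tau> | \<tau> permutes {..<m}.
     of_int (sign \<sigma>) * of_int (sign \<tau>) * leval (x \<circ> \<sigma>) (y \<circ> \<rho> \<circ> \<tau>) f)"
    unfolding sum_distrib_left
  proof (intro sum.cong refl)
    fix \<sigma> \<tau> assume "\<tau> \<in> {\<tau>. \<tau> permutes {..<m}}"
    then have "sign (\<rho> \<circ> \<tau>) = sign \<rho> * sign \<tau>"
      by (intro sign_compose) (use \<rho> permutes_imp_permutation in auto)
    then show "of_int (sign \<rho>) * (of_int (sign \<sigma>) * of_int (sign (\<rho> \<circ> \<tau>)) * leval (x \<circ> \<sigma>) (y \<circ> (\<rho> \<circ> \<tau>)) f) =
      of_int (sign \<sigma>) * of_int (sign \<tau>) * leval (x \<circ> \<sigma>) (y \<circ> \<rho> \<circ> \<tau>) f"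
      by (simp add: comp_assoc mult.left_commute flip: mult.assoc of_int_mult)
  qed
  finally show "leval x (y \<circ> \<rho>) (asym_numer n m f) = of_int (sign \<rho>) * leval x y (asym_numer n m f)"
    using nz by (simp add: leval_asym_numer)
qed

lemma laurent_in_of_int [simp]: "laurent_in n m (of_int k)"
  by (metis laurent_in_const leval_eqI leval_of_int leval_simps(7))

lemma laurent_in_asym_numer:
  assumes "laurent_in n m f" shows "laurent_in n m (asym_numer n m f)"
  unfolding asym_numer_def
proof (intro laurent_in_sum laurent_in_mult laurent_in_of_int laurent_in_rename[OF assms])
  fix \<sigma> \<tau> assume "\<sigma> \<in> {\<sigma>. \<sigma> permutes {..<n}}" "\<tau> \<in> {\<tau>. \<tau> permutes {..<m}}"
  then show "rename_var \<sigma> \<tau> ` vars n m \<subseteq> vars n m"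
    using permutes_in_image[of \<sigma> "{..<n}"] permutes_in_image[of \<tau> "{..<m}"] by (auto simp: vars_def)
qed

lemma laurent_in_shuffle_kernel:
  assumes "laurent_in k1 l1 f" "laurent_in k2 l2 g"
  shows "laurent_in (k1 + k2) (l1 + l2) (shuffle_kernel k1 l1 k2 l2 f g)"
  unfolding shuffle_kernel_def
proof (intro laurent_in_mult laurent_in_prod laurent_in_diff laurent_in_single laurent_in_const)
  show "laurent_in (k1 + k2) (l1 + l2) f" by (rule laurent_in_mono[OF assms(1)]) auto
  show "laurent_in (k1 + k2) (l1 + l2) (laurent_rename (\<lambda>i. k1 + i) (\<lambda>j. l1 + j) g)"
    by (rule laurent_in_rename[OF assms(2)]) (auto simp: vars_def)
qed auto

text \<open>On a wheel, a term of the shuffle product vanishes unless all wheel variables belong to the same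
  factor: going around the wheel, one cannot pass from the first factor to the second.\<close>

lemma leval_shuffle_kernel_wheel:
  assumes f: "xwheel k1 l1 f" and g: "xwheel k2 l2 g" and nz: "nz x" "nz y"
    and \<alpha>: "inj_on \<alpha> {..<t}" "\<alpha> ` {..<t} \<subseteq> {..<k1 + k2}"
    and \<beta>: "inj_on \<beta> {..<t}" "\<beta> ` {..<t} \<subseteq> {..<l1 + l2}"
    and wh: "\<And>i. i < t \<Longrightarrow> x (\<alpha> i) = u * y (\<beta> i) \<and> y (\<beta> i) = u * x (\<alpha> (Suc i mod t))"
  shows "leval x y (shuffle_kernel k1 l1 k2 l2 f g) = 0"
proof (rule ccontr)
  assume ne: "leval x y (shuffle_kernel k1 l1 k2 l2 f g) \<noteq> 0"
  let ?sx = "x \<circ> (\<lambda>i. k1 + i)" and ?sy = "y \<circ> (\<lambda>i. l1 + i)"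
  have ne': "leval x y f \<noteq> 0" "leval ?sx ?sy g \<noteq> 0"
    "\<And>i j. i < k1 \<Longrightarrow> l1 \<le> j \<Longrightarrow> j < l1 + l2 \<Longrightarrow> x i \<noteq> u * y j"
    "\<And>i j. k1 \<le> i \<Longrightarrow> i < k1 + k2 \<Longrightarrow> j < l1 \<Longrightarrow> y j \<noteq> u * x i"
    using ne nz by (simp_all add: shuffle_kernel_def)
  have next_lt: "Suc i mod t < t" for i using t_pos by simp
  have \<alpha>r: "\<alpha> i < k1 + k2" if "i < t" for i using \<alpha>(2) that by auto
  have \<beta>r: "\<beta> i < l1 + l2" if "i < t" for i using \<beta>(2) that by auto
  have xy: "\<beta> i < l1" if "i < t" "\<alpha> i < k1" for i
    using ne'(3)[OF that(2), of "\<beta> i"] \<beta>r[OF that(1)] wh[OF that(1)] by fastforce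
  have yx: "\<alpha> (Suc i mod t) < k1" if "i < t" "\<beta> i < l1" for i
    using ne'(4)[of "\<alpha> (Suc i mod t)" "\<beta> i"] \<alpha>r[OF next_lt] wh[OF that(1)] that(2) by fastforce
  show False
  proof (cases "\<exists>i<t. \<alpha> i < k1")
    case True
    then obtain i0 where i0: "i0 < t" "\<alpha> i0 < k1" by auto
    \<comment> \<open>By \<open>xy\<close> and \<open>yx\<close> each step around the wheel stays in
      the first operand, so a single index there forces all of them.\<close>
    have all: "\<alpha> ((i0 + j) mod t) < k1" for j
    proof (induction j)
      case 0
      then show ?case using i0 by simp
    next
      case (Suc j)
      have "(i0 + j) mod t < t" using t_pos by simp
      from yx[OF this xy[OF this Suc]] show ?case by (simp add: mod_Suc_eq)
    qed
    have a: "\<alpha> i < k1" if "i < t" for i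
      using all[of "i + t - i0"] that i0(1) by simp
    have "leval x y f = 0"
    proof (rule xwheelD[OF f nz \<alpha>(1) _ \<beta>(1)])
      show "\<alpha> ` {..<t} \<subseteq> {..<k1}" "\<beta> ` {..<t} \<subseteq> {..<l1}" using a xy by blast+
    qed (rule wh)
    then show False using ne'(1) by simp
  next
    case False
    then have a: "k1 \<le> \<alpha> i" if "i < t" for i using that by force
    \<comment> \<open>A wheel \<open>y\<close> in the first operand would force the next
      \<open>x\<close> into it.\<close>
    have b: "l1 \<le> \<beta> i" if "i < t" for i using yx[OF that] a[OF next_lt, of i] by (meson not_le)
    have "leval ?sx ?sy g = 0"
    proof (rule xwheelD[OF g, where \<alpha> = "\<lambda>i. \<alpha> i - k1" and \<beta> = "\<lambda>i. \<beta> i - l1"])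
      show "inj_on (\<lambda>i. \<alpha> i - k1) {..<t}"
        using \<alpha>(1) a unfolding inj_on_def by (metis lessThan_iff le_add_diff_inverse)
      show "inj_on (\<lambda>i. \<beta> i - l1) {..<t}"
        using \<beta>(1) b unfolding inj_on_def by (metis lessThan_iff le_add_diff_inverse)
      show "(\<lambda>i. \<alpha> i - k1) ` {..<t} \<subseteq> {..<k2}" using \<alpha>r a by force
      show "(\<lambda>i. \<beta> i - l1) ` {..<t} \<subseteq> {..<l2}" using \<beta>r b by force
      show "nz ?sx" "nz ?sy" using nz by simp_all
      fix i assume i: "i < t"
      have "k1 + (\<alpha> i - k1) = \<alpha> i" "k1 + (\<alpha> (Suc i mod t) - k1) = \<alpha> (Suc i mod t)" "l1 + (\<beta> i - l1) = \<beta> i"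
        using a[OF i] a[OF next_lt, of i] b[OF i] by simp_all
      then show "?sx (\<alpha> i - k1) = u * ?sy (\<beta> i - l1) \<and> ?sy (\<beta> i - l1) = u * ?sx (\<alpha> (Suc i mod t) - k1)"
        using wh[OF i] by (simp only: comp_apply)
    qed
    then show False using ne'(2) by simp
  qed
qed

text \<open>The summand for \<open>\<sigma>\<close> and \<open>\<tau>\<close> is the kernel at
  permuted arguments, where the wheel occupies the indices
  \<open>inv \<sigma> \<circ> \<alpha>\<close> and
  \<open>inv \<tau> \<circ> \<beta>\<close>.\<close>

lemma wheel_numer_shuffle:
  assumes f: "wheel_numer k1 l1 f" and g: "wheel_numer k2 l2 g"
  shows "wheel_numer (k1 + k2) (l1 + l2) (asym_numer (k1 + k2) (l1 + l2) (shuffle_kernel k1 l1 k2 l2 f g))"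
proof -
  have "xwheel (k1 + k2) (l1 + l2) (asym_numer (k1 + k2) (l1 + l2) (shuffle_kernel k1 l1 k2 l2 f g))"
    unfolding xwheel_def
  proof (intro allI impI)
    fix x y assume "on_wheel (k1 + k2) (l1 + l2) x y"
    then obtain \<alpha> \<beta> where nz: "nz x" "nz y" and \<alpha>: "inj_on \<alpha> {..<t}" "\<alpha> ` {..<t} \<subseteq> {..<k1 + k2}"
      and \<beta>: "inj_on \<beta> {..<t}" "\<beta> ` {..<t} \<subseteq> {..<l1 + l2}"
      and wh: "\<And>i. i < t \<Longrightarrow> x (\<alpha> i) = u * y (\<beta> i) \<and> y (\<beta> i) = u * x (\<alpha> (Suc i mod t))"
      by (erule on_wheelE)
    have "leval (x \<circ> \<sigma>) (y \<circ> \<tau>) (shuffle_kernel k1 l1 k2 l2 f g) = 0"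
      if \<sigma>: "\<sigma> permutes {..<k1 + k2}" and \<tau>: "\<tau> permutes {..<l1 + l2}" for \<sigma> \<tau>
    proof (rule leval_shuffle_kernel_wheel)
      show "inj_on (inv \<sigma> \<circ> \<alpha>) {..<t}" "inj_on (inv \<tau> \<circ> \<beta>) {..<t}"
        using \<alpha>(1) \<beta>(1) permutes_inj[OF permutes_inv[OF \<sigma>]] permutes_inj[OF permutes_inv[OF \<tau>]]
        by (auto intro!: comp_inj_on intro: inj_on_subset)
      show "(inv \<sigma> \<circ> \<alpha>) ` {..<t} \<subseteq> {..<k1 + k2}" "(inv \<tau> \<circ> \<beta>) ` {..<t} \<subseteq> {..<l1 + l2}"
        using \<alpha>(2) \<beta>(2) permutes_in_image[OF permutes_inv[OF \<sigma>]] permutes_in_image[OF permutes_inv[OF \<tau>]]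
        by (auto simp: image_subset_iff)
      show "xwheel k1 l1 f" "xwheel k2 l2 g" using f g by (simp_all add: wheel_numer_def)
      show "nz (x \<circ> \<sigma>)" "nz (y \<circ> \<tau>)" using nz by simp_all
      fix i assume "i < t"
      then show "(x \<circ> \<sigma>) ((inv \<sigma> \<circ> \<alpha>) i) = u * (y \<circ> \<tau>) ((inv \<tau> \<circ> \<beta>) i) \<and>
          (y \<circ> \<tau>) ((inv \<tau> \<circ> \<beta>) i) = u * (x \<circ> \<sigma>) ((inv \<sigma> \<circ> \<alpha>) (Suc i mod t))"
        using wh by (simp only: comp_apply permutes_inverses(1)[OF \<sigma>] permutes_inverses(1)[OF \<tau>])
    qed
    then show "leval x y (asym_numer (k1 + k2) (l1 + l2) (shuffle_kernel k1 l1 k2 l2 f g)) = 0"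
      using nz by (simp add: leval_asym_numer)
  qed
  then show ?thesis
    using f g by (simp add: wheel_numer_def skew_asym_numer laurent_in_asym_numer laurent_in_shuffle_kernel)
qed

section \<open>The generated subalgebra satisfies the wheel condition\<close>

definition wheel_algebra :: "(nat \<times> nat \<Rightarrow>\<^sub>0 ratfun) set" where
  "wheel_algebra = {F. \<forall>n m. \<exists>f. wheel_numer n m f \<and> lookup F (n, m) = quo n m f}"

lemma wheel_algebra_single: "wheel_numer n m f \<Longrightarrow> single (n, m) (quo n m f) \<in> wheel_algebra"
  unfolding wheel_algebra_def by (auto simp: lookup_single when_def intro: exI[of _ 0])

lemma wheel_algebra_0: "0 \<in> wheel_algebra"
  unfolding wheel_algebra_def by (auto intro: exI[of _ 0])

lemma wheel_algebra_add:
  assumes "F \<in> wheel_algebra" "G \<in> wheel_algebra" shows "F + G \<in> wheel_algebra"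
  unfolding wheel_algebra_def
proof (intro CollectI allI)
  fix n m
  obtain f g where "wheel_numer n m f" "lookup F (n, m) = quo n m f"
    "wheel_numer n m g" "lookup G (n, m) = quo n m g"
    using assms unfolding wheel_algebra_def by blast
  then show "\<exists>f. wheel_numer n m f \<and> lookup (F + G) (n, m) = quo n m f"
    by (intro exI[of _ "f + g"]) (simp add: wheel_numer_add lookup_add quo_add)
qed

lemma wheel_algebra_sum: "(\<And>a. a \<in> A \<Longrightarrow> F a \<in> wheel_algebra) \<Longrightarrow> sum F A \<in> wheel_algebra"
  by (induction A rule: infinite_finite_induct) (auto simp: wheel_algebra_0 wheel_algebra_add)

text \<open>The unit and the generators have no bidegree with variables of both kinds, whereas a
  wheel needs both since \<open>t \<ge> 1\<close>; so the condition is empty for them, and the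
  operations preserve it.\<close>

lemma Lambda_zeta_subset_wheel_algebra: "Lambda_zeta v \<subseteq> wheel_algebra"
proof
  fix F assume "F \<in> Lambda_zeta v"
  then show "F \<in> wheel_algebra"
    unfolding Lambda_zeta_def
  proof (induction rule: generated_subalgebra.induct)
    case one
    have "wheel_numer 0 0 1" by (rule wheel_numer_short) (auto simp: skew_def sign_id)
    moreover have "quo 0 0 1 = 1" by (simp add: quo_def denom_def)
    ultimately show ?case using wheel_algebra_single[of 0 0 1] by (simp add: shuffle_one_def)
  next
    case (gen F)
    show ?case
      unfolding wheel_algebra_def
    proof (intro CollectI allI)
      fix n m
      obtain f where f: "laurent_in n m f" "skew {..<n} {..<m} f" "lookup F (n, m) = quo n m f"
        using gen unfolding shuffle_algebra_def shuffle_component_iff by blast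
      show "\<exists>f. wheel_numer n m f \<and> lookup F (n, m) = quo n m f"
      proof (cases "(n, m) \<in> keys F")
        case True
        then have "n = 0 \<or> m = 0" using gen by auto
        then show ?thesis using f wheel_numer_short by blast
      next
        case False
        then show ?thesis by (intro exI[of _ 0]) (simp add: in_keys_iff)
      qed
    qed
  next
    case (add F G)
    then show ?case by (simp add: wheel_algebra_add)
  next
    case (scale F c)
    show ?case
      unfolding wheel_algebra_def
    proof (intro CollectI allI)
      fix n m
      obtain f where "wheel_numer n m f" "lookup F (n, m) = quo n m f"
        using scale.IH unfolding wheel_algebra_def by blast
      then show "\<exists>f. wheel_numer n m f \<and> lookup (shuffle_scale c F) (n, m) = quo n m f"
        by (intro exI[of _ "LC c * f"]) (simp add: wheel_numer_LC_mult quo_LC_mult shuffle_scale_def map.rep_eq when_def)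
    qed
  next
    case (mult F G)
    show ?case
      unfolding shuffle_mult_def
    proof (intro wheel_algebra_sum)
      fix p q :: "nat \<times> nat"
      obtain k1 l1 k2 l2 where pq: "p = (k1, l1)" "q = (k2, l2)" by (cases p; cases q)
      obtain f g where fg: "wheel_numer k1 l1 f" "lookup F (k1, l1) = quo k1 l1 f"
        "wheel_numer k2 l2 g" "lookup G (k2, l2) = quo k2 l2 g"
        using mult.IH unfolding wheel_algebra_def by blast
      show "single (fst p + fst q, snd p + snd q)
          (shuffle_hom v p q (lookup F p) (lookup G q)) \<in> wheel_algebra"
        unfolding pq fg fst_conv snd_conv shuffle_hom_quo
        by (intro wheel_algebra_single wheel_numer_LC_mult wheel_numer_shuffle fg)
    qed
  qed
qed

section \<open>Numerators of the generated subalgebra\<close>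

definition lz_numer :: "nat \<Rightarrow> nat \<Rightarrow> laurent \<Rightarrow> bool" where
  "lz_numer n m f \<longleftrightarrow> laurent_in n m f \<and> single (n, m) (quo n m f) \<in> Lambda_zeta v"

lemma lz_numer_imp_wheel_numer: assumes "lz_numer n m f" shows "wheel_numer n m f"
proof -
  have "single (n, m) (quo n m f) \<in> wheel_algebra"
    using assms Lambda_zeta_subset_wheel_algebra by (auto simp: lz_numer_def)
  then obtain g where "wheel_numer n m g" "lookup (single (n, m) (quo n m f)) (n, m) = quo n m g"
    unfolding wheel_algebra_def by blast
  then show ?thesis by simp
qed

lemma Lambda_zeta_0: "0 \<in> Lambda_zeta v"
proof -
  have "shuffle_scale 0 shuffle_one \<in> Lambda_zeta v"
    unfolding Lambda_zeta_def by (intro generated_subalgebra.scale generated_subalgebra.one)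
  moreover have "shuffle_scale 0 shuffle_one = 0"
    by (rule poly_mapping_eqI) (simp add: shuffle_scale_def map.rep_eq when_def rconst_def)
  ultimately show ?thesis by simp
qed

lemma Lambda_zeta_add: "F \<in> Lambda_zeta v \<Longrightarrow> G \<in> Lambda_zeta v \<Longrightarrow> F + G \<in> Lambda_zeta v"
  unfolding Lambda_zeta_def by (rule generated_subalgebra.add)

lemma Lambda_zeta_sum: "(\<And>a. a \<in> A \<Longrightarrow> F a \<in> Lambda_zeta v) \<Longrightarrow> sum F A \<in> Lambda_zeta v"
  by (induction A rule: infinite_finite_induct) (auto simp: Lambda_zeta_0 Lambda_zeta_add)

lemma lz_numer_0: "lz_numer n m 0"
  by (simp add: lz_numer_def Lambda_zeta_0)

lemma lz_numer_add: "lz_numer n m f \<Longrightarrow> lz_numer n m g \<Longrightarrow> lz_numer n m (f + g)"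
  unfolding lz_numer_def by (simp add: quo_add single_add Lambda_zeta_def generated_subalgebra.add)

lemma lz_numer_LC_mult: assumes "lz_numer n m f" shows "lz_numer n m (LC c * f)"
proof -
  have e: "shuffle_scale c (single (n, m) (quo n m f)) = single (n, m) (quo n m (LC c * f))"
    by (rule poly_mapping_eqI) (auto simp: shuffle_scale_def map.rep_eq when_def lookup_single quo_LC_mult)
  have "shuffle_scale c (single (n, m) (quo n m f)) \<in> Lambda_zeta v"
    using assms unfolding lz_numer_def Lambda_zeta_def by (intro generated_subalgebra.scale) simp
  then show ?thesis using assms by (simp add: lz_numer_def e)
qed

lemma lz_numer_diff: "lz_numer n m f \<Longrightarrow> lz_numer n m g \<Longrightarrow> lz_numer n m (f - g)"
proof -
  assume "lz_numer n m f" "lz_numer n m g"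
  then have "lz_numer n m (f + LC (-1) * g)" by (intro lz_numer_add lz_numer_LC_mult)
  moreover have "f + LC (-1) * g = f - g" by (rule leval_eqI) simp
  ultimately show ?thesis by simp
qed

lemma lz_numer_sum: "(\<And>a. a \<in> A \<Longrightarrow> lz_numer n m (F a)) \<Longrightarrow> lz_numer n m (sum F A)"
  by (induction A rule: infinite_finite_induct) (auto simp: lz_numer_0 lz_numer_add)

lemma lz_numer_1: "lz_numer 0 0 1"
proof -
  have "quo 0 0 1 = 1" by (simp add: quo_def denom_def)
  then show ?thesis unfolding lz_numer_def Lambda_zeta_def
    using generated_subalgebra.one by (simp add: shuffle_one_def)
qed

lemma lz_numer_gen:
  assumes "laurent_in n m g" "skew {..<n} {..<m} g" "(n, m) = (1, 0) \<or> (n, m) = (0, 1)"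
  shows "lz_numer n m g"
proof -
  have "single (n, m) (quo n m g) \<in> shuffle_algebra"
    unfolding shuffle_algebra_def
  proof (intro CollectI allI)
    fix n' m'
    show "lookup (single (n, m) (quo n m g)) (n', m') \<in> shuffle_component n' m'"
      unfolding shuffle_component_iff using assms(1,2)
      by (auto simp: lookup_single when_def intro: exI[of _ 0])
  qed
  moreover have "keys (single (n, m) (quo n m g)) \<subseteq> {(1, 0), (0, 1)}"
    using assms(3) by (auto split: if_splits)
  ultimately show ?thesis using assms(1) unfolding lz_numer_def Lambda_zeta_def
    by (intro conjI generated_subalgebra.gen CollectI)
qed

lemma lz_numer_shuffle:
  assumes f: "lz_numer k1 l1 f" and g: "lz_numer k2 l2 g"
  shows "lz_numer (k1 + k2) (l1 + l2) (asym_numer (k1 + k2) (l1 + l2) (shuffle_kernel k1 l1 k2 l2 f g))"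
\<comment> \<open>\<open>shuffle_mult\<close> sums over \<open>keys\<close>, and \<open>keys\<close>
  of a \<open>single\<close> with value 0 is empty, so zero operands are treated apart.\<close>
proof (cases "f = 0 \<or> g = 0")
  case True
  then have "asym_numer (k1 + k2) (l1 + l2) (shuffle_kernel k1 l1 k2 l2 f g) = 0"
    by (intro leval_eqI) (auto simp: leval_asym_numer shuffle_kernel_def)
  then show ?thesis by (simp add: lz_numer_0)
next
  case False
  define c :: complex where "c = (-1) ^ (k2 * l1) / of_nat (fact (k1 + k2) * fact (l1 + l2))"
  define N where "N = asym_numer (k1 + k2) (l1 + l2) (shuffle_kernel k1 l1 k2 l2 f g)"
  have c: "c \<noteq> 0" by (simp add: c_def)
  have "shuffle_mult v (single (k1, l1) (quo k1 l1 f)) (single (k2, l2) (quo k2 l2 g)) \<in> Lambda_zeta v"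
    using f g unfolding lz_numer_def Lambda_zeta_def by (blast intro: generated_subalgebra.mult)
  moreover have "shuffle_mult v (single (k1, l1) (quo k1 l1 f)) (single (k2, l2) (quo k2 l2 g)) =
    single (k1 + k2, l1 + l2) (quo (k1 + k2) (l1 + l2) (LC c * N))"
    using False unfolding shuffle_mult_def by (simp add: shuffle_hom_quo c_def N_def)
  moreover have "laurent_in (k1 + k2) (l1 + l2) N"
    using f g by (simp add: N_def lz_numer_def laurent_in_asym_numer laurent_in_shuffle_kernel)
  ultimately have "lz_numer (k1 + k2) (l1 + l2) (LC c * N)" by (simp add: lz_numer_def)
  then have "lz_numer (k1 + k2) (l1 + l2) (LC (1 / c) * (LC c * N))" by (rule lz_numer_LC_mult)
  moreover have "LC (1 / c) * (LC c * N) = N" by (rule leval_eqI) (simp add: c)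
  ultimately show ?thesis by (simp only: N_def)
qed

section \<open>Right multiplication by one-variable elements\<close>

definition mul_x :: "nat \<Rightarrow> nat \<Rightarrow> int \<Rightarrow> laurent \<Rightarrow> laurent" where
  "mul_x n m a f = (\<Sum>b\<le>n. of_int (sign (transpose n b)) * laurent_rename (transpose n b) id
     (single (single (X n) a) 1 * (\<Prod>j<m. LV (Y j) - LC u * LV (X n)) * f))"

definition mul_y :: "nat \<Rightarrow> nat \<Rightarrow> int \<Rightarrow> laurent \<Rightarrow> laurent" where
  "mul_y n m a f = (\<Sum>b\<le>m. of_int (sign (transpose m b)) * laurent_rename id (transpose m b)
     (single (single (Y m) a) 1 * (\<Prod>i<n. LV (X i) - LC u * LV (Y m)) * f))"

lemma leval_mul_x:
  assumes "nz x" "nz y"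
  shows "leval x y (mul_x n m a f) = (\<Sum>b\<le>n. of_int (sign (transpose n b)) *
    (x b powi a * (\<Prod>j<m. y j - u * x b) * leval (x \<circ> transpose n b) y f))"
  using assms by (simp add: mul_x_def)

lemma leval_mul_y:
  assumes "nz x" "nz y"
  shows "leval x y (mul_y n m a f) = (\<Sum>b\<le>m. of_int (sign (transpose m b)) *
    (y b powi a * (\<Prod>i<n. x i - u * y b) * leval x (y \<circ> transpose m b) f))"
  using assms by (simp add: mul_y_def)

text \<open>This is the product with the power \<open>a\<close> of one variable \<open>x\<close> on
  the right. As \<open>f\<close> is skew, the antisymmetrisation over all permutations is
  \<open>fact n * fact m\<close> times the sum over the \<open>n + 1\<close> coset representatives
  in \<open>mul_x\<close>.\<close>

lemma lz_numer_mul_x: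
  assumes f: "lz_numer n m f" shows "lz_numer (Suc n) m (mul_x n m a f)"
proof -
  define g where "g = (single (single (X 0) a) 1 :: laurent)"
  have fs: "skew {..<n} {..<m} f" using lz_numer_imp_wheel_numer[OF f] by (simp add: wheel_numer_def)
  have "lz_numer 1 0 g"
    by (rule lz_numer_gen) (auto simp: g_def skew_def sign_id lessThan_Suc)
  from lz_numer_shuffle[OF f this]
  have "lz_numer (Suc n) m (asym_numer (Suc n) m (shuffle_kernel n m 1 0 f g))" by simp
  then have "lz_numer (Suc n) m (LC (1 / (fact n * fact m)) * asym_numer (Suc n) m (shuffle_kernel n m 1 0 f g))"
    by (rule lz_numer_LC_mult)
  moreover have "LC (1 / (fact n * fact m)) * asym_numer (Suc n) m (shuffle_kernel n m 1 0 f g) = mul_x n m a f"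
  proof (rule leval_eqI)
    fix x y :: point assume nz: "nz x" "nz y"
    define \<Phi> where "\<Phi> = (\<lambda>x. x n powi a * (\<Prod>j<m. y j - u * x n) * leval x y f)"
    have \<Phi>: "\<Phi> (x \<circ> \<sigma>) = of_int (sign \<sigma>) * \<Phi> x" if \<sigma>: "\<sigma> permutes {..<n}" and "nz x" for \<sigma> x
    proof -
      have "\<sigma> n = n" using \<sigma> by (simp add: permutes_def)
      then show ?thesis using skewX[OF fs \<sigma> \<open>nz x\<close> nz(2)] by (simp add: \<Phi>_def)
    qed
    have K: "leval (x \<circ> \<sigma>) (y \<circ> \<tau>) (shuffle_kernel n m 1 0 f g) = of_int (sign \<tau>) * \<Phi> (x \<circ> \<sigma>)"
      if \<tau>: "\<tau> permutes {..<m}" for \<sigma> \<tau>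
    proof -
      have "(\<Prod>j<m. y (\<tau> j) - u * x (\<sigma> n)) = (\<Prod>j<m. y j - u * x (\<sigma> n))"
        using prod.permute[OF \<tau>, of "\<lambda>j. y j - u * x (\<sigma> n)"] by (simp add: comp_def)
      then show ?thesis using nz skewY[OF fs \<tau>, of "x \<circ> \<sigma>" y]
        by (simp add: shuffle_kernel_def g_def \<Phi>_def)
    qed
    have "leval x y (asym_numer (Suc n) m (shuffle_kernel n m 1 0 f g)) =
      (\<Sum>\<sigma> | \<sigma> permutes {..<Suc n}. \<Sum>\<tau> | \<tau> permutes {..<m}. of_int (sign \<sigma>) * \<Phi> (x \<circ> \<sigma>))"
      unfolding leval_asym_numer[OF nz]
    proof (intro sum.cong refl)
      fix \<sigma> \<tau> assume "\<tau> \<in> {\<tau>. \<tau> permutes {..<m}}"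
      then show "of_int (sign \<sigma>) * of_int (sign \<tau>) * leval (x \<circ> \<sigma>) (y \<circ> \<tau>) (shuffle_kernel n m 1 0 f g) = of_int (sign \<sigma>) * \<Phi> (x \<circ> \<sigma>)"
        using K[of \<tau> \<sigma>] by (simp add: sign_def)
    qed
    also have "\<dots> = fact m * (\<Sum>\<sigma> | \<sigma> permutes {..<Suc n}. of_int (sign \<sigma>) * \<Phi> (x \<circ> \<sigma>))"
      by (simp add: card_permutations sum_distrib_left)
    also have "\<dots> = fact m * (fact n * (\<Sum>b\<le>n. of_int (sign (transpose n b)) * \<Phi> (x \<circ> transpose n b)))"
      using antisym_cosets[of n \<Phi> x, OF \<Phi> nz(1)] by simp
    finally show "leval x y (LC (1 / (fact n * fact m)) * asym_numer (Suc n) m (shuffle_kernel n m 1 0 f g)) = leval x y (mul_x n m a f)"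
      using nz by (simp add: leval_mul_x \<Phi>_def)
  qed
  ultimately show ?thesis by simp
qed

lemma lz_numer_mul_y:
  assumes f: "lz_numer n m f" shows "lz_numer n (Suc m) (mul_y n m a f)"
proof -
  define g where "g = (single (single (Y 0) a) 1 :: laurent)"
  have fs: "skew {..<n} {..<m} f" using lz_numer_imp_wheel_numer[OF f] by (simp add: wheel_numer_def)
  have "lz_numer 0 1 g"
    by (rule lz_numer_gen) (auto simp: g_def skew_def sign_id lessThan_Suc)
  from lz_numer_shuffle[OF f this]
  have "lz_numer n (Suc m) (asym_numer n (Suc m) (shuffle_kernel n m 0 1 f g))" by simp
  then have "lz_numer n (Suc m) (LC (1 / (fact n * fact m)) * asym_numer n (Suc m) (shuffle_kernel n m 0 1 f g))"
    by (rule lz_numer_LC_mult)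
  moreover have "LC (1 / (fact n * fact m)) * asym_numer n (Suc m) (shuffle_kernel n m 0 1 f g) = mul_y n m a f"
  proof (rule leval_eqI)
    fix x y :: point assume nz: "nz x" "nz y"
    define \<Phi> where "\<Phi> = (\<lambda>y. y m powi a * (\<Prod>i<n. x i - u * y m) * leval x y f)"
    have \<Phi>: "\<Phi> (y \<circ> \<tau>) = of_int (sign \<tau>) * \<Phi> y" if \<tau>: "\<tau> permutes {..<m}" and "nz y" for \<tau> y
    proof -
      have "\<tau> m = m" using \<tau> by (simp add: permutes_def)
      then show ?thesis using skewY[OF fs \<tau> nz(1) \<open>nz y\<close>] by (simp add: \<Phi>_def)
    qed
    have K: "leval (x \<circ> \<sigma>) (y \<circ> \<tau>) (shuffle_kernel n m 0 1 f g) = of_int (sign \<sigma>) * \<Phi> (y \<circ> \<tau>)"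
      if \<sigma>: "\<sigma> permutes {..<n}" for \<sigma> \<tau>
    proof -
      have "(\<Prod>i<n. x (\<sigma> i) - u * y (\<tau> m)) = (\<Prod>i<n. x i - u * y (\<tau> m))"
        using prod.permute[OF \<sigma>, of "\<lambda>i. x i - u * y (\<tau> m)"] by (simp add: comp_def)
      then show ?thesis using nz skewX[OF fs \<sigma>, of x "y \<circ> \<tau>"]
        by (simp add: shuffle_kernel_def g_def \<Phi>_def)
    qed
    have "leval x y (asym_numer n (Suc m) (shuffle_kernel n m 0 1 f g)) =
      (\<Sum>\<sigma> | \<sigma> permutes {..<n}. \<Sum>\<tau> | \<tau> permutes {..<Suc m}. of_int (sign \<tau>) * \<Phi> (y \<circ> \<tau>))"
      unfolding leval_asym_numer[OF nz]
    proof (intro sum.cong refl)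
      fix \<sigma> \<tau> assume "\<sigma> \<in> {\<sigma>. \<sigma> permutes {..<n}}"
      then show "of_int (sign \<sigma>) * of_int (sign \<tau>) * leval (x \<circ> \<sigma>) (y \<circ> \<tau>) (shuffle_kernel n m 0 1 f g) = of_int (sign \<tau>) * \<Phi> (y \<circ> \<tau>)"
        using K[of \<sigma> \<tau>] by (simp add: sign_def)
    qed
    also have "\<dots> = fact n * (\<Sum>\<tau> | \<tau> permutes {..<Suc m}. of_int (sign \<tau>) * \<Phi> (y \<circ> \<tau>))"
      by (simp add: card_permutations)
    also have "\<dots> = fact n * (fact m * (\<Sum>b\<le>m. of_int (sign (transpose m b)) * \<Phi> (y \<circ> transpose m b)))"
      using antisym_cosets[of m \<Phi> y, OF \<Phi> nz(2)] by simp
    finally show "leval x y (LC (1 / (fact n * fact m)) * asym_numer n (Suc m) (shuffle_kernel n m 0 1 f g)) = leval x y (mul_y n m a f)"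
      using nz by (simp add: leval_mul_y \<Phi>_def)
  qed
  ultimately show ?thesis by simp
qed

section \<open>Building elements with prescribed specialisations\<close>

lemma sign_sq: "of_int (sign p) * (of_int (sign p) * c) = (c :: complex)"
  by (simp add: sign_def)

text \<open>Without \<open>y\<close> the kernel of \<open>mul_x\<close> is empty. Multiplying every
  coefficient of \<open>p\<close> in its last variable by the corresponding power reproduces
  \<open>p\<close> once for each of the \<open>r + 1\<close> coset representatives, by
  skewness.\<close>

lemma lz_numer_skew_X:
  assumes "laurent_in r 0 p" "skew {..<r} {} p"
  shows "lz_numer r 0 p"
  using assms
proof (induction r arbitrary: p)
  case 0
  have "p = LC (lookup p 0) * 1"
  proof (rule poly_mapping_eqI)
    fix \<mu>
    show "lookup p \<mu> = lookup (LC (lookup p 0) * 1) \<mu>"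
    proof (cases "\<mu> \<in> keys p")
      case True
      then have "keys \<mu> = {}" using 0 by (auto simp: laurent_in_vars vars_def)
      then show ?thesis by simp
    next
      case False
      then show ?thesis by (auto simp: in_keys_iff lookup_single when_def)
    qed
  qed
  then show ?case using lz_numer_LC_mult[OF lz_numer_1] by metis
next
  case (Suc r)
  define D where "D = (\<lambda>\<mu>. lookup \<mu> (X r)) ` keys p"
  define W where "W = (\<Sum>a\<in>D. mul_x r 0 a (vcoeff (X r) a p))"
  have "lz_numer r 0 (vcoeff (X r) a p)" for a
    by (intro Suc.IH laurent_in_vcoeff_X Suc.prems(1) skew_vcoeff_X[OF Suc.prems(2)]) auto
  then have "lz_numer (Suc r) 0 W" unfolding W_def by (intro lz_numer_sum lz_numer_mul_x)
  then have "lz_numer (Suc r) 0 (LC (1 / of_nat (Suc r)) * W)" by (rule lz_numer_LC_mult)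
  moreover have "LC (1 / of_nat (Suc r)) * W = p"
  proof (rule leval_eqI)
    fix x y :: point assume nz: "nz x" "nz y"
    have exp: "(\<Sum>a\<in>D. x b powi a * leval (x \<circ> transpose r b) y (vcoeff (X r) a p)) = leval (x \<circ> transpose r b) y p" for b
      using ev_vcoeff_expand[of "case_var (x \<circ> transpose r b) y" D "X r" p] nz
      by (simp add: D_def laurent_eval_ev)
    have "leval x y W = (\<Sum>a\<in>D. \<Sum>b\<le>r. of_int (sign (transpose r b)) * (x b powi a * leval (x \<circ> transpose r b) y (vcoeff (X r) a p)))"
      using nz by (simp add: W_def leval_mul_x)
    also have "\<dots> = (\<Sum>b\<le>r. of_int (sign (transpose r b)) * (\<Sum>a\<in>D. x b powi a * leval (x \<circ> transpose r b) y (vcoeff (X r) a p)))"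
      by (subst sum.swap) (simp add: sum_distrib_left)
    also have "\<dots> = (\<Sum>b\<le>r. leval x y p)"
    proof (intro sum.cong refl)
      fix b assume "b \<in> {..r}"
      then have "transpose r b permutes {..<Suc r}" by (intro permutes_swap_id) auto
      from skewX[OF Suc.prems(2) this nz]
      show "of_int (sign (transpose r b)) * (\<Sum>a\<in>D. x b powi a * leval (x \<circ> transpose r b) y (vcoeff (X r) a p)) = leval x y p"
        unfolding exp by (simp add: sign_sq)
    qed
    finally show "leval x y (LC (1 / of_nat (Suc r)) * W) = leval x y p" using nz by (simp del: of_nat_Suc)
  qed
  ultimately show ?case by simp
qed

definition aligned :: "nat \<Rightarrow> nat \<Rightarrow> point \<Rightarrow> point \<Rightarrow> bool" where
  "aligned r k x y \<longleftrightarrow> (\<forall>l<k. x (r + l) = u * y l)"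

text \<open>The linear forms that divide the restriction of \<open>f\<close> to matched pairs
  \<open>x (r + l) = u * y l\<close>. The restriction is symmetric in the matched variables, since a
  swap also swaps the partners, so it contains their Vandermonde product twice. One copy is left to
  the cofactor \<open>h\<close>, which is therefore skew.\<close>

definition prefactor :: "nat \<Rightarrow> nat \<Rightarrow> nat \<Rightarrow> point \<Rightarrow> point \<Rightarrow> complex" where
  "prefactor r k s x y = vandermonde k y * (\<Prod>i<r. \<Prod>j<k + s. x i - u * y j) * (\<Prod>j\<in>{k..<k + s}. \<Prod>i<k. y j - y i)"

definition realized :: "nat \<Rightarrow> nat \<Rightarrow> laurent \<Rightarrow> bool" where
  "realized r k h \<longleftrightarrow> (\<exists>W. lz_numer (r + k) k W \<and>
     (\<forall>x y. nz x \<longrightarrow> nz y \<longrightarrow> aligned r k x y \<longrightarrow> leval x y W = prefactor r k 0 x y * leval x y h))"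

lemma prod_split_add: "(\<Prod>i<r + k. h i) = (\<Prod>i<r. h i) * (\<Prod>i<k. h (r + i))" for h :: point
  by (induction k) (simp_all add: mult.assoc)

lemma prod_atMost_remove: "l \<le> k \<Longrightarrow> (\<Prod>j<Suc k. h j) = h l * (\<Prod>j\<in>{..k} - {l}. h j)" for h :: point
  unfolding lessThan_Suc_atMost by (rule prod.remove) auto

text \<open>If the variable removed by \<open>mul_x\<close> is not the partner \<open>x (r + l)\<close> of the variable \<open>y l\<close> removed by
  \<open>mul_y\<close>, the summand contains the factor \<open>x (r + l) - u * y l = 0\<close>.\<close>

lemma leval_mul_x_mul_y_aligned:
  assumes nz: "nz x" "nz y" and al: "aligned r (Suc k) x y"
  shows "leval x y (mul_x (r + k) (Suc k) 0 (mul_y (r + k) k a W)) =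
    (\<Sum>l\<le>k. (\<Prod>j<Suc k. y j - u * (u * y l)) * y l powi a *
      (\<Prod>i<r + k. (x \<circ> transpose (r + k) (r + l)) i - u * y l) * leval (x \<circ> transpose (r + k) (r + l)) (y \<circ> transpose k l) W)"
proof -
  define G where "G = (\<lambda>p l. of_int (sign (transpose (r + k) p)) * (\<Prod>j<Suc k. y j - u * x p) *
     (of_int (sign (transpose k l)) * (y l powi a * (\<Prod>i<r + k. (x \<circ> transpose (r + k) p) i - u * y l) *
       leval (x \<circ> transpose (r + k) p) (y \<circ> transpose k l) W)))"
  have zero: "G p l = 0" if "p \<le> r + k" "l \<le> k" "p \<noteq> r + l" for p l
  proof -
    define i where "i = transpose (r + k) p (r + l)"
    have "i < r + k" using that by (auto simp: i_def transpose_def)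
    moreover have "(x \<circ> transpose (r + k) p) i - u * y l = 0"
      using al that(2) by (simp add: i_def aligned_def less_Suc_eq_le)
    ultimately have "(\<Prod>i<r + k. (x \<circ> transpose (r + k) p) i - u * y l) = 0"
      by (intro prod_zero) auto
    then show ?thesis by (simp add: G_def)
  qed
  have "leval x y (mul_x (r + k) (Suc k) 0 (mul_y (r + k) k a W)) = (\<Sum>p\<le>r + k. \<Sum>l\<le>k. G p l)"
    using nz by (simp add: leval_mul_x leval_mul_y G_def sum_distrib_left mult_ac)
  also have "\<dots> = (\<Sum>l\<le>k. \<Sum>p\<le>r + k. G p l)" by (rule sum.swap)
  also have "\<dots> = (\<Sum>l\<le>k. G (r + l) l)"
  proof (intro sum.cong refl)
    fix l assume l: "l \<in> {..k}"
    have "(\<Sum>p\<le>r + k. G p l) = (\<Sum>p\<in>{r + l}. G p l)"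
      by (rule sum.mono_neutral_right) (use l zero in auto)
    then show "(\<Sum>p\<le>r + k. G p l) = G (r + l) l" by simp
  qed
  also have "\<dots> = (\<Sum>l\<le>k. (\<Prod>j<Suc k. y j - u * (u * y l)) * y l powi a *
      (\<Prod>i<r + k. (x \<circ> transpose (r + k) (r + l)) i - u * y l) * leval (x \<circ> transpose (r + k) (r + l)) (y \<circ> transpose k l) W)"
  proof (intro sum.cong refl)
    fix l assume l: "l \<in> {..k}"
    have "sign (transpose (r + k) (r + l)) = sign (transpose k l)" by (simp add: sign_swap_id)
    moreover have "x (r + l) = u * y l" using al l by (simp add: aligned_def less_Suc_eq_le)
    ultimately show "G (r + l) l = (\<Prod>j<Suc k. y j - u * (u * y l)) * y l powi a *
      (\<Prod>i<r + k. (x \<circ> transpose (r + k) (r + l)) i - u * y l) * leval (x \<circ> transpose (r + k) (r + l)) (y \<circ> transpose k l) W"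
      by (simp only: G_def mult.assoc) (simp add: sign_def)
  qed
  finally show ?thesis .
qed

text \<open>Multiplying by \<open>y\<close> and then by \<open>x\<close> appends a matched pair. On
  matched pairs the factors of \<open>mul_x\<close> become
  \<open>y j - q * y l = - q * (y l - w * y j)\<close>, the kernel of \<open>zshuffle\<close>. Those
  of \<open>mul_y\<close> become \<open>u * (y j - y l)\<close>, which complete the Vandermonde
  product, and \<open>x i - u * y l\<close>, which extend the rest of
  \<open>prefactor\<close>.\<close>

lemma realized_zshuffle:
  assumes t: "t \<ge> 2" and f: "laurent_in r k f" and R: "realized r k f"
  shows "realized r (Suc k) (zshuffle b k f)"
proof -
  obtain W where W: "lz_numer (r + k) k W"
    "\<And>x y. nz x \<Longrightarrow> nz y \<Longrightarrow> aligned r k x y \<Longrightarrow> leval x y W = prefactor r k 0 x y * leval x y f"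
    using R unfolding realized_def by blast
  define q where "q = u * u"
  \<comment> \<open>The constants collected: \<open>1 - q\<close> from the new pair itself,
    \<open>- q\<close> and \<open>u\<close> from each earlier pair in \<open>mul_x\<close> and
    \<open>mul_y\<close>, and \<open>-1\<close> for each reversed Vandermonde factor.\<close>
  define C where "C = (1 - q) * (- q) ^ k * u ^ k * (-1) ^ k"
  have qw: "q * w = 1" using uuw by (simp add: q_def)
  \<comment> \<open>Here \<open>t \<ge> 2\<close> enters: for \<open>t = 1\<close> the two variables
    of the new pair would contribute the factor 0.\<close>
  have "q \<noteq> 1" using qw w_pow_neq_1[of 1] t by auto
  then have C: "C \<noteq> 0" by (simp add: C_def q_def)
  \<comment> \<open>The new pair meets itself in the factor \<open>(1 - q) * y l\<close>, which
    raises the exponent \<open>b - 1\<close> to \<open>b\<close>.\<close>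
  define W2 where "W2 = mul_x (r + k) (Suc k) 0 (mul_y (r + k) k (b - 1) W)"
  have "lz_numer (r + Suc k) (Suc k) W2" using lz_numer_mul_x[OF lz_numer_mul_y[OF W(1)]] by (simp add: W2_def)
  then have "lz_numer (r + Suc k) (Suc k) (LC (1 / C) * W2)" by (rule lz_numer_LC_mult)
  moreover have "leval x y (LC (1 / C) * W2) = prefactor r (Suc k) 0 x y * leval x y (zshuffle b k f)"
    if nz: "nz x" "nz y" and al: "aligned r (Suc k) x y" for x y
  proof -
    have tm: "(\<Prod>j<Suc k. y j - u * (u * y l)) * y l powi (b - 1) *
      (\<Prod>i<r + k. (x \<circ> transpose (r + k) (r + l)) i - u * y l) * leval (x \<circ> transpose (r + k) (r + l)) (y \<circ> transpose k l) W
      = C * prefactor r (Suc k) 0 x y * (of_int (sign (transpose k l)) * (y l powi b * (\<Prod>i\<in>{..k} - {l}. y l - w * y i) * leval x (y \<circ> transpose k l) f))"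
      if l: "l \<le> k" for l
    proof -
      define x' y' where "x' = x \<circ> transpose (r + k) (r + l)" and "y' = y \<circ> transpose k l"
      have x'r: "x' i = x i" if "i < r" for i using that by (simp add: x'_def transpose_def)
      have x'k: "x' (r + i) = u * y' i" if "i < k" for i
      proof -
        have "transpose (r + k) (r + l) (r + i) = r + transpose k l i" by (auto simp: transpose_def)
        moreover have "transpose k l i < Suc k" using that l by (auto simp: transpose_def)
        ultimately show ?thesis using al by (simp add: x'_def y'_def aligned_def)
      qed
      have card: "card ({..k} - {l}) = k" using l by simp
      have 1: "(\<Prod>j<Suc k. y j - u * (u * y l)) = (1 - q) * y l * ((- q) ^ k * (\<Prod>j\<in>{..k} - {l}. y l - w * y j))"
      proof -
        have e: "y j - u * (u * y l) = - q * (y l - w * y j)" for j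
        proof -
          have "- q * (y l - w * y j) = (q * w) * y j - q * y l" by (simp add: algebra_simps)
          then show ?thesis using qw by (simp add: q_def)
        qed
        have "(\<Prod>j<Suc k. y j - u * (u * y l)) = (y l - u * (u * y l)) * (\<Prod>j\<in>{..k} - {l}. - q * (y l - w * y j))"
          unfolding e[symmetric] by (rule prod_atMost_remove[OF l])
        also have "y l - u * (u * y l) = (1 - q) * y l" by (simp add: q_def algebra_simps)
        finally show ?thesis unfolding prod.distrib by (simp add: card)
      qed
      have 2: "(\<Prod>i<r + k. x' i - u * y l) = (\<Prod>i<r. x i - u * y l) * (u ^ k * (\<Prod>i\<in>{..k} - {l}. y i - y l))"
      proof -
        have "(\<Prod>i<k. x' (r + i) - u * y l) = (\<Prod>i<k. u * (y' i - y l))"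
          by (rule prod.cong[OF refl]) (simp only: x'k lessThan_iff right_diff_distrib)
        also have "\<dots> = u ^ k * (\<Prod>i\<in>{..k} - {l}. y i - y l)"
          unfolding prod.distrib y'_def comp_apply by (simp add: prod_transpose[OF l, of "\<lambda>i. y i - y l"])
        finally show ?thesis by (simp add: prod_split_add x'r)
      qed
      have 3: "(\<Prod>i\<in>{..k} - {l}. y i - y l) * vandermonde k y' = (-1) ^ k * (of_int (sign (transpose k l)) * vandermonde (Suc k) y)"
      proof -
        have \<tau>: "transpose k l permutes {..<Suc k}" using l by (intro permutes_swap_id) auto
        have "of_int (sign (transpose k l)) * vandermonde (Suc k) y = vandermonde k y' * (\<Prod>i<k. y' k - y' i)"
          using vandermonde_permute[OF \<tau>, of y] by (simp add: vandermonde_Suc y'_def)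
        also have "(\<Prod>i<k. y' k - y' i) = (\<Prod>i\<in>{..k} - {l}. - 1 * (y i - y l))"
          using prod_transpose[OF l, of "\<lambda>i. y l - y i"] by (simp add: y'_def)
        also have "\<dots> = (-1) ^ k * (\<Prod>i\<in>{..k} - {l}. y i - y l)"
          unfolding prod.distrib by (simp add: card)
        finally have eq: "of_int (sign (transpose k l)) * vandermonde (Suc k) y =
          vandermonde k y' * ((-1) ^ k * (\<Prod>i\<in>{..k} - {l}. y i - y l))" .
        have sq: "(-1) ^ k * (-1) ^ k = (1 :: complex)" by (simp flip: power_mult_distrib)
        have "(-1) ^ k * (of_int (sign (transpose k l)) * vandermonde (Suc k) y) =
          ((-1) ^ k * (-1) ^ k) * ((\<Prod>i\<in>{..k} - {l}. y i - y l) * vandermonde k y')"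
          unfolding eq by (simp only: mult_ac)
        then show ?thesis by (simp only: sq mult_1)
      qed
      have 4: "(\<Prod>i<r. x i - u * y l) * (\<Prod>i<r. \<Prod>j<k. x' i - u * y' j) = (\<Prod>i<r. \<Prod>j<Suc k. x i - u * y j)"
      proof -
        have "(\<Prod>i<r. \<Prod>j<k. x' i - u * y' j) = (\<Prod>i<r. \<Prod>j\<in>{..k} - {l}. x i - u * y j)"
          by (rule prod.cong) (simp_all add: x'r y'_def prod_transpose[OF l, of "\<lambda>j. x _ - u * y j"])
        then show ?thesis
          unfolding prod_atMost_remove[OF l] by (simp add: prod.distrib)
      qed
      have 5: "leval x' y' W = vandermonde k y' * (\<Prod>i<r. \<Prod>j<k. x' i - u * y' j) * leval x y' f"
      proof -
        have "leval x' y' W = prefactor r k 0 x' y' * leval x' y' f"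
          by (rule W(2)) (use nz x'k in \<open>auto simp: x'_def y'_def aligned_def\<close>)
        also have "leval x' y' f = leval x y' f" by (rule leval_cong[OF f]) (use x'r in auto)
        finally show ?thesis by (simp add: prefactor_def)
      qed
      have 6: "y l powi b = y l * y l powi (b - 1)"
        using nzD[OF nz(2), of l] by (simp add: power_int_diff)
      have "(\<Prod>j<Suc k. y j - u * (u * y l)) * y l powi (b - 1) * (\<Prod>i<r + k. x' i - u * y l) * leval x' y' W
        = (1 - q) * (- q) ^ k * u ^ k * (y l * y l powi (b - 1)) * (\<Prod>j\<in>{..k} - {l}. y l - w * y j) *
          ((\<Prod>i\<in>{..k} - {l}. y i - y l) * vandermonde k y') *
          ((\<Prod>i<r. x i - u * y l) * (\<Prod>i<r. \<Prod>j<k. x' i - u * y' j)) * leval x y' f"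
        unfolding 1 2 5 by (simp only: mult_ac)
      also have "\<dots> = C * prefactor r (Suc k) 0 x y * (of_int (sign (transpose k l)) * (y l powi b * (\<Prod>i\<in>{..k} - {l}. y l - w * y i) * leval x y' f))"
        unfolding 3 4 6[symmetric] C_def by (simp add: prefactor_def mult_ac)
      finally show ?thesis by (simp only: x'_def y'_def)
    qed
    have "leval x y W2 = C * (prefactor r (Suc k) 0 x y * leval x y (zshuffle b k f))"
      unfolding W2_def leval_mul_x_mul_y_aligned[OF nz al] leval_zshuffle[OF nz] sum_distrib_left
      by (intro sum.cong refl) (subst tm, simp_all add: mult_ac)
    then show ?thesis using nz C by simp
  qed
  ultimately show ?thesis unfolding realized_def by blast
qed

lemma realized_zwheel:
  assumes "laurent_in r k h" "skew {..<r} {..<k} h" "zwheel k h"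
  shows "realized r k h"
  using assms
proof (induction rule: zwheel_induct)
  case (skew f)
  then show ?case unfolding realized_def
    by (intro exI[of _ f]) (simp add: lz_numer_skew_X prefactor_def vandermonde_def)
next
  case (zero k)
  then show ?case unfolding realized_def by (intro exI[of _ 0]) (simp add: lz_numer_0)
next
  case (diff k f g)
  then obtain V W where "lz_numer (r + k) k V" "lz_numer (r + k) k W"
    "\<And>x y. nz x \<Longrightarrow> nz y \<Longrightarrow> aligned r k x y \<Longrightarrow> leval x y V = prefactor r k 0 x y * leval x y f"
    "\<And>x y. nz x \<Longrightarrow> nz y \<Longrightarrow> aligned r k x y \<Longrightarrow> leval x y W = prefactor r k 0 x y * leval x y g"
    unfolding realized_def by blast
  then show ?case unfolding realized_def by (intro exI[of _ "V - W"]) (simp add: lz_numer_diff algebra_simps)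
next
  case (scale k f c)
  then obtain W where "lz_numer (r + k) k W"
    "\<And>x y. nz x \<Longrightarrow> nz y \<Longrightarrow> aligned r k x y \<Longrightarrow> leval x y W = prefactor r k 0 x y * leval x y f"
    unfolding realized_def by blast
  then show ?case unfolding realized_def by (intro exI[of _ "LC c * W"]) (simp add: lz_numer_LC_mult)
next
  case (zshuffle b k f)
  then show ?case by (rule realized_zshuffle)
qed

section \<open>The filtration by the number of matched pairs\<close>

definition matched :: "nat \<Rightarrow> nat \<Rightarrow> nat \<Rightarrow> point \<Rightarrow> point \<Rightarrow> bool" where
  "matched k n m x y \<longleftrightarrow> nz x \<and> nz y \<and> (\<exists>\<alpha> \<beta>. inj_on \<alpha> {..<k} \<and> \<alpha> ` {..<k} \<subseteq> {..<n} \<and>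
     inj_on \<beta> {..<k} \<and> \<beta> ` {..<k} \<subseteq> {..<m} \<and> (\<forall>i<k. x (\<alpha> i) = u * y (\<beta> i)))"

lemma matchedI:
  assumes "nz x" "nz y" "inj_on \<alpha> {..<k}" "\<alpha> ` {..<k} \<subseteq> {..<n}" "inj_on \<beta> {..<k}"
    "\<beta> ` {..<k} \<subseteq> {..<m}" "\<And>i. i < k \<Longrightarrow> x (\<alpha> i) = u * y (\<beta> i)"
  shows "matched k n m x y"
  unfolding matched_def using assms by blast

definition vanishing :: "nat \<Rightarrow> nat \<Rightarrow> nat \<Rightarrow> laurent \<Rightarrow> bool" where
  "vanishing k n m f \<longleftrightarrow> (\<forall>x y. matched k n m x y \<longrightarrow> leval x y f = 0)"

lemma inj_on_lessThan_le: "inj_on \<alpha> {..<k} \<Longrightarrow> \<alpha> ` {..<k} \<subseteq> {..<n::nat} \<Longrightarrow> k \<le> n"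
  by (metis card_image card_lessThan card_mono finite_lessThan)

lemma vanishing_large:
  assumes "n < k \<or> m < k" shows "vanishing k n m f"
proof -
  have "\<not> matched k n m x y" for x y
    using inj_on_lessThan_le assms unfolding matched_def by (metis not_le)
  then show ?thesis by (simp add: vanishing_def)
qed

lemma vanishing_LC_mult: "vanishing k n m f \<Longrightarrow> vanishing k n m (LC c * f)"
  by (auto simp: vanishing_def matched_def)

lemma vanishing_sum: "(\<And>a. a \<in> A \<Longrightarrow> vanishing k n m (F a)) \<Longrightarrow> vanishing k n m (sum F A)"
  by (simp add: vanishing_def)

text \<open>If the new \<open>y\<close> belongs to one of the pairs, its partner makes a factor
  \<open>x i - u * y b\<close> vanish; otherwise all \<open>k\<close> pairs are already arguments of
  \<open>f\<close>. Hence a \<open>y\<close> multiplied on the right creates no match.\<close>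

lemma vanishing_mul_y:
  assumes f: "vanishing k n m f"
  shows "vanishing k n (Suc m) (mul_y n m a f)"
  unfolding vanishing_def
proof (intro allI impI)
  fix x y assume "matched k n (Suc m) x y"
  then obtain \<alpha> \<beta> where nz: "nz x" "nz y" and \<alpha>: "inj_on \<alpha> {..<k}" "\<alpha> ` {..<k} \<subseteq> {..<n}"
    and \<beta>: "inj_on \<beta> {..<k}" "\<beta> ` {..<k} \<subseteq> {..<Suc m}" and xy: "\<forall>i<k. x (\<alpha> i) = u * y (\<beta> i)"
    unfolding matched_def by blast
  have "(\<Prod>i<n. x i - u * y b) * leval x (y \<circ> transpose m b) f = 0" if b: "b \<le> m" for b
  proof (cases "b \<in> \<beta> ` {..<k}")
    case True
    then obtain i where i: "i < k" "b = \<beta> i" by auto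
    then have "\<alpha> i < n" "x (\<alpha> i) - u * y b = 0" using \<alpha> xy by auto
    then have "(\<Prod>i<n. x i - u * y b) = 0" by (intro prod_zero) auto
    then show ?thesis by simp
  next
    case False
    have "matched k n m x (y \<circ> transpose m b)"
    proof (rule matchedI[where \<alpha> = \<alpha> and \<beta> = "transpose m b \<circ> \<beta>"])
      show "inj_on (transpose m b \<circ> \<beta>) {..<k}" using \<beta>(1) by (simp add: comp_inj_on inj_on_subset)
      show "(transpose m b \<circ> \<beta>) ` {..<k} \<subseteq> {..<m}"
        using \<beta>(2) False b by (auto simp: transpose_def image_subset_iff less_Suc_eq)
    qed (use nz \<alpha> xy in auto)
    then show ?thesis using f by (simp add: vanishing_def)
  qed
  then show "leval x y (mul_y n m a f) = 0"
    using nz by (auto simp: leval_mul_y mult.assoc intro!: sum.neutral simp del: mult_eq_0_iff)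
qed

lemma prefactor_Suc:
  "prefactor r k (Suc s) x y = prefactor r k s x y * ((\<Prod>i<r. x i - u * y (k + s)) * (\<Prod>i<k. y (k + s) - y i))"
proof -
  have "{k..<k + Suc s} = insert (k + s) {k..<k + s}" by auto
  then show ?thesis by (simp add: prefactor_def prod.distrib mult_ac)
qed

lemma prefactor_permute_Y:
  assumes \<tau>: "\<tau> permutes {k..<k + s}"
  shows "prefactor r k s x (y \<circ> \<tau>) = prefactor r k s x y"
proof -
  have \<tau>': "\<tau> permutes {..<k + s}" by (rule permutes_subset[OF \<tau>]) auto
  have fx: "\<tau> i = i" if "i < k" for i using \<tau> that by (simp add: permutes_def)
  have "vandermonde k (y \<circ> \<tau>) = vandermonde k y" by (rule vandermonde_cong) (simp add: fx)
  moreover have "(\<Prod>j<k + s. c - u * y (\<tau> j)) = (\<Prod>j<k + s. c - u * y j)" for c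
    using prod.permute[OF \<tau>', of "\<lambda>j. c - u * y j"] by (simp add: comp_def)
  moreover have "(\<Prod>j\<in>{k..<k + s}. \<Prod>i<k. y (\<tau> j) - y (\<tau> i)) = (\<Prod>j\<in>{k..<k + s}. \<Prod>i<k. y j - y i)"
    using prod.permute[OF \<tau>, of "\<lambda>j. \<Prod>i<k. y j - y i"] by (simp add: comp_def fx)
  ultimately show ?thesis by (simp add: prefactor_def)
qed

text \<open>Induction on the number \<open>s\<close> of unmatched \<open>y\<close>: \<open>h\<close>
  is expanded in the last of them, and the realisation of each coefficient is multiplied by the
  corresponding power of \<open>y\<close>. At aligned points the summands that single out a matched
  \<open>y\<close> vanish through its partner, and the other \<open>Suc s\<close> agree by
  skewness.\<close>

lemma realize:
  assumes "laurent_in r (k + s) h" "skew {..<r} {..<k} h" "skew {} {k..<k + s} h" "zwheel k h"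
  shows "\<exists>W. lz_numer (r + k) (k + s) W \<and> vanishing (Suc k) (r + k) (k + s) W \<and>
    (\<forall>x y. nz x \<longrightarrow> nz y \<longrightarrow> aligned r k x y \<longrightarrow> leval x y W = prefactor r k s x y * leval x y h)"
  using assms
proof (induction s arbitrary: h)
  case 0
  then have "realized r k h" by (intro realized_zwheel) auto
  then show ?case unfolding realized_def by (auto simp: vanishing_large)
next
  case (Suc s)
  define D where "D = (\<lambda>\<mu>. lookup \<mu> (Y (k + s))) ` keys h"
  have "\<exists>W. lz_numer (r + k) (k + s) W \<and> vanishing (Suc k) (r + k) (k + s) W \<and>
    (\<forall>x y. nz x \<longrightarrow> nz y \<longrightarrow> aligned r k x y \<longrightarrow> leval x y W = prefactor r k s x y * leval x y (vcoeff (Y (k + s)) a h))" for a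
  proof (rule Suc.IH)
    show "laurent_in r (k + s) (vcoeff (Y (k + s)) a h)" using Suc.prems(1) by (intro laurent_in_vcoeff_Y) simp
    show "skew {..<r} {..<k} (vcoeff (Y (k + s)) a h)" by (rule skew_vcoeff_Y[OF Suc.prems(2)]) auto
    show "skew {} {k..<k + s} (vcoeff (Y (k + s)) a h)" by (rule skew_vcoeff_Y[OF Suc.prems(3)]) auto
    show "zwheel k (vcoeff (Y (k + s)) a h)" by (rule zwheel_vcoeff[OF Suc.prems(4)]) auto
  qed
  then obtain V where V: "\<And>a. lz_numer (r + k) (k + s) (V a)" "\<And>a. vanishing (Suc k) (r + k) (k + s) (V a)"
    "\<And>a x y. nz x \<Longrightarrow> nz y \<Longrightarrow> aligned r k x y \<Longrightarrow> leval x y (V a) = prefactor r k s x y * leval x y (vcoeff (Y (k + s)) a h)"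
    by metis
  define W where "W = (\<Sum>a\<in>D. mul_y (r + k) (k + s) a (V a))"
  \<comment> \<open>A factor \<open>- u\<close> comes from each
    \<open>x (r + i) - u * y b = - u * (y b - y i)\<close>, and \<open>Suc s\<close> counts the
    equal summands.\<close>
  define C where "C = (-u) ^ k * of_nat (Suc s)"
  have C: "C \<noteq> 0" by (simp add: C_def del: of_nat_Suc)
  have "lz_numer (r + k) (Suc (k + s)) W" unfolding W_def by (intro lz_numer_sum lz_numer_mul_y V)
  then have "lz_numer (r + k) (k + Suc s) (LC (1 / C) * W)" by (simp add: lz_numer_LC_mult)
  moreover have "vanishing (Suc k) (r + k) (Suc (k + s)) W"
    unfolding W_def by (intro vanishing_sum vanishing_mul_y V)
  then have "vanishing (Suc k) (r + k) (k + Suc s) (LC (1 / C) * W)" by (simp add: vanishing_LC_mult)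
  moreover have "leval x y (LC (1 / C) * W) = prefactor r k (Suc s) x y * leval x y h"
    if nz: "nz x" "nz y" and al: "aligned r k x y" for x y
  proof -
    define \<Theta> where "\<Theta> = (\<lambda>b. transpose (k + s) b)"
    have exp: "(\<Sum>a\<in>D. y b powi a * leval x (y \<circ> \<Theta> b) (vcoeff (Y (k + s)) a h)) = leval x (y \<circ> \<Theta> b) h" for b
      using ev_vcoeff_expand[of "case_var x (y \<circ> \<Theta> b)" D "Y (k + s)" h] nz
      by (simp add: D_def laurent_eval_ev \<Theta>_def)
    have low: "(\<Prod>i<r + k. x i - u * y b) = 0" if "b < k" for b
      using al that by (intro prod_zero bexI[of _ "r + b"]) (auto simp: aligned_def)
    have high: "(\<Prod>i<r + k. x i - u * y b) * leval x (y \<circ> \<Theta> b) (V a) =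
      (-u) ^ k * prefactor r k (Suc s) x y * leval x (y \<circ> \<Theta> b) (vcoeff (Y (k + s)) a h)"
      if b: "b \<in> {k..k + s}" for a b
    proof -
      have "\<Theta> b permutes {k..<k + Suc s}" unfolding \<Theta>_def using b by (intro permutes_swap_id) auto
      from prefactor_permute_Y[OF this, of r x y]
      have p: "prefactor r k (Suc s) x y = prefactor r k s x (y \<circ> \<Theta> b) * ((\<Prod>i<r. x i - u * y b) * (\<Prod>i<k. y b - y i))"
        using b by (simp add: prefactor_Suc \<Theta>_def transpose_def cong: prod.cong_simp)
      have "(\<Prod>i<k. x (r + i) - u * y b) = (\<Prod>i<k. - u * (y b - y i))"
        using al by (intro prod.cong) (simp_all add: aligned_def algebra_simps)
      also have "\<dots> = (- u) ^ k * (\<Prod>i<k. y b - y i)"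
        by (simp only: prod.distrib prod_constant card_lessThan)
      finally have "(\<Prod>i<r + k. x i - u * y b) = (\<Prod>i<r. x i - u * y b) * ((- u) ^ k * (\<Prod>i<k. y b - y i))"
        by (simp only: prod_split_add)
      moreover have "leval x (y \<circ> \<Theta> b) (V a) = prefactor r k s x (y \<circ> \<Theta> b) * leval x (y \<circ> \<Theta> b) (vcoeff (Y (k + s)) a h)"
        by (rule V(3)) (use nz al b in \<open>auto simp: aligned_def \<Theta>_def transpose_def\<close>)
      ultimately show ?thesis by (simp add: p mult_ac)
    qed
    have "leval x y W = (\<Sum>a\<in>D. \<Sum>b\<le>k + s. of_int (sign (\<Theta> b)) * (y b powi a * ((\<Prod>i<r + k. x i - u * y b) * leval x (y \<circ> \<Theta> b) (V a))))"
      using nz by (simp add: W_def leval_mul_y \<Theta>_def mult.assoc)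
    also have "\<dots> = (\<Sum>a\<in>D. \<Sum>b\<in>{k..k + s}. of_int (sign (\<Theta> b)) * (y b powi a * ((\<Prod>i<r + k. x i - u * y b) * leval x (y \<circ> \<Theta> b) (V a))))"
    proof (intro sum.cong[OF refl] sum.mono_neutral_right ballI)
      fix a b assume "b \<in> {..k + s} - {k..k + s}"
      then have "b < k" by auto
      then show "of_int (sign (\<Theta> b)) * (y b powi a * ((\<Prod>i<r + k. x i - u * y b) * leval x (y \<circ> \<Theta> b) (V a))) = 0"
        by (simp only: low) simp
    qed auto
    also have "\<dots> = (\<Sum>a\<in>D. \<Sum>b\<in>{k..k + s}. (-u) ^ k * prefactor r k (Suc s) x y * (of_int (sign (\<Theta> b)) * (y b powi a * leval x (y \<circ> \<Theta> b) (vcoeff (Y (k + s)) a h))))"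
      by (intro sum.cong refl) (subst high, assumption, simp only: mult_ac)
    also have "\<dots> = (\<Sum>b\<in>{k..k + s}. (-u) ^ k * prefactor r k (Suc s) x y * (of_int (sign (\<Theta> b)) * (\<Sum>a\<in>D. y b powi a * leval x (y \<circ> \<Theta> b) (vcoeff (Y (k + s)) a h))))"
      by (subst sum.swap) (simp only: sum_distrib_left)
    also have "\<dots> = (\<Sum>b\<in>{k..k + s}. (-u) ^ k * prefactor r k (Suc s) x y * leval x y h)"
    proof (intro sum.cong refl)
      fix b assume "b \<in> {k..k + s}"
      then have "\<Theta> b permutes {k..<k + Suc s}" unfolding \<Theta>_def by (intro permutes_swap_id) auto
      from skewY[OF Suc.prems(3) this nz]
      have "of_int (sign (\<Theta> b)) * leval x (y \<circ> \<Theta> b) h = leval x y h" by (simp add: sign_sq)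
      then show "(-u) ^ k * prefactor r k (Suc s) x y * (of_int (sign (\<Theta> b)) * (\<Sum>a\<in>D. y b powi a * leval x (y \<circ> \<Theta> b) (vcoeff (Y (k + s)) a h))) = (-u) ^ k * prefactor r k (Suc s) x y * leval x y h"
        unfolding exp by simp
    qed
    also have "\<dots> = C * (prefactor r k (Suc s) x y * leval x y h)" by (simp add: C_def mult_ac)
    finally show ?thesis using nz C by simp
  qed
  ultimately show ?case by blast
qed

section \<open>Specialisation at matched variables\<close>

definition matched_x :: "nat \<Rightarrow> nat \<Rightarrow> point \<Rightarrow> point \<Rightarrow> nat \<Rightarrow> complex" where
  "matched_x r k x y = (\<lambda>i. if r \<le> i \<and> i < r + k then u * y (i - r) else x i)"

definition special :: "nat \<Rightarrow> nat \<Rightarrow> laurent \<Rightarrow> laurent" where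
  "special r k = monom_subst
     (\<lambda>z. case z of X i \<Rightarrow> if r \<le> i \<and> i < r + k then u else 1 | Y j \<Rightarrow> 1)
     (\<lambda>z. case z of X i \<Rightarrow> if r \<le> i \<and> i < r + k then Y (i - r) else X i | Y j \<Rightarrow> Y j)"

lemma nz_matched_x: "nz x \<Longrightarrow> nz y \<Longrightarrow> nz (matched_x r k x y)"
  by (simp add: nz_def matched_x_def)

lemma leval_special: "nz x \<Longrightarrow> nz y \<Longrightarrow> leval x y (special r k f) = leval (matched_x r k x y) y f"
proof -
  assume nz: "nz x" "nz y"
  have "(\<lambda>z. (case z of X i \<Rightarrow> if r \<le> i \<and> i < r + k then u else 1 | Y j \<Rightarrow> 1) *
      case_var x y (case z of X i \<Rightarrow> if r \<le> i \<and> i < r + k then Y (i - r) else X i | Y j \<Rightarrow> Y j)) = case_var (matched_x r k x y) y"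
    by (rule ext) (simp add: matched_x_def split: var.splits)
  then show ?thesis
    using nz ev_monom_subst[of "case_var x y"] by (simp add: special_def laurent_eval_ev)
qed

lemma laurent_in_special:
  assumes "laurent_in (r + k) (k + s) f" shows "laurent_in r (k + s) (special r k f)"
  unfolding special_def by (rule laurent_in_monom_subst[OF _ assms]) (auto simp: vars_def)

definition prefactor_poly :: "nat \<Rightarrow> nat \<Rightarrow> nat \<Rightarrow> laurent" where
  "prefactor_poly r k s = vandermonde_poly k * ((\<Prod>i<r. \<Prod>j<k + s. LV (X i) - LC u * LV (Y j)) *
     (\<Prod>j\<in>{k..<k + s}. \<Prod>i<k. LV (Y j) - LV (Y i)))"

lemma leval_prefactor_poly: "nz x \<Longrightarrow> nz y \<Longrightarrow> leval x y (prefactor_poly r k s) = prefactor r k s x y"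
  by (simp add: prefactor_poly_def prefactor_def)

lemma prefactor_neq_0:
  assumes "inj y" "\<And>i j. x i \<noteq> u * y j"
  shows "prefactor r k s x y \<noteq> 0"
proof -
  have "vandermonde k y \<noteq> 0" by (rule vandermonde_neq_0) (rule inj_on_subset[OF assms(1) subset_UNIV])
  moreover have "(\<Prod>j\<in>{k..<k + s}. \<Prod>i<k. y j - y i) \<noteq> 0"
    using assms(1) by (auto simp: inj_eq)
  moreover have "(\<Prod>i<r. \<Prod>j<k + s. x i - u * y j) \<noteq> 0" using assms(2) by simp
  ultimately show ?thesis by (simp add: prefactor_def)
qed

lemma prefactor_poly_neq_0: "prefactor_poly r k s \<noteq> 0"
proof
  assume 0: "prefactor_poly r k s = 0"
  \<comment> \<open>With these values \<open>x i - u * y j = - u * (1 + y j)\<close>, which is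
    nonzero since \<open>y j\<close> is a positive integer.\<close>
  define x y :: point where "x = (\<lambda>_. - u)" and "y = (\<lambda>i. of_nat (Suc i))"
  have nz: "nz x" "nz y" by (auto simp: nz_def x_def y_def simp del: of_nat_Suc)
  have "- u \<noteq> u * of_nat (Suc j)" for j
  proof
    assume "- u = u * of_nat (Suc j)"
    then have "u * of_nat (Suc (Suc j)) = 0" by (simp add: algebra_simps)
    then show False by (simp del: of_nat_Suc)
  qed
  then have "prefactor r k s x y \<noteq> 0"
    by (intro prefactor_neq_0) (auto simp: inj_def x_def y_def simp del: of_nat_Suc)
  then show False using leval_prefactor_poly[OF nz, of r k s] 0 by simp
qed

lemma prefactor_poly_cancel:
  assumes "\<And>x y. nz x \<Longrightarrow> nz y \<Longrightarrow> prefactor r k s x y * leval x y g = 0"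
  shows "g = 0"
proof -
  have "prefactor_poly r k s * g = 0" by (rule leval_eqI) (simp add: leval_prefactor_poly assms)
  then show ?thesis using prefactor_poly_neq_0 by simp
qed

lemma prefactor_permute_X:
  assumes "\<sigma> permutes {..<r}" shows "prefactor r k s (x \<circ> \<sigma>) y = prefactor r k s x y"
  using prod.permute[OF assms, of "\<lambda>i. \<Prod>j<k + s. x i - u * y j"] by (simp add: prefactor_def comp_def)

lemma prefactor_permute_Z:
  assumes \<tau>: "\<tau> permutes {..<k}" shows "prefactor r k s x (y \<circ> \<tau>) = of_int (sign \<tau>) * prefactor r k s x y"
proof -
  have \<tau>': "\<tau> permutes {..<k + s}" by (rule permutes_subset[OF \<tau>]) auto
  have fx: "\<tau> j = j" if "j \<in> {k..<k + s}" for j using \<tau> that by (simp add: permutes_def)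
  have "(\<Prod>j<k + s. c - u * y (\<tau> j)) = (\<Prod>j<k + s. c - u * y j)" for c
    using prod.permute[OF \<tau>', of "\<lambda>j. c - u * y j"] by (simp add: comp_def)
  moreover have "(\<Prod>j\<in>{k..<k + s}. \<Prod>i<k. y (\<tau> j) - y (\<tau> i)) = (\<Prod>j\<in>{k..<k + s}. \<Prod>i<k. y j - y i)"
  proof (rule prod.cong[OF refl])
    fix j assume "j \<in> {k..<k + s}"
    then show "(\<Prod>i<k. y (\<tau> j) - y (\<tau> i)) = (\<Prod>i<k. y j - y i)"
      using prod.permute[OF \<tau>, of "\<lambda>i. y j - y i"] by (simp add: comp_def fx)
  qed
  ultimately show ?thesis by (simp add: prefactor_def vandermonde_permute[OF \<tau>])
qed

text \<open>Two equal \<open>y\<close> give 0 by skewness. If \<open>x a = u * y b\<close> with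
  \<open>y b\<close> matched, then \<open>x a\<close> equals the partner of \<open>y b\<close> and
  skewness in the \<open>x\<close> applies; with \<open>y b\<close> unmatched it is one more matched
  pair, and \<open>f\<close> vanishes by \<open>vanishing (Suc k)\<close>.\<close>

lemma special_quotient:
  assumes f: "wheel_numer (r + k) (k + s) f" "vanishing (Suc k) (r + k) (k + s) f"
  shows "\<exists>h. laurent_in r (k + s) h \<and> special r k f = prefactor_poly r k s * h"
proof -
  have fs: "laurent_in (r + k) (k + s) f" "skew {..<r + k} {..<k + s} f" using f(1) by (auto simp: wheel_numer_def)
  \<comment> \<open>\<open>A\<close> lists the pairs of matched \<open>y\<close>, \<open>B\<close>
    an unmatched \<open>x\<close> with any \<open>y\<close>, \<open>C\<close> an unmatched with a
    matched \<open>y\<close>. Differences of two unmatched \<open>y\<close> stay in the cofactor,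
    which keeps it skew in them.\<close>
  define A where "A = (SIGMA j:{..<k}. {..<j})"
  define B where "B = {..<r} \<times> {..<k + s}"
  define C where "C = {k..<k + s} \<times> {..<k}"
  define I where "I = A <+> (B <+> C)"
  define zf :: "nat \<times> nat + nat \<times> nat + nat \<times> nat \<Rightarrow> var" where "zf = case_sum (\<lambda>(j, i). Y j) (case_sum (\<lambda>(i, j). X i) (\<lambda>(j, i). Y j))"
  define wf :: "nat \<times> nat + nat \<times> nat + nat \<times> nat \<Rightarrow> var" where "wf = case_sum (\<lambda>(j, i). Y i) (case_sum (\<lambda>(i, j). Y j) (\<lambda>(j, i). Y i))"
  define cc :: "nat \<times> nat + nat \<times> nat + nat \<times> nat \<Rightarrow> complex" where "cc = case_sum (\<lambda>_. 1) (case_sum (\<lambda>_. u) (\<lambda>_. 1))"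
  have fin: "finite A" "finite B" "finite C" by (auto simp: A_def B_def C_def)
  have "\<exists>h. laurent_in r (k + s) h \<and> special r k f = (\<Prod>i\<in>I. LV (zf i) - LC (cc i) * LV (wf i)) * h"
  proof (rule linear_forms_quotient)
    show "finite I" using fin by (simp add: I_def)
    show "inj_on (\<lambda>i. {zf i, wf i}) I"
      by (rule inj_onI) (auto simp: I_def A_def B_def C_def zf_def wf_def doubleton_eq_iff)
    show "laurent_in r (k + s) (special r k f)" by (rule laurent_in_special[OF fs(1)])
    show "zf i \<noteq> wf i \<and> cc i \<noteq> 0 \<and> zf i \<in> vars r (k + s) \<and> wf i \<in> vars r (k + s)" if "i \<in> I" for i
      using that by (auto simp: I_def A_def B_def C_def zf_def wf_def cc_def)
    fix i p assume i: "i \<in> I" and p: "nz p" "p (zf i) = cc i * p (wf i)"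
    define x y where "x = (\<lambda>i. p (X i))" and "y = (\<lambda>i. p (Y i))"
    have nz: "nz x" "nz y" using p(1) by (auto simp: nz_def x_def y_def)
    have "case_var x y = p"
    proof
      fix z show "case_var x y z = p z" by (cases z) (auto simp: x_def y_def)
    qed
    moreover have "leval (matched_x r k x y) y f = 0"
    proof -
      consider a b where "i = Inl (a, b)" "a < k" "b < a" | a b where "i = Inr (Inl (a, b))" "a < r" "b < k + s"
        | a b where "i = Inr (Inr (a, b))" "k \<le> a" "a < k + s" "b < k"
        using i by (auto simp: I_def A_def B_def C_def)
      then show ?thesis
      proof cases
        case 1
        then have "y a = y b" using p(2) by (simp add: zf_def wf_def cc_def y_def)
        then show ?thesis using 1 nz by (intro skew_coincide_Y[OF fs(2), of a b]) (auto simp: nz_matched_x)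
      next
        case 3
        then have "y a = y b" using p(2) by (simp add: zf_def wf_def cc_def y_def)
        then show ?thesis using 3 nz by (intro skew_coincide_Y[OF fs(2), of a b]) (auto simp: nz_matched_x)
      next
        case 2
        then have xy: "x a = u * y b" using p(2) by (simp add: zf_def wf_def cc_def x_def y_def)
        show ?thesis
        proof (cases "b < k")
          case True
          then show ?thesis using 2 nz xy
            by (intro skew_coincide_X[OF fs(2), of a "r + b"]) (auto simp: nz_matched_x, simp add: matched_x_def)
        next
          case False
          have "matched (Suc k) (r + k) (k + s) (matched_x r k x y) y"
          proof (rule matchedI)
            show "inj_on (\<lambda>l. if l < k then r + l else a) {..<Suc k}" using 2 by (auto simp: inj_on_def)
            show "inj_on (\<lambda>l. if l < k then l else b) {..<Suc k}" using False by (auto simp: inj_on_def)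
            fix l assume "l < Suc k"
            then show "matched_x r k x y (if l < k then r + l else a) = u * y (if l < k then l else b)"
              using 2 xy by (auto simp: matched_x_def)
          qed (use nz 2 False in \<open>auto simp: nz_matched_x\<close>)
          then show ?thesis using f(2) by (simp add: vanishing_def)
        qed
      qed
    qed
    ultimately show "ev p (special r k f) = 0"
      using leval_special[OF nz, of r k f] by (simp add: laurent_eval_ev)
  qed
  moreover have "(\<Prod>i\<in>I. LV (zf i) - LC (cc i) * LV (wf i)) = prefactor_poly r k s"
    unfolding I_def using fin
    by (simp add: prod.Plus comp_def prefactor_poly_def vandermonde_poly_def A_def B_def C_def zf_def wf_def cc_def
        prod.Sigma prod.cartesian_product split_def)
  ultimately show ?thesis by simp
qed

text \<open>The cofactor \<open>h\<close> of \<open>f\<close> on matched pairs has the symmetries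
  and the chain condition that \<open>realize\<close> asks for, so some \<open>W\<close> of the
  subalgebra has the same restriction. It suffices to compare at aligned points, because skewness
  moves every matching there.\<close>

lemma matching_step:
  assumes f: "wheel_numer n m f" "vanishing (Suc k) n m f" and "k \<le> n" "k \<le> m"
  shows "\<exists>W. lz_numer n m W \<and> vanishing (Suc k) n m W \<and> vanishing k n m (f - W)"
proof -
  obtain r s where n: "n = r + k" and m: "m = k + s"
    using \<open>k \<le> n\<close> \<open>k \<le> m\<close> by (metis add.commute le_Suc_ex)
  have fs: "laurent_in n m f" "skew {..<n} {..<m} f" "xwheel n m f" using f(1) by (auto simp: wheel_numer_def)
  obtain h where h: "laurent_in r (k + s) h" "special r k f = prefactor_poly r k s * h"
    using special_quotient f unfolding n m by blast
  have ph: "prefactor r k s x y * leval x y h = leval (matched_x r k x y) y f" if "nz x" "nz y" for x y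
    using arg_cong[OF h(2), of "leval x y"] that by (simp add: leval_special leval_prefactor_poly)
  have hX: "leval (x \<circ> \<sigma>) y h = of_int (sign \<sigma>) * leval x y h"
    if \<sigma>: "\<sigma> permutes {..<r}" and nz: "nz x" "nz y" for \<sigma> x y
  proof -
    have \<sigma>': "\<sigma> permutes {..<n}" by (rule permutes_subset[OF \<sigma>]) (auto simp: n)
    have "laurent_rename \<sigma> id h - of_int (sign \<sigma>) * h = 0"
    proof (rule prefactor_poly_cancel)
      fix x y :: point assume nz: "nz x" "nz y"
      have \<sigma>r: "\<sigma> i < r \<longleftrightarrow> i < r" for i using permutes_in_image[OF \<sigma>, of i] by simp
      have "matched_x r k (x \<circ> \<sigma>) y = matched_x r k x y \<circ> \<sigma>"
      proof
        fix i
        show "matched_x r k (x \<circ> \<sigma>) y i = (matched_x r k x y \<circ> \<sigma>) i"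
        proof (cases "i < r")
          case True
          then show ?thesis using \<sigma>r[of i] by (simp add: matched_x_def)
        next
          case False
          then have "\<sigma> i = i" using \<sigma> by (simp add: permutes_def)
          then show ?thesis by (simp add: matched_x_def)
        qed
      qed
      then have "prefactor r k s x y * leval (x \<circ> \<sigma>) y h = leval (matched_x r k x y \<circ> \<sigma>) y f"
        using ph[of "x \<circ> \<sigma>" y] nz by (simp add: prefactor_permute_X[OF \<sigma>])
      also have "\<dots> = of_int (sign \<sigma>) * (prefactor r k s x y * leval x y h)"
        using skewX[OF fs(2) \<sigma>' nz_matched_x[OF nz] nz(2)] ph[OF nz] by simp
      finally show "prefactor r k s x y * leval x y (laurent_rename \<sigma> id h - of_int (sign \<sigma>) * h) = 0"
        using nz by (simp add: algebra_simps)
    qed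
    from arg_cong[OF this, of "leval x y"] show ?thesis using nz by simp
  qed
  have hZ: "leval x (y \<circ> transpose a b) h = - leval x y h"
    if ab: "a < k" "b < k" "a \<noteq> b" and nz: "nz x" "nz y" for a b x y
  proof -
    have \<tau>: "transpose a b permutes {..<k}" "transpose a b permutes {..<m}" "transpose (r + a) (r + b) permutes {..<n}"
      using ab by (auto intro!: permutes_swap_id simp: n m)
    have "laurent_rename id (transpose a b) h + h = 0"
    proof (rule prefactor_poly_cancel)
      fix x y :: point assume nz: "nz x" "nz y"
      \<comment> \<open>Swapping two matched \<open>y\<close> swaps their partners as well: the two
        signs of \<open>f\<close> cancel, so the sign of the Vandermonde factor must be compensated
        by \<open>h\<close>.\<close>
      have "matched_x r k x (y \<circ> transpose a b) = matched_x r k x y \<circ> transpose (r + a) (r + b)"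
        using ab by (auto simp: fun_eq_iff matched_x_def transpose_def)
      then have "- prefactor r k s x y * leval x (y \<circ> transpose a b) h =
        leval (matched_x r k x y \<circ> transpose (r + a) (r + b)) (y \<circ> transpose a b) f"
        using ph[of x "y \<circ> transpose a b"] nz ab(3) by (simp add: prefactor_permute_Z[OF \<tau>(1)] sign_swap_id)
      also have "\<dots> = prefactor r k s x y * leval x y h"
        using skewD[OF fs(2) \<tau>(3,2) nz_matched_x[OF nz] nz(2)] ph[OF nz] ab(3) by (simp add: sign_swap_id)
      finally have eq: "- prefactor r k s x y * leval x (y \<circ> transpose a b) h = prefactor r k s x y * leval x y h" .
      show "prefactor r k s x y * leval x y (laurent_rename id (transpose a b) h + h) = 0"
        using nz by (simp add: distrib_left eq[symmetric])
    qed
    from arg_cong[OF this, of "leval x y"] show ?thesis using nz by (simp add: add_eq_0_iff2)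
  qed
  have hY: "leval x (y \<circ> \<tau>) h = of_int (sign \<tau>) * leval x y h"
    if \<tau>: "\<tau> permutes {k..<k + s}" and nz: "nz x" "nz y" for \<tau> x y
  proof -
    have \<tau>': "\<tau> permutes {..<m}" by (rule permutes_subset[OF \<tau>]) (auto simp: m)
    have "laurent_rename id \<tau> h - of_int (sign \<tau>) * h = 0"
    proof (rule prefactor_poly_cancel)
      fix x y :: point assume nz: "nz x" "nz y"
      have "\<tau> i = i" if "i < k" for i using \<tau> that by (simp add: permutes_def)
      then have "matched_x r k x (y \<circ> \<tau>) = matched_x r k x y" by (auto simp: fun_eq_iff matched_x_def)
      then have "prefactor r k s x y * leval x (y \<circ> \<tau>) h = leval (matched_x r k x y) (y \<circ> \<tau>) f"
        using ph[of x "y \<circ> \<tau>"] nz by (simp add: prefactor_permute_Y[OF \<tau>])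
      also have "\<dots> = of_int (sign \<tau>) * (prefactor r k s x y * leval x y h)"
        using skewY[OF fs(2) \<tau>' nz_matched_x[OF nz] nz(2)] ph[OF nz] by simp
      finally show "prefactor r k s x y * leval x y (laurent_rename id \<tau> h - of_int (sign \<tau>) * h) = 0"
        using nz by (simp add: algebra_simps)
    qed
    from arg_cong[OF this, of "leval x y"] show ?thesis using nz by simp
  qed
  have "zwheel k h"
  proof (rule zwheel_cancel[where P = "prefactor_poly r k s"])
    fix \<alpha> and x y :: point
    assume nz: "nz x" "nz y" and \<alpha>: "inj_on \<alpha> {..<t}" "\<alpha> ` {..<t} \<subseteq> {..<k}"
      and wh: "\<And>i. Suc i < t \<Longrightarrow> y (\<alpha> (Suc i)) = w * y (\<alpha> i)"
    have \<alpha>k: "\<alpha> i < k" if "i < t" for i using \<alpha>(2) that by auto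
    \<comment> \<open>The matched pairs over a chain form a wheel: \<open>u * u * w = 1\<close>
      links each pair to the next, and \<open>w ^ t = 1\<close> closes the circle.\<close>
    have "leval (matched_x r k x y) y f = 0"
    proof (rule xwheelD[OF fs(3) nz_matched_x[OF nz] nz(2), where \<alpha> = "\<lambda>i. r + \<alpha> i" and \<beta> = \<alpha>])
      show "inj_on (\<lambda>i. r + \<alpha> i) {..<t}" using \<alpha>(1) by (auto simp: inj_on_def)
      show "(\<lambda>i. r + \<alpha> i) ` {..<t} \<subseteq> {..<n}" using \<alpha>k by (auto simp: n)
      show "\<alpha> ` {..<t} \<subseteq> {..<m}" using \<alpha>k by (force simp: m)
      fix i assume i: "i < t"
      have next_lt: "Suc i mod t < t" using t_pos by simp
      have x: "matched_x r k x y (r + \<alpha> j) = u * y (\<alpha> j)" if "j < t" for j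
        using \<alpha>k[OF that] by (simp add: matched_x_def)
      have "y (\<alpha> (Suc i mod t)) = w * y (\<alpha> i)"
      proof (cases "Suc i < t")
        case False
        then have "Suc i = t" using i by simp
        moreover have "y (\<alpha> i) = w ^ i * y (\<alpha> 0)" by (rule wheel_values) (use wh i in auto)
        then have "w * y (\<alpha> i) = w ^ Suc i * y (\<alpha> 0)" by simp
        ultimately show ?thesis by (simp add: w_pow_t)
      qed (simp add: wh)
      then have "u * (u * y (\<alpha> (Suc i mod t))) = (u * u * w) * y (\<alpha> i)" by simp
      then show "matched_x r k x y (r + \<alpha> i) = u * y (\<alpha> i) \<and> y (\<alpha> i) = u * matched_x r k x y (r + \<alpha> (Suc i mod t))"
        by (simp add: x[OF i] x[OF next_lt] uuw)
    qed (fact \<alpha>)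
    then show "leval x y (prefactor_poly r k s) * leval x y h = 0" using ph[OF nz] nz by (simp add: leval_prefactor_poly)
  next
    fix x y :: point assume "nz x" "nz y" "inj y" "\<And>i j. x i \<noteq> u * y j"
    then show "leval x y (prefactor_poly r k s) \<noteq> 0" by (simp add: leval_prefactor_poly prefactor_neq_0)
  qed
  moreover have "skew {..<r} {..<k} h"
    by (rule skewI) (auto intro: hX skewY_transpositions hZ)
  moreover have "skew {} {k..<k + s} h"
    by (rule skewI) (auto intro: hY)
  ultimately obtain W where W: "lz_numer n m W" "vanishing (Suc k) n m W"
    "\<And>x y. nz x \<Longrightarrow> nz y \<Longrightarrow> aligned r k x y \<Longrightarrow> leval x y W = prefactor r k s x y * leval x y h"
    using realize[OF h(1)] unfolding n m by blast
  have fW: "wheel_numer n m (f - W)" using wheel_numer_diff[OF f(1) lz_numer_imp_wheel_numer[OF W(1)]] .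
  have "vanishing k n m (f - W)"
    unfolding vanishing_def
  proof (intro allI impI)
    fix x y assume "matched k n m x y"
    then obtain \<alpha> \<beta> where nz: "nz x" "nz y" and \<alpha>: "inj_on \<alpha> {..<k}" "\<alpha> ` {..<k} \<subseteq> {..<n}"
      and \<beta>: "inj_on \<beta> {..<k}" "\<beta> ` {..<k} \<subseteq> {..<m}" and xy: "\<forall>i<k. x (\<alpha> i) = u * y (\<beta> i)"
      unfolding matched_def by blast
    obtain \<sigma>1 where \<sigma>1: "\<sigma>1 permutes {..<n}" "\<And>i. i < k \<Longrightarrow> \<sigma>1 i = r + i"
      by (rule extend_to_permutation[of "\<lambda>i. r + i" k n]) (auto simp: n)
    obtain \<sigma>2 where \<sigma>2: "\<sigma>2 permutes {..<n}" "\<And>i. i < k \<Longrightarrow> \<sigma>2 i = \<alpha> i"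
      using extend_to_permutation[OF \<alpha>] by blast
    obtain \<tau> where \<tau>: "\<tau> permutes {..<m}" "\<And>i. i < k \<Longrightarrow> \<tau> i = \<beta> i"
      using extend_to_permutation[OF \<beta>] by blast
    \<comment> \<open>\<open>\<sigma>1\<close> sends \<open>l\<close> to the aligned position
      \<open>r + l\<close> and \<open>\<sigma>2\<close> sends it to \<open>\<alpha> l\<close>; so
      \<open>\<sigma>\<close> carries the aligned positions to those of the given matching.\<close>
    define \<sigma> where "\<sigma> = \<sigma>2 \<circ> inv \<sigma>1"
    have \<sigma>: "\<sigma> permutes {..<n}" unfolding \<sigma>_def by (rule permutes_compose[OF permutes_inv[OF \<sigma>1(1)] \<sigma>2(1)])
    have \<sigma>r: "\<sigma> (r + l) = \<alpha> l" if "l < k" for l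
      using \<sigma>1(2)[OF that, symmetric] \<sigma>2(2)[OF that] permutes_inverses(2)[OF \<sigma>1(1)] by (simp add: \<sigma>_def)
    have al: "aligned r k (x \<circ> \<sigma>) (y \<circ> \<tau>)"
      using xy by (simp add: aligned_def \<sigma>r \<tau>(2))
    have "leval (matched_x r k (x \<circ> \<sigma>) (y \<circ> \<tau>)) (y \<circ> \<tau>) f = leval (x \<circ> \<sigma>) (y \<circ> \<tau>) f"
    proof (rule leval_cong[OF fs(1)])
      fix i assume "i < n"
      show "matched_x r k (x \<circ> \<sigma>) (y \<circ> \<tau>) i = (x \<circ> \<sigma>) i"
      proof (cases "r \<le> i")
        case True
        then obtain l where "i = r + l" using le_Suc_ex by blast
        then show ?thesis using al \<open>i < n\<close> by (simp add: matched_x_def aligned_def n)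
      qed (simp add: matched_x_def)
    qed simp
    then have "leval (x \<circ> \<sigma>) (y \<circ> \<tau>) (f - W) = 0"
      using W(3)[OF _ _ al] ph[of "x \<circ> \<sigma>" "y \<circ> \<tau>"] nz by simp
    moreover have "skew {..<n} {..<m} (f - W)" using fW by (simp add: wheel_numer_def)
    ultimately show "leval x y (f - W) = 0"
      using skewD[OF _ \<sigma> \<tau>(1) nz, of "f - W"] by (simp add: sign_def split: if_splits)
  qed
  then show ?thesis using W(1,2) by blast
qed

section \<open>Descent along the filtration\<close>

lemma vanishing_imp_lz_numer: "wheel_numer n m f \<Longrightarrow> vanishing k n m f \<Longrightarrow> lz_numer n m f"
proof (induction k arbitrary: f)
  case 0
  \<comment> \<open>Zero pairs are matched at every point, so the bottom of the filtration is
    0.\<close>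
  have "f = 0"
  proof (rule leval_eqI)
    fix x y :: point assume "nz x" "nz y"
    then have "matched 0 n m x y" by (auto simp: matched_def)
    then show "leval x y f = leval x y 0" using 0 by (simp add: vanishing_def)
  qed
  then show ?case by (simp add: lz_numer_0)
next
  case (Suc k)
  show ?case
  proof (cases "k \<le> n \<and> k \<le> m")
    case True
    then obtain W where W: "lz_numer n m W" "vanishing k n m (f - W)"
      using matching_step[OF Suc.prems] by blast
    have "lz_numer n m (f - W)" using Suc.IH wheel_numer_diff[OF Suc.prems(1) lz_numer_imp_wheel_numer[OF W(1)]] W(2) by blast
    then have "lz_numer n m (f - W + W)" using W(1) by (rule lz_numer_add)
    then show ?thesis by simp
  next
    case False
    then show ?thesis by (intro Suc.IH Suc.prems(1) vanishing_large) auto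
  qed
qed

text \<open>At most \<open>n\<close> disjoint pairs fit into bidegree \<open>(n, m)\<close>, so
  every numerator vanishes vacuously on \<open>Suc n\<close> pairs and the descent can start
  there.\<close>

lemma wheel_numer_imp_lz_numer: "wheel_numer n m f \<Longrightarrow> lz_numer n m f"
  by (rule vanishing_imp_lz_numer[where k = "Suc n"]) (auto intro: vanishing_large)

end

theorem theorem2p18:
  fixes t :: nat and v :: complex and F :: "nat \<times> nat \<Rightarrow>\<^sub>0 ratfun"
  assumes "t \<ge> 1"
    and "primitive_root_of_unity (2 * t) v"
    and "F \<in> shuffle_algebra"
  shows "F \<in> Lambda_zeta v \<longleftrightarrow> wheel_condition v t F"
proof -
  interpret wheel t v by standard (fact assms)+
  have comp: "\<exists>f. laurent_in n m f \<and> skew {..<n} {..<m} f \<and> lookup F (n, m) = quo n m f" for n m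
    using assms(3) by (auto simp: shuffle_algebra_def shuffle_component_iff)
  show ?thesis
  proof
    assume "F \<in> Lambda_zeta v"
    then have F: "F \<in> wheel_algebra" using Lambda_zeta_subset_wheel_algebra by blast
    show "wheel_condition v t F"
      unfolding wheel_condition_def
    proof (intro allI)
      fix n m
      obtain f where "wheel_numer n m f" "lookup F (n, m) = quo n m f"
        using F unfolding wheel_algebra_def by blast
      then show "wheel_component v t n m (lookup F (n, m))"
        by (simp add: wheel_numer_def wheel_component_quo)
    qed
  next
    assume wc: "wheel_condition v t F"
    \<comment> \<open>The wheel condition is imposed componentwise, so each component is realised
      separately; \<open>F\<close> is their finite sum.\<close>
    have "single p (lookup F p) \<in> Lambda_zeta v" for p
    proof -
      obtain n m where p: "p = (n, m)" by (cases p)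
      obtain f where f: "laurent_in n m f" "skew {..<n} {..<m} f" "lookup F (n, m) = quo n m f"
        using comp by blast
      moreover have "wheel_component v t n m (quo n m f)"
        using wc unfolding wheel_condition_def f(3)[symmetric] by blast
      ultimately have "wheel_numer n m f" by (simp add: wheel_component_quo wheel_numer_def)
      then have "lz_numer n m f" by (rule wheel_numer_imp_lz_numer)
      then show ?thesis by (simp add: lz_numer_def p f(3))
    qed
    then have "(\<Sum>p\<in>keys F. single p (lookup F p)) \<in> Lambda_zeta v"
      by (intro Lambda_zeta_sum)
    then show "F \<in> Lambda_zeta v" by (simp flip: poly_mapping_expand)
  qed
qed

end
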